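(* There exist constants $C,c>0$ independent of $\nu,k,B,\lambda,R$ such that the following holds for all $\nu>0$, $B\in\mathbb{R}\setminus\{0\}$, $R>1$, $k\in\mathbb Z$ with $|k|\ge1$, $\lambda\in\mathbb R$, $w\in D_k$ and every $0\le c'\le c$. Let $$F=-\nu\Big(\partial_r^2-\frac{k^2-\frac14}{r^2}\Big)w+ikB\Big(\frac1{r^2}-\lambda\Big)w,$$ and let $\varphi$ solve $\big(\partial_r^2-\frac{k^2-1/4}{r^2}\big)\varphi=w$ on $[1,R]$, $\varphi|_{r=1,R}=0$. Then $$\nu^{2/3}|kB|^{1/3}\|w'\|_{L^2}+\nu^{1/3}|kB|^{2/3}\Big\|\frac wr\Big\|_{L^2}\le C\Big\|rF-c'\nu^{1/3}|kB|^{2/3}\frac wr\Big\|_{L^2},$$ $$\nu^{1/6}|kB|^{5/6}|k|^{1/2}\Big(\|\varphi'\|_{L^2}+|k|\Big\|\frac\varphi r\Big\|_{L^2}\Big)\le CR^2\Big(\Big(\frac{\nu}{|kB|}\Big)^{1/6}(\log R)^{1/2}+1\Big)\Big\|rF-c'\nu^{1/3}|kB|^{2/3}\frac wr\Big\|_{L^2}.$$ Moreover, $$\nu\|w\|_{H^1_r}+\nu^{2/3}|kB|^{1/3}\Big\|\frac wr\Big\|_{L^2}\le C\big\|F-c'\nu^{1/3}|kB|^{2/3}R^{-2}w\big\|_{H^{-1}_r},$$ $$\nu^{1/2}|kB|^{1/2}\|\varphi'\|_{L^2}+\nu^{1/2}|k||kB|^{1/2}\Big\|\frac\varphi r\Big\|_{L^2}\le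 CR^2\big\|F-c'\nu^{1/3}|kB|^{2/3}R^{-2}w\big\|_{H^{-1}_r}.$$
   Context: $L^2=L^2([1,R],dr)$ (complex-valued functions) with inner product $\langle f,g\rangle=\int_1^R f\bar g\,dr$; $'$ denotes $\partial_r$. $D_k$ is the domain of the operator $-\nu(\partial_r^2-\frac{k^2-1/4}{r^2})+i\frac{kB}{r^2}$ on $L^2([1,R])$ with Dirichlet conditions, i.e. $w\in L^2$ with $\partial_r^2w,\ w/r^2\in L^2$ and $w|_{r=1,R}=0$. The norms are $\|f\|_{H^1_r}^2=\|f'\|_{L^2}^2+\|f/r\|_{L^2}^2$ and $\|f\|_{H^{-1}_r}=\sup_{\|g\|_{H^1_r}\le1}|\langle f,g\rangle|$. *)

theory Defs
  imports "HOL-Analysis.Analysis"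
begin

text \<open>
  Elements of \<open>L\<^sup>2([1,R],dr)\<close> are represented by functions \<open>real \<Rightarrow> complex\<close>; only their values
  on \<open>{1..R}\<close> (almost everywhere) matter.  All derivatives are weak derivatives on \<open>(1,R)\<close>.
\<close>

definition L2 :: "real \<Rightarrow> (real \<Rightarrow> complex) set" where
  "L2 R = {f. f \<in> borel_measurable (lebesgue_on {1..R}) \<and>
              integrable (lebesgue_on {1..R}) (\<lambda>r. (cmod (f r))\<^sup>2)}"

definition inner_L2 :: "real \<Rightarrow> (real \<Rightarrow> complex) \<Rightarrow> (real \<Rightarrow> complex) \<Rightarrow> complex" where
  "inner_L2 R f g = integral\<^sup>L (lebesgue_on {1..R}) (\<lambda>r. f r * cnj (g r))"

definition norm_L2 :: "real \<Rightarrow> (real \<Rightarrow> complex) \<Rightarrow> real" where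
  "norm_L2 R f = sqrt (integral\<^sup>L (lebesgue_on {1..R}) (\<lambda>r. (cmod (f r))\<^sup>2))"

text \<open>
  Weak derivatives are tested against \<open>C\<^sup>1\<close> functions with compact support in \<open>(1,R)\<close>, which
  in dimension one gives the same notion as \<open>C\<^sup>\<infinity>\<close> test functions.
\<close>

definition test_fun :: "real \<Rightarrow> (real \<Rightarrow> complex) \<Rightarrow> (real \<Rightarrow> complex) \<Rightarrow> bool" where
  "test_fun R \<eta> \<eta>' \<longleftrightarrow>
     (\<forall>x. (\<eta> has_vector_derivative \<eta>' x) (at x)) \<and> continuous_on UNIV \<eta>' \<and>
     (\<exists>a b. 1 < a \<and> a \<le> b \<and> b < R \<and> (\<forall>x. x \<notin> {a..b} \<longrightarrow> \<eta> x = 0))"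

definition is_weak_deriv :: "real \<Rightarrow> (real \<Rightarrow> complex) \<Rightarrow> (real \<Rightarrow> complex) \<Rightarrow> bool" where
  "is_weak_deriv R f g \<longleftrightarrow>
     (\<forall>\<eta> \<eta>'. test_fun R \<eta> \<eta>' \<longrightarrow>
        integral\<^sup>L (lebesgue_on {1..R}) (\<lambda>r. f r * \<eta>' r) =
        - integral\<^sup>L (lebesgue_on {1..R}) (\<lambda>r. g r * \<eta> r))"

definition H1 :: "real \<Rightarrow> (real \<Rightarrow> complex) set" where
  "H1 R = {f \<in> L2 R. \<exists>g \<in> L2 R. is_weak_deriv R f g}"

text \<open>
  For \<open>f \<in> H1 R\<close>, \<open>wderiv R f\<close> is some representative of the weak derivative of \<open>f\<close>; the weak
  derivative is unique up to null sets, so the choice does not affect anything below.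
\<close>

definition wderiv :: "real \<Rightarrow> (real \<Rightarrow> complex) \<Rightarrow> (real \<Rightarrow> complex)" where
  "wderiv R f = (SOME g. g \<in> L2 R \<and> is_weak_deriv R f g)"

definition norm_H1r :: "real \<Rightarrow> (real \<Rightarrow> complex) \<Rightarrow> real" where
  "norm_H1r R f =
     sqrt ((norm_L2 R (wderiv R f))\<^sup>2 + (norm_L2 R (\<lambda>r. f r / of_real r))\<^sup>2)"

text \<open>
  The test functions \<open>g\<close> carry no boundary condition.  For \<open>f \<in> L2 R\<close> the set is bounded by
  \<open>R * norm_L2 R f\<close>, so the real supremum is meaningful.
\<close>

definition norm_Hm1r :: "real \<Rightarrow> (real \<Rightarrow> complex) \<Rightarrow> real" where
  "norm_Hm1r R f = Sup {cmod (inner_L2 R f g) | g. g \<in> H1 R \<and> norm_H1r R g \<le> 1}"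

text \<open>
  The domain \<open>D\<^sub>k\<close>; as a set it does not depend on \<open>k\<close>.  An element is given by its continuous
  representative, so that the boundary values make sense.
\<close>

definition dom_D :: "real \<Rightarrow> (real \<Rightarrow> complex) set" where
  "dom_D R = {w. w \<in> H1 R \<and> wderiv R w \<in> H1 R \<and> (\<lambda>r. w r / (of_real r)\<^sup>2) \<in> L2 R \<and>
                 continuous_on {1..R} w \<and> w 1 = 0 \<and> w R = 0}"

definition Delta_k :: "real \<Rightarrow> int \<Rightarrow> (real \<Rightarrow> complex) \<Rightarrow> (real \<Rightarrow> complex)" where
  "Delta_k R k w = (\<lambda>r. wderiv R (wderiv R w) r
                        - of_real (((of_int k)\<^sup>2 - 1/4) / r\<^sup>2) * w r)"

definition resolvent_F ::
  "real \<Rightarrow> real \<Rightarrow> int \<Rightarrow> real \<Rightarrow> real \<Rightarrow> (real \<Rightarrow> complex) \<Rightarrow> (real \<Rightarrow> complex)" where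
  "resolvent_F R \<nu> k B lam w = (\<lambda>r. - of_real \<nu> * Delta_k R k w r
      + \<i> * of_int k * of_real B * of_real (1 / r\<^sup>2 - lam) * w r)"

definition solves_stream :: "real \<Rightarrow> int \<Rightarrow> (real \<Rightarrow> complex) \<Rightarrow> (real \<Rightarrow> complex) \<Rightarrow> bool" where
  "solves_stream R k w \<phi> \<longleftrightarrow>
     \<phi> \<in> dom_D R \<and> (AE r in lebesgue_on {1..R}. Delta_k R k \<phi> r = w r)"

end

(* With K = |kB| and eta = (nu/K)^(1/3), divide the equation by K and write s = 1 - lam r^2, so that
  1/r^2 - lam = s/r^2 and the critical layer is {|s| < eta}.  Testing with w gives the energy
  estimate.  Testing with the smooth multiplier eta s/(s^2 + eta^2) times w and taking the imaginary
  part controls |w/r| off the layer; this kills the c'-term, which is real.  On the layer,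
  eta^2/(s^2 + eta^2) times |u|^2/r^2 is integrated by parts against a primitive arctan(s/eta), at the
  price of 8 eta (|u'| + |u/r|) |u/r| for every u vanishing at both ends.  For phi, split
  1 = s^2/(s^2 + eta^2) + eta^2/(s^2 + eta^2) in <w, phi> and rewrite the first part through the
  equation tested with r^2 s/(s^2 + eta^2) phi.  If eta |k| >= 1/16 the energy estimate alone suffices.
*)

theory Submission
  imports Defs
begin

section \<open>Weak derivatives on an interval\<close>

text \<open>The width \<eta> = (\<nu>/K)^(1/3) is the one at which the losses balance. The
  multiplier has slope of order 1/\<eta>, so its commutator with the diffusion of size \<eta>^3
  costs, after division by \<eta>, a multiple of \<eta> |w'| |w/r|: the same order as the price of
  the layer. A smooth multiplier instead of the sign of s leaves no terms at the edges of the layer,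
  so every step tests with a C^1 function that vanishes at both ends. The estimates form a loop:
  energy bounds |w'| by |w/r|, the layer bounds |w/r| by |w'|. In the energy estimate the c'-term
  survives, and it comes back multiplied by the square of the constant of the loop (22^2 = 484); c'
  at most 1/4000 keeps this below 1. In the H^-1 case the derivative of the multiplier, of order
  1/\<eta>, also meets the forcing, which costs one more power of \<eta>. The factor R^2 for
  \<open>\<phi>\<close> arises because the weight r^2 is needed to cancel the 1/r^2 of the transport
  term. The definitions give only weak derivatives, so C^1 representatives of \<open>w\<close> and
  \<open>\<phi>\<close> have to be produced before anything can be tested.\<close>

abbreviation leb :: "real \<Rightarrow> real measure" where "leb R \<equiv> lebesgue_on {1..R}"

text \<open>The indicator keeps the domain of integration fixed: the value makes sense for every
  real \<open>x\<close>, the half-lines \<open>{..x}\<close> generate the Borel sets, and Fubini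
  applies on the square.\<close>

definition prim :: "real \<Rightarrow> (real \<Rightarrow> complex) \<Rightarrow> real \<Rightarrow> complex" where
  "prim R h x = (LINT t|leb R. indicator {..x} t *\<^sub>R h t)"

text \<open>The derivative is an explicit argument, so that concrete formulas can be used in place
  of the representative chosen by \<open>wderiv\<close>. At the endpoints it is one-sided.\<close>

definition C1_on :: "real \<Rightarrow> (real \<Rightarrow> complex) \<Rightarrow> (real \<Rightarrow> complex) \<Rightarrow> bool" where
  "C1_on R f f' \<longleftrightarrow> continuous_on {1..R} f' \<and>
     (\<forall>x\<in>{1..R}. (f has_vector_derivative f' x) (at x within {1..R}))"

lemma borel_id_lebesgue_on [measurable]: "(\<lambda>x. x) \<in> borel_measurable (lebesgue_on S)"
  by (rule measurable_restrict_space1, rule measurable_completion) simp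

lemma sigma_finite_lebesgue_on_interval: "sigma_finite_measure (lebesgue_on {a..b::real})"
  by (rule finite_measure.axioms(1), rule finite_measure_lebesgue_on) simp

lemma integrable_indicator_leb:
  assumes "integrable (leb R) (h :: real \<Rightarrow> complex)" "A \<in> sets borel"
  shows "integrable (leb R) (\<lambda>t. indicator A t *\<^sub>R h t)"
proof -
  have "A \<inter> {1..R} \<in> sets (leb R)"
    using assms(2) by (subst sets_restrict_space_iff) auto
  then have "integrable (leb R) (\<lambda>t. indicator (A \<inter> {1..R}) t *\<^sub>R h t)"
    using assms(1) by (rule integrable_mult_indicator)
  then show ?thesis
    by (rule Bochner_Integration.integrable_cong[THEN iffD1, rotated 2]) (auto simp: indicator_def)
qed

text \<open>The Borel sets over which \<open>h\<close> integrates to 0 form a Dynkin system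
  containing the half-lines, which are stable under intersection; hence they are all the Borel
  sets.\<close>

lemma AE_zero_if_segment_integrals_zero:
  fixes h :: "real \<Rightarrow> complex"
  assumes h: "integrable (leb R) h" and z: "\<And>x. prim R h x = 0"
  shows "AE r in leb R. h r = 0"
proof (rule sigma_finite_measure.density_zero[OF sigma_finite_lebesgue_on_interval h])
  have borel: "(LINT t|leb R. indicator A t *\<^sub>R h t) = 0" if "A \<in> sets borel" for A
  proof -
    have eq: "sets borel = sigma_sets UNIV (range (\<lambda>a::real. {..a}))"
      by (subst borel_eq_atMost) simp
    have "A \<in> sigma_sets UNIV (range (\<lambda>a::real. {..a}))" using that eq by auto
    have IS: "Int_stable (range (\<lambda>a::real. {..a}))"
      by (auto simp: Int_stable_def)
    have Pow: "range (\<lambda>a::real. {..a}) \<subseteq> Pow UNIV" by simp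
    from \<open>A \<in> sigma_sets _ _\<close> show ?thesis
    proof (induction rule: sigma_sets_induct_disjoint[OF IS Pow, consumes 1])
      fix X assume "X \<in> range (\<lambda>a::real. {..a})"
      then show "(LINT t|leb R. indicator X t *\<^sub>R h t) = 0"
        using z by (auto simp: prim_def)
    next
      show "(LINT t|leb R. indicator {} t *\<^sub>R h t) = 0" by simp
    next
      fix X assume X: "X \<in> sigma_sets UNIV (range (\<lambda>a::real. {..a}))"
        "(LINT t|leb R. indicator X t *\<^sub>R h t) = 0"
      \<comment> \<open>The half-line \<open>{..R}\<close> covers the whole space, so the total
        integral is 0 as well; this gives closure under complements.\<close>
      have "(LINT t|leb R. h t) = prim R h R"
        unfolding prim_def by (rule Bochner_Integration.integral_cong) auto
      then have 0: "(LINT t|leb R. h t) = 0" using z by simp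
      have "(LINT t|leb R. indicator (UNIV - X) t *\<^sub>R h t)
          = (LINT t|leb R. h t - indicator X t *\<^sub>R h t)"
        by (rule Bochner_Integration.integral_cong) (auto simp: indicator_def)
      also have "\<dots> = 0"
        using X 0 h eq by (subst Bochner_Integration.integral_diff) (auto intro: integrable_indicator_leb)
      finally show "(LINT t|leb R. indicator (UNIV - X) t *\<^sub>R h t) = 0" .
    next
      fix X :: "nat \<Rightarrow> real set"
      assume X: "disjoint_family X" "range X \<subseteq> sigma_sets UNIV (range (\<lambda>a::real. {..a}))"
        "\<And>i. (LINT t|leb R. indicator (X i) t *\<^sub>R h t) = 0"
      let ?Y = "\<lambda>i. X i \<inter> {1..R}"
      have Xb: "X i \<in> sets borel" for i using X(2) eq by auto
      have ind: "indicator (A \<inter> {1..R}) t *\<^sub>R h t = indicator A t *\<^sub>R h t"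
        if "t \<in> space (leb R)" for t A using that by (auto simp: indicator_def)
      have Y: "?Y i \<in> sets (leb R)" for i
        using Xb[of i] by (subst sets_restrict_space_iff) auto
      have U: "(\<Union>i. ?Y i) = (\<Union>i. X i) \<inter> {1..R}" by auto
      have "(LINT t:(\<Union>i. ?Y i)|leb R. h t) = (\<Sum>i. (LINT t:(?Y i)|leb R. h t))"
      proof (rule lebesgue_integral_countable_add)
        show "set_integrable (leb R) (\<Union>i. ?Y i) h"
          unfolding set_integrable_def using Y h
          by (intro integrable_mult_indicator sets.countable_UN) auto
        show "?Y i \<inter> ?Y j = {}" if "i \<noteq> j" for i j
          using X(1) that unfolding disjoint_family_on_def by blast
      qed (rule Y)
      moreover have "(LINT t:(?Y i)|leb R. h t) = 0" for i
        using X(3)[of i] unfolding set_lebesgue_integral_def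
        by (subst Bochner_Integration.integral_cong[OF refl ind]) auto
      moreover have "(LINT t:(\<Union>i. ?Y i)|leb R. h t) = (LINT t|leb R. indicator (\<Union>i. X i) t *\<^sub>R h t)"
        unfolding set_lebesgue_integral_def U
        by (rule Bochner_Integration.integral_cong[OF refl ind])
      ultimately show "(LINT t|leb R. indicator (\<Union>i. X i) t *\<^sub>R h t) = 0" by simp
    qed
  qed
  fix A assume A: "A \<in> sets (leb R)"
  then have AL: "A \<in> sets lebesgue" by (auto simp: sets_restrict_space)
  \<comment> \<open>A Lebesgue set differs from a Borel set by a null set, which does not change the
    integral.\<close>
  obtain S N N' where N: "A = S \<union> N" "N \<subseteq> N'" "N' \<in> null_sets lborel" "S \<in> sets lborel"
    using AL by (rule sets_completionE)
  have "AE t in leb R. indicator A t *\<^sub>R h t = indicator S t *\<^sub>R h t"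
  proof (subst AE_restrict_space_iff, simp)
    have "AE t in lebesgue. t \<notin> N'" using N(3) by (auto intro!: AE_not_in null_sets_completionI)
    then show "AE t in lebesgue. t \<in> {1..R} \<longrightarrow> indicator A t *\<^sub>R h t = indicator S t *\<^sub>R h t"
      by eventually_elim (use N in \<open>auto simp: indicator_def\<close>)
  qed
  then have "(LINT t|leb R. indicator A t *\<^sub>R h t) = (LINT t|leb R. indicator S t *\<^sub>R h t)"
    using A N h by (intro integral_cong_AE borel_measurable_integrable integrable_mult_indicator
        integrable_indicator_leb) auto
  with borel[of S] N(4) show "set_lebesgue_integral (leb R) A h = 0"
    by (simp add: set_lebesgue_integral_def)
qed

lemma C1_onD:
  assumes "C1_on R f f'"
  shows "continuous_on {1..R} f" "continuous_on {1..R} f'"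
  using assms unfolding C1_on_def
  by (auto intro: continuous_on_vector_derivative)

lemma integral_leb_eqI:
  assumes "(f has_integral I) {1..R}" "integrable (leb R) (f :: real \<Rightarrow> complex)"
  shows "integral\<^sup>L (leb R) f = I"
  using has_integral_integral_lebesgue_on[OF assms(2)] assms(1) has_integral_unique by auto

lemma integral_C1_on:
  assumes "C1_on R f f'" "1 \<le> R"
  shows "integral\<^sup>L (leb R) f' = f R - f 1"
  using assms unfolding C1_on_def
  by (intro integral_leb_eqI fundamental_theorem_of_calculus continuous_imp_integrable_real) auto

lemma integral_C1_on_tail:
  assumes "C1_on R f f'" "t \<in> {1..R}"
  shows "(LINT s|leb R. indicator {t..} s *\<^sub>R f' s) = f R - f t"
proof (rule integral_leb_eqI)
  show "integrable (leb R) (\<lambda>s. indicator {t..} s *\<^sub>R f' s)"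
    using assms unfolding C1_on_def by (intro integrable_indicator_leb continuous_imp_integrable_real) auto
  have "(f' has_integral (f R - f t)) {t..R}"
    using assms unfolding C1_on_def
    by (intro fundamental_theorem_of_calculus)
      (auto intro: has_vector_derivative_within_subset[where S="{1..R}"])
  then have "((\<lambda>s. if s \<in> {t..R} then f' s else 0) has_integral (f R - f t)) {1..R}"
    using assms by (subst has_integral_restrict) auto
  then show "((\<lambda>s. indicator {t..} s *\<^sub>R f' s) has_integral (f R - f t)) {1..R}"
    by (rule has_integral_eq[rotated]) (auto simp: indicator_def)
qed

lemma prim_eq_integral:
  assumes "integrable (leb R) h" "x \<in> {1..R}"
  shows "prim R h x = integral {1..x} h"
  unfolding prim_def
proof (rule integral_leb_eqI)
  show "integrable (leb R) (\<lambda>s. indicator {..x} s *\<^sub>R h s)"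
    using assms by (intro integrable_indicator_leb) auto
  have "h integrable_on {1..R}" using assms by (intro integrable_on_lebesgue_on) auto
  then have "h integrable_on {1..x}" using assms by (auto intro: integrable_on_subinterval)
  then have "(h has_integral integral {1..x} h) {1..x}" by auto
  then have "((\<lambda>s. if s \<in> {1..x} then h s else 0) has_integral integral {1..x} h) {1..R}"
    using assms by (subst has_integral_restrict) auto
  then show "((\<lambda>s. indicator {..x} s *\<^sub>R h s) has_integral integral {1..x} h) {1..R}"
    by (rule has_integral_eq[rotated]) (auto simp: indicator_def)
qed

lemma prim_1 [simp]: "prim R h 1 = 0" if "integrable (leb R) h" "1 \<le> R"
  using that by (subst prim_eq_integral) auto

lemma continuous_on_prim:
  assumes "integrable (leb R) h"
  shows "continuous_on {1..R} (prim R h)"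
proof -
  have "h integrable_on {1..R}" using assms by (intro integrable_on_lebesgue_on) auto
  then have "continuous_on {1..R} (\<lambda>x. integral {1..x} h)" by (rule indefinite_integral_continuous_1)
  then show ?thesis by (subst continuous_on_cong[OF refl prim_eq_integral]) (use assms in auto)
qed

lemma C1_on_prim:
  assumes "continuous_on {1..R} h"
  shows "C1_on R (prim R h) h"
  unfolding C1_on_def
proof (intro conjI ballI assms)
  fix x assume x: "x \<in> {1..R}"
  have i: "integrable (leb R) h" using assms by (rule continuous_imp_integrable_real)
  have "((\<lambda>x. integral {1..x} h) has_vector_derivative h x) (at x within {1..R})"
    using assms x by (rule integral_has_vector_derivative)
  then show "(prim R h has_vector_derivative h x) (at x within {1..R})"
    by (rule has_vector_derivative_transform[OF x, rotated]) (auto simp: prim_eq_integral i)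
qed

lemma integrable_mult_continuous:
  assumes h: "integrable (leb R) h" and c: "continuous_on {1..R} (p :: real \<Rightarrow> complex)"
  shows "integrable (leb R) (\<lambda>r. h r * p r)"
proof -
  have "bounded (p ` {1..R})" using c by (intro compact_imp_bounded compact_continuous_image) auto
  then obtain K where K: "\<And>x. x \<in> {1..R} \<Longrightarrow> norm (p x) \<le> K" unfolding bounded_iff by blast
  show ?thesis
  proof (rule Bochner_Integration.integrable_bound)
  show "integrable (leb R) (\<lambda>t. K *\<^sub>R h t)" using h by simp
  show "AE x in leb R. cmod (h x * p x) \<le> cmod (K *\<^sub>R h x)"
  proof (rule AE_I2)
    fix x assume "x \<in> space (leb R)"
    then have "norm (p x) \<le> K" using K by auto
    then show "cmod (h x * p x) \<le> cmod (K *\<^sub>R h x)"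
      by (simp add: norm_mult) (metis abs_ge_self mult.commute mult_right_mono norm_ge_zero order_trans)
  qed
  have "integrable (leb R) p" using c by (rule continuous_imp_integrable_real)
  then show "(\<lambda>r. h r * p r) \<in> borel_measurable (leb R)" using h by measurable
  qed
qed

text \<open>Fubini on the triangle t \<le> s. No regularity of \<open>h\<close> beyond integrability
  enters, which is what second weak derivatives require.\<close>

lemma integral_prim_by_parts:
  assumes G: "C1_on R G G'" and h: "integrable (leb R) h" and R: "1 \<le> R"
  shows "(LINT s|leb R. prim R h s * G' s) = G R * prim R h R - (LINT t|leb R. h t * G t)"
proof -
  interpret pair_sigma_finite "leb R" "leb R"
    by (intro pair_sigma_finite.intro sigma_finite_lebesgue_on_interval)
  have cont: "continuous_on {1..R} G'" "continuous_on {1..R} G" using C1_onD[OF G] by auto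
  have iG': "integrable (leb R) G'" using cont by (intro continuous_imp_integrable_real)
  have iG: "integrable (leb R) G" using cont by (intro continuous_imp_integrable_real)
  have [measurable]: "G' \<in> borel_measurable (leb R)" "h \<in> borel_measurable (leb R)"
    "G \<in> borel_measurable (leb R)"
    using iG' h iG by auto
  have prod: "integrable (leb R \<Otimes>\<^sub>M leb R) (\<lambda>(s,t). G' s * h t)"
  proof (rule Fubini_integrable)
    show "integrable (leb R) (\<lambda>s. LINT t|leb R. norm (case (s, t) of (s, t) \<Rightarrow> G' s * h t))"
      using iG' by (simp add: norm_mult)
  qed (use h in auto)
  have int: "integrable (leb R \<Otimes>\<^sub>M leb R) (\<lambda>(s,t). indicator {..s} t *\<^sub>R (G' s * h t))"
    (is "integrable _ ?f")
  proof (rule Bochner_Integration.integrable_bound[OF prod])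
    have "?f = (\<lambda>x. (if snd x \<le> fst x then G' (fst x) * h (snd x) else 0))"
      by (auto simp: indicator_def)
    then show "?f \<in> borel_measurable (leb R \<Otimes>\<^sub>M leb R)" by simp
  qed (auto simp: indicator_def)
  have ihG: "integrable (leb R) (\<lambda>t. h t * G t)" using h cont(2) by (rule integrable_mult_continuous)
  have "(LINT s|leb R. prim R h s * G' s) = (LINT s|leb R. (LINT t|leb R. indicator {..s} t *\<^sub>R (G' s * h t)))"
  proof (rule Bochner_Integration.integral_cong[OF refl])
    fix s
    have "(LINT t|leb R. indicator {..s} t *\<^sub>R (G' s * h t)) = (LINT t|leb R. G' s * (indicator {..s} t *\<^sub>R h t))"
      by (rule Bochner_Integration.integral_cong) auto
    also have "\<dots> = G' s * prim R h s"
      unfolding prim_def by (rule integral_mult_right_zero)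
    finally show "prim R h s * G' s = (LINT t|leb R. indicator {..s} t *\<^sub>R (G' s * h t))" by simp
  qed
  also have "\<dots> = (LINT t|leb R. (LINT s|leb R. indicator {..s} t *\<^sub>R (G' s * h t)))"
    using int by (rule Fubini_integral[symmetric])
  also have "\<dots> = (LINT t|leb R. h t * (G R - G t))"
  proof (rule Bochner_Integration.integral_cong[OF refl])
    fix t assume "t \<in> space (leb R)"
    then have t: "t \<in> {1..R}" by simp
    have "(LINT s|leb R. indicator {..s} t *\<^sub>R (G' s * h t)) = (LINT s|leb R. h t * (indicator {t..} s *\<^sub>R G' s))"
      by (rule Bochner_Integration.integral_cong) (auto simp: indicator_def)
    also have "\<dots> = h t * (G R - G t)"
      by (subst integral_mult_right_zero) (simp add: integral_C1_on_tail[OF G t])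
    finally show "(LINT s|leb R. indicator {..s} t *\<^sub>R (G' s * h t)) = h t * (G R - G t)" .
  qed
  also have "\<dots> = (LINT t|leb R. G R * h t - h t * G t)"
    by (rule Bochner_Integration.integral_cong) (auto simp: algebra_simps)
  also have "\<dots> = G R * (LINT t|leb R. h t) - (LINT t|leb R. h t * G t)"
    using h ihG by (subst Bochner_Integration.integral_diff) auto
  also have "(LINT t|leb R. h t) = prim R h R"
    unfolding prim_def by (rule Bochner_Integration.integral_cong) auto
  finally show ?thesis .
qed

text \<open>Trapezoids that increase to the indicator of (1,x): 0 where the distance to the
  endpoints is at most 1/n, 1 where it is at least 2/n. Continuity is enough, because they serve as
  derivatives of test functions and not as test functions.\<close>

definition bump :: "real \<Rightarrow> nat \<Rightarrow> real \<Rightarrow> complex" where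
  "bump x n r = of_real (max 0 (min 1 (real n * min (r - 1) (x - r) - 1)))"

definition compactly_supported :: "real \<Rightarrow> (real \<Rightarrow> complex) \<Rightarrow> bool" where
  "compactly_supported R \<psi> \<longleftrightarrow> continuous_on UNIV \<psi> \<and> (\<exists>e>0. \<forall>x. x \<notin> {1+e..R-e} \<longrightarrow> \<psi> x = 0)"

lemma compactly_supported_bump:
  assumes "x \<le> R"
  shows "compactly_supported R (bump x n)"
  unfolding compactly_supported_def
\<comment> \<open>The margin 1/(n+1) instead of 1/n also covers n = 0.\<close>
proof (intro conjI exI[of _ "1 / real (Suc n)"] allI impI)
  show "continuous_on UNIV (bump x n)"
    unfolding bump_def by (intro continuous_intros)
  fix r assume r: "r \<notin> {1 + 1 / real (Suc n)..R - 1 / real (Suc n)}"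
  then have "min (r - 1) (x - r) < 1 / real (Suc n)" using assms by auto
  then have "real n * min (r - 1) (x - r) \<le> real n * (1 / real (Suc n))"
    by (intro mult_left_mono) auto
  also have "\<dots> \<le> 1" by (simp add: field_simps)
  finally show "bump x n r = 0" by (simp add: bump_def max_def)
qed simp

lemma bump_tendsto:
  assumes "1 < r" "r \<noteq> x"
  shows "(\<lambda>n. bump x n r) \<longlonglongrightarrow> indicator {..x} r"
proof (cases "r < x")
  case True
  define d where "d = min (r - 1) (x - r)"
  have d: "d > 0" using True assms by (simp add: d_def)
  have "eventually (\<lambda>n. bump x n r = indicator {..x} r) sequentially"
  proof (rule eventually_sequentiallyI[of "nat \<lceil>2 / d\<rceil>"])
    fix n assume "nat \<lceil>2 / d\<rceil> \<le> n"
    then have "2 / d \<le> real n" by linarith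
    then have "real n * d - 1 \<ge> 1" using d by (simp add: field_simps)
    then show "bump x n r = indicator {..x} r"
      using True unfolding bump_def d_def[symmetric] by (simp add: max_def)
  qed
  then show ?thesis by (rule tendsto_eventually)
next
  case False
  have "bump x n r = 0" for n
  proof -
    have "real n * min (r - 1) (x - r) \<le> 0" using False assms by (simp add: mult_nonneg_nonpos)
    then show ?thesis by (simp add: bump_def max_def)
  qed
  then show ?thesis using False assms by simp
qed

text \<open>Dominated convergence with majorant |h|. The bump vanishes at 1 and at \<open>x\<close>,
  where the indicator may be 1; these two points are removed as a null set.\<close>

lemma integral_bump_tendsto:
  assumes h: "integrable (leb R) h" and R: "1 < R"
  shows "(\<lambda>n. LINT r|leb R. h r * bump x n r) \<longlonglongrightarrow> prim R h x"
  unfolding prim_def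
proof (rule integral_dominated_convergence)
  have ae: "AE r in leb R. 1 < r \<and> r \<noteq> x"
  proof (subst AE_restrict_space_iff, simp)
    have "AE r in lebesgue. r \<notin> {1, x}"
      by (intro AE_not_in null_sets_completionI) (simp add: finite_imp_null_set_lborel)
    then show "AE r in lebesgue. r \<in> {1..R} \<longrightarrow> 1 < r \<and> r \<noteq> x"
      by eventually_elim auto
  qed
  then show "AE r in leb R. (\<lambda>n. h r * bump x n r) \<longlonglongrightarrow> indicator {..x} r *\<^sub>R h r"
  proof eventually_elim
    case (elim r)
    then have "(\<lambda>n. h r * bump x n r) \<longlonglongrightarrow> h r * indicator {..x} r"
      by (intro tendsto_intros bump_tendsto) auto
    then show ?case by (cases "r \<le> x") (auto simp: indicator_def)
  qed
  show "(\<lambda>r. indicator {..x} r *\<^sub>R h r) \<in> borel_measurable (leb R)"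
    using h by (intro borel_measurable_integrable integrable_indicator_leb) auto
  show "(\<lambda>r. h r * bump x n r) \<in> borel_measurable (leb R)" for n
    using h unfolding bump_def by measurable
  show "integrable (leb R) (\<lambda>r. norm (h r))" using h by simp
  show "AE r in leb R. norm (h r * bump x n r) \<le> norm (h r)" for n
  proof (rule AE_I2)
    fix r
    have "norm (bump x n r) \<le> 1" by (simp add: bump_def)
    then show "norm (h r * bump x n r) \<le> norm (h r)"
      by (simp add: norm_mult mult_left_le)
  qed
qed

section \<open>Test functions with prescribed derivative and the lemma of du Bois-Reymond\<close>

lemma test_fun_C1_on:
  assumes "test_fun R \<eta> \<eta>'"
  shows "C1_on R \<eta> \<eta>'" "\<eta> 1 = 0" "\<eta> R = 0"
proof -
  show "C1_on R \<eta> \<eta>'" using assms unfolding C1_on_def test_fun_def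
    by (auto intro: continuous_on_subset has_vector_derivative_at_within)
  obtain a b where "1 < a" "a \<le> b" "b < R" "\<And>x. x \<notin> {a..b} \<Longrightarrow> \<eta> x = 0"
    using assms unfolding test_fun_def by blast
  then show "\<eta> 1 = 0" "\<eta> R = 0" by auto
qed

lemma integral_leb_eq:
  assumes "continuous_on {1..R} (f :: real \<Rightarrow> complex)"
  shows "integral\<^sup>L (leb R) f = integral {1..R} f"
  using assms by (intro integral_leb_eqI integrable_integral integrable_continuous_interval
      continuous_imp_integrable_real)

text \<open>The antiderivative is 0 to the left of the support of \<psi> and constant to its right;
  mean zero makes that constant 0.\<close>

lemma test_fun_antideriv:
  assumes \<psi>: "compactly_supported R \<psi>" and 0: "integral\<^sup>L (leb R) \<psi> = 0" and R: "1 < R"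
  shows "\<exists>\<eta>. test_fun R \<eta> \<psi>"
proof -
  obtain e0 where e0: "e0 > 0" "\<And>x. x \<notin> {1+e0..R-e0} \<Longrightarrow> \<psi> x = 0" and c: "continuous_on UNIV \<psi>"
    using \<psi> unfolding compactly_supported_def by blast
  \<comment> \<open>Shrinking the margin to at most (R-1)/2 keeps \<open>{1+e..R-e}\<close>
    nonempty, as \<open>test_fun\<close> demands.\<close>
  define e where "e = min e0 ((R - 1) / 2)"
  have e: "e > 0" "1 + e \<le> R - e" using e0 R by (auto simp: e_def min_def field_simps)
  have z: "\<psi> x = 0" if "x \<notin> {1+e..R-e}" for x
    using that by (intro e0) (auto simp: e_def)
  \<comment> \<open>Integration starts at 0 rather than 1, so that every x \<ge> 1 is interior to
    \<open>{0..x+1}\<close> and the derivative there is two-sided.\<close>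
  define \<eta> where "\<eta> x = integral {0..x} \<psi>" for x
  have ci: "continuous_on S \<psi>" for S using c continuous_on_subset by blast
  have int: "\<psi> integrable_on {a..b}" for a b by (intro integrable_continuous_interval ci)
  have int0: "integral {a..b} \<psi> = 0" if "\<And>x. x \<in> {a..b} \<Longrightarrow> \<psi> x = 0" for a b
    using Henstock_Kurzweil_Integration.integral_cong[of "{a..b}" \<psi> "\<lambda>_. 0"] that by simp
  have lo: "\<eta> x = 0" if "x < 1 + e" for x
    unfolding \<eta>_def by (rule int0) (use z that in auto)
  have "integral {1..R} \<psi> = 0" using 0 by (simp add: integral_leb_eq ci)
  moreover have "integral {0..1} \<psi> = 0" using lo[of 1] e by (simp add: \<eta>_def)
  ultimately have \<eta>R: "\<eta> R = 0"
    unfolding \<eta>_def using R int Henstock_Kurzweil_Integration.integral_combine[of 0 1 R \<psi>] by simp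
  have hi: "\<eta> x = 0" if "R - e < x" for x
  proof (cases "x \<le> R")
    case True
    have "integral {x..R} \<psi> = 0"
      by (rule int0) (use z that in auto)
    moreover have "integral {0..x} \<psi> + integral {x..R} \<psi> = integral {0..R} \<psi>"
      using True that e int by (intro Henstock_Kurzweil_Integration.integral_combine) auto
    ultimately show ?thesis using \<eta>R by (simp add: \<eta>_def)
  next
    case False
    have "integral {R..x} \<psi> = 0"
      by (rule int0) (use z e in auto)
    moreover have "integral {0..R} \<psi> + integral {R..x} \<psi> = integral {0..x} \<psi>"
      using False R int by (intro Henstock_Kurzweil_Integration.integral_combine) auto
    ultimately show ?thesis using \<eta>R by (simp add: \<eta>_def)
  qed
  have "test_fun R \<eta> \<psi>" unfolding test_fun_def
  proof (intro conjI allI c)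
    have "\<eta> x = 0" if "x \<notin> {1+e..R-e}" for x using that lo hi by (cases "x < 1 + e") auto
    then show "\<exists>a b. 1 < a \<and> a \<le> b \<and> b < R \<and> (\<forall>x. x \<notin> {a..b} \<longrightarrow> \<eta> x = 0)"
      using e by (intro exI[of _ "1+e"] exI[of _ "R-e"]) auto
    fix x
    show "(\<eta> has_vector_derivative \<psi> x) (at x)"
    proof (cases "x < 1")
      case True
      have "((\<lambda>_. 0) has_vector_derivative \<psi> x) (at x)" using z[of x] True e by simp
      then show ?thesis
        by (rule has_vector_derivative_transform_within_open[of _ _ _ "{..<1}"])
          (use True lo e in auto)
    next
      case False
      have "((\<lambda>u. integral {0..u} \<psi>) has_vector_derivative \<psi> x) (at x within {0..x+1})"
        using False by (intro integral_has_vector_derivative ci) auto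
      moreover have "at x within {0..x+1} = at x"
        using False by (intro at_within_interior) (auto simp: interior_atLeastAtMost_real)
      ultimately show ?thesis by (simp add: \<eta>_def[abs_def])
    qed
  qed
  then show ?thesis by blast
qed

lemma compactly_supported_continuous: "compactly_supported R \<psi> \<Longrightarrow> continuous_on S \<psi>"
  unfolding compactly_supported_def using continuous_on_subset by blast

lemma prim_const:
  assumes "1 \<le> x" "x \<le> R"
  shows "prim R (\<lambda>_. c) x = c * of_real (x - 1)"
proof -
  have "integrable (leb R) (\<lambda>_. c)" by (intro continuous_imp_integrable_real) auto
  then show ?thesis using assms by (subst prim_eq_integral) (auto simp: scaleR_conv_of_real algebra_simps)
qed

text \<open>Fix a compactly supported \<psi>0 of integral 1 and let c be the integral of h \<psi>0.
  Subtracting from any \<psi> its mean times \<psi>0 leaves the derivative of a test function, so h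
  - c annihilates every \<psi>. Bumps then show that all segment integrals of h - c vanish.\<close>

lemma du_Bois_Reymond:
  assumes h: "integrable (leb R) h" and R: "1 < R"
    and z: "\<And>\<eta> \<eta>'. test_fun R \<eta> \<eta>' \<Longrightarrow> (LINT r|leb R. h r * \<eta>' r) = 0"
  shows "\<exists>c. AE r in leb R. h r = c"
proof -
  have one: "integrable (leb R) (\<lambda>_. 1 :: complex)" by (intro continuous_imp_integrable_real) auto
  \<comment> \<open>Otherwise the limit of the bump integrals, which is R - 1, would be 0.\<close>
  have "\<exists>n. integral\<^sup>L (leb R) (bump R n) \<noteq> 0"
  proof (rule ccontr)
    assume "\<not> ?thesis"
    then have "(\<lambda>n. 0) \<longlonglongrightarrow> prim R (\<lambda>_. 1) R"
      using integral_bump_tendsto[OF one R, of R] by simp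
    then have "prim R (\<lambda>_. 1) R = 0" by (simp add: LIMSEQ_const_iff)
    then show False using R by (simp add: prim_const)
  qed
  then obtain n0 where n0: "integral\<^sup>L (leb R) (bump R n0) \<noteq> 0" ..
  define \<psi>0 where "\<psi>0 r = bump R n0 r / integral\<^sup>L (leb R) (bump R n0)" for r
  have s0: "compactly_supported R \<psi>0" using compactly_supported_bump[of R R n0] unfolding compactly_supported_def \<psi>0_def
    by (auto intro!: continuous_intros n0)
  have i0: "integral\<^sup>L (leb R) \<psi>0 = 1"
    unfolding \<psi>0_def using n0 by simp
  define c where "c = (LINT r|leb R. h r * \<psi>0 r)"
  have orth: "(LINT r|leb R. (h r - c) * \<psi> r) = 0" if s: "compactly_supported R \<psi>" for \<psi>
  proof -
    define I where "I = integral\<^sup>L (leb R) \<psi>"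
    have int: "integrable (leb R) \<psi>" "integrable (leb R) \<psi>0"
      "integrable (leb R) (\<lambda>r. h r * \<psi> r)" "integrable (leb R) (\<lambda>r. h r * \<psi>0 r)"
      using compactly_supported_continuous[OF s] compactly_supported_continuous[OF s0] h
      by (auto intro: continuous_imp_integrable_real integrable_mult_continuous)
    have "compactly_supported R (\<lambda>r. \<psi> r - I * \<psi>0 r)"
    proof -
      obtain e1 e2 where e: "e1 > 0" "e2 > 0" "\<And>x. x \<notin> {1+e1..R-e1} \<Longrightarrow> \<psi> x = 0"
        "\<And>x. x \<notin> {1+e2..R-e2} \<Longrightarrow> \<psi>0 x = 0" using s s0 unfolding compactly_supported_def by blast
      have "\<psi> x = 0 \<and> \<psi>0 x = 0" if "x \<notin> {1+min e1 e2..R-min e1 e2}" for x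
        using that by (intro conjI e) auto
      then show ?thesis unfolding compactly_supported_def
        using e(1,2) compactly_supported_continuous[OF s] compactly_supported_continuous[OF s0]
        by (intro conjI continuous_intros exI[of _ "min e1 e2"]) auto
    qed
    moreover have "integral\<^sup>L (leb R) (\<lambda>r. \<psi> r - I * \<psi>0 r) = 0"
      using int i0 by (simp add: I_def)
    ultimately obtain \<eta> where "test_fun R \<eta> (\<lambda>r. \<psi> r - I * \<psi>0 r)"
      using test_fun_antideriv R by blast
    from z[OF this] have "(LINT r|leb R. h r * \<psi> r - I * (h r * \<psi>0 r)) = 0"
      by (simp add: algebra_simps)
    then have "(LINT r|leb R. h r * \<psi> r) = I * c"
      using int by (simp add: c_def)
    moreover have "(LINT r|leb R. (h r - c) * \<psi> r) = (LINT r|leb R. h r * \<psi> r - c * \<psi> r)"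
      by (simp add: algebra_simps)
    ultimately show ?thesis using int by (simp add: I_def)
  qed
  have hc: "integrable (leb R) (\<lambda>r. h r - c)"
    using h one by (auto intro!: Bochner_Integration.integrable_diff continuous_imp_integrable_real)
  have zero: "prim R (\<lambda>r. h r - c) x = 0" if "x \<le> R" for x
  proof -
    have "(\<lambda>n. 0) \<longlonglongrightarrow> prim R (\<lambda>r. h r - c) x"
      using integral_bump_tendsto[OF hc R, of x] orth[OF compactly_supported_bump[OF that]] by simp
    then show ?thesis by (simp add: LIMSEQ_const_iff)
  qed
  have "prim R (\<lambda>r. h r - c) x = 0" for x
  proof (cases "x \<le> R")
    case False
    then have "prim R (\<lambda>r. h r - c) x = prim R (\<lambda>r. h r - c) R"
      unfolding prim_def by (intro Bochner_Integration.integral_cong) auto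
    then show ?thesis using zero by simp
  qed (rule zero)
  then have "AE r in leb R. h r - c = 0" by (rule AE_zero_if_segment_integrals_zero[OF hc])
  then show ?thesis by auto
qed

lemma continuous_AE_zero:
  assumes c: "continuous_on {1..R} (f :: real \<Rightarrow> complex)" and ae: "AE r in leb R. f r = 0" and R: "1 < R"
    and x: "x \<in> {1..R}"
  shows "f x = 0"
proof -
  have cn: "continuous_on {1..R} (\<lambda>r. norm (f r))" using c by (intro continuous_intros)
  have "integral {1..R} (\<lambda>r. norm (f r)) = (LINT r|leb R. norm (f r))"
    using has_integral_integral_lebesgue_on[OF continuous_imp_integrable_real[OF cn]] by auto
  also have "\<dots> = 0" using ae by (intro integral_eq_zero_AE) auto
  finally have "\<forall>x\<in>{1..R}. norm (f x) = 0"
    using R by (subst (asm) integral_eq_0_iff[OF cn]) auto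
  then show ?thesis using x by auto
qed

lemma L2_integrable:
  assumes "f \<in> L2 R"
  shows "integrable (leb R) f"
proof (rule Bochner_Integration.integrable_bound)
  show "integrable (leb R) (\<lambda>r. 1 + (cmod (f r))\<^sup>2)"
    using assms by (auto simp: L2_def intro!: Bochner_Integration.integrable_add continuous_imp_integrable_real)
  show "AE r in leb R. cmod (f r) \<le> norm (1 + (cmod (f r))\<^sup>2)"
  proof (rule AE_I2)
    fix r
    have "2 * cmod (f r) \<le> 1 + (cmod (f r))\<^sup>2"
      using sum_squares_bound[of 1 "cmod (f r)"] by simp
    then have "cmod (f r) \<le> 1 + (cmod (f r))\<^sup>2" using norm_ge_zero[of "f r"] by linarith
    then show "cmod (f r) \<le> norm (1 + (cmod (f r))\<^sup>2)" by simp
  qed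
qed (use assms in \<open>auto simp: L2_def\<close>)

lemma L2_continuous: "continuous_on {1..R} f \<Longrightarrow> f \<in> L2 R"
  unfolding L2_def
  by (auto intro!: borel_measurable_integrable continuous_imp_integrable_real continuous_intros)

section \<open>Weak derivatives, primitives and C^1 representatives\<close>

lemma weak_deriv_C1_on:
  assumes f: "C1_on R f f'" and R: "1 < R"
  shows "is_weak_deriv R f f'"
  unfolding is_weak_deriv_def
proof (intro allI impI)
  fix \<eta> \<eta>' assume t: "test_fun R \<eta> \<eta>'"
  note \<eta> = test_fun_C1_on[OF t]
  have i: "integrable (leb R) f'" using f by (intro continuous_imp_integrable_real C1_onD)
  have iW: "integrable (leb R) (\<lambda>r. \<eta>' r * prim R f' r)"
    using C1_onD[OF \<eta>(1)] continuous_on_prim[OF i]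
    by (auto intro: integrable_mult_continuous continuous_imp_integrable_real)
  have i\<eta>: "integrable (leb R) \<eta>'" using \<eta> by (intro continuous_imp_integrable_real C1_onD)
  have eq: "f r = f 1 + prim R f' r" if "r \<in> {1..R}" for r
  proof -
    have "(f' has_integral (f r - f 1)) {1..r}" using f that unfolding C1_on_def
      by (intro fundamental_theorem_of_calculus)
        (auto intro: has_vector_derivative_within_subset[where S="{1..R}"])
    then show ?thesis using prim_eq_integral[OF i that] by (simp add: integral_unique)
  qed
  have "(LINT r|leb R. f r * \<eta>' r) = (LINT r|leb R. f 1 * \<eta>' r + \<eta>' r * prim R f' r)"
  proof (rule Bochner_Integration.integral_cong[OF refl])
    fix r assume "r \<in> space (leb R)"
    then have "f r = f 1 + prim R f' r" by (intro eq) simp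
    then show "f r * \<eta>' r = f 1 * \<eta>' r + \<eta>' r * prim R f' r"
      by (metis distrib_right mult.commute)
  qed
  also have "\<dots> = f 1 * integral\<^sup>L (leb R) \<eta>' + (LINT r|leb R. prim R f' r * \<eta>' r)"
    using iW i\<eta> by (simp add: mult.commute)
  also have "\<dots> = - (LINT r|leb R. f' r * \<eta> r)"
    using integral_C1_on[OF \<eta>(1)] integral_prim_by_parts[OF \<eta>(1) i] \<eta> R by simp
  finally show "(LINT r|leb R. f r * \<eta>' r) = - (LINT r|leb R. f' r * \<eta> r)" .
qed

lemma prim_weak_deriv:
  assumes "integrable (leb R) g" "1 < R"
  shows "is_weak_deriv R (prim R g) g"
  unfolding is_weak_deriv_def
proof (intro allI impI)
  fix \<eta> \<eta>' assume t: "test_fun R \<eta> \<eta>'"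
  show "(LINT r|leb R. prim R g r * \<eta>' r) = - (LINT r|leb R. g r * \<eta> r)"
    using test_fun_C1_on[OF t] integral_prim_by_parts[of R \<eta> \<eta>' g] assms by simp
qed

text \<open>The difference of \<open>f\<close> and the primitive of \<open>g\<close> has weak
  derivative 0, so it is constant.\<close>

lemma weak_deriv_imp_AE_prim:
  assumes fg: "is_weak_deriv R f g" and f: "integrable (leb R) f" and g: "integrable (leb R) g" and R: "1 < R"
  shows "\<exists>c. AE r in leb R. f r = c + prim R g r"
proof -
  have ip: "integrable (leb R) (prim R g)" using continuous_on_prim[OF g] by (rule continuous_imp_integrable_real)
  have "\<exists>c. AE r in leb R. f r - prim R g r = c"
  proof (rule du_Bois_Reymond)
    fix \<eta> \<eta>' assume t: "test_fun R \<eta> \<eta>'"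
    have c: "continuous_on {1..R} \<eta>'" using test_fun_C1_on[OF t] C1_onD by blast
    have "(LINT r|leb R. (f r - prim R g r) * \<eta>' r)
        = (LINT r|leb R. f r * \<eta>' r) - (LINT r|leb R. prim R g r * \<eta>' r)"
      using integrable_mult_continuous[OF f c] integrable_mult_continuous[OF ip c]
      by (simp add: left_diff_distrib)
    then show "(LINT r|leb R. (f r - prim R g r) * \<eta>' r) = 0"
      using fg prim_weak_deriv[OF g R] t unfolding is_weak_deriv_def by simp
  qed (use f ip R in auto)
  then show ?thesis by (auto simp: algebra_simps)
qed

text \<open>The difference h of the two derivatives annihilates all test functions, so its primitive
  has weak derivative 0 and is constant. The constant is 0 because the primitive vanishes at 1;
  hence all segment integrals of h vanish.\<close>

lemma weak_deriv_unique:
  assumes "is_weak_deriv R f g1" "is_weak_deriv R f g2"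
    and g: "integrable (leb R) g1" "integrable (leb R) g2" and R: "1 < R"
  shows "AE r in leb R. g1 r = g2 r"
proof -
  define h where "h r = g1 r - g2 r" for r
  have h: "integrable (leb R) h" using g by (simp add: h_def[abs_def])
  have h0: "(LINT r|leb R. h r * \<eta> r) = 0" if t: "test_fun R \<eta> \<eta>'" for \<eta> \<eta>'
  proof -
    have c: "continuous_on {1..R} \<eta>" using test_fun_C1_on[OF t] C1_onD by blast
    have "(LINT r|leb R. h r * \<eta> r) = (LINT r|leb R. g1 r * \<eta> r) - (LINT r|leb R. g2 r * \<eta> r)"
      using integrable_mult_continuous[OF g(1) c] integrable_mult_continuous[OF g(2) c]
      by (simp add: h_def left_diff_distrib)
    moreover have "(LINT r|leb R. f r * \<eta>' r) = - (LINT r|leb R. g1 r * \<eta> r)"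
      "(LINT r|leb R. f r * \<eta>' r) = - (LINT r|leb R. g2 r * \<eta> r)"
      using assms(1,2) t unfolding is_weak_deriv_def by blast+
    ultimately show ?thesis by simp
  qed
  have cp: "continuous_on {1..R} (prim R h)" by (rule continuous_on_prim[OF h])
  have "\<exists>c. AE r in leb R. prim R h r = c"
  proof (rule du_Bois_Reymond)
    show "integrable (leb R) (prim R h)" using cp by (rule continuous_imp_integrable_real)
    fix \<eta> \<eta>' assume t: "test_fun R \<eta> \<eta>'"
    then show "(LINT r|leb R. prim R h r * \<eta>' r) = 0"
      using prim_weak_deriv[OF h R] h0[OF t] unfolding is_weak_deriv_def by simp
  qed (rule R)
  then obtain c where c: "AE r in leb R. prim R h r - c = 0" by auto
  have const: "prim R h x = c" if "x \<in> {1..R}" for x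
    using continuous_AE_zero[OF continuous_on_diff[OF cp continuous_on_const] c R that] by simp
  have "c = 0" using const[of 1] R h by simp
  have "prim R h x = 0" for x
  proof -
    consider "x < 1" | "x \<in> {1..R}" | "x > R" by fastforce
    then show ?thesis
    proof cases
      case 1
      then have "prim R h x = (LINT r|leb R. 0)"
        unfolding prim_def by (intro Bochner_Integration.integral_cong) auto
      then show ?thesis by simp
    next
      case 3
      then have "prim R h x = prim R h R"
        unfolding prim_def by (intro Bochner_Integration.integral_cong) auto
      then show ?thesis using const[of R] \<open>c = 0\<close> R by simp
    qed (use const \<open>c = 0\<close> in auto)
  qed
  then have "AE r in leb R. h r = 0" by (rule AE_zero_if_segment_integrals_zero[OF h])
  then show ?thesis by (simp add: h_def)
qed

lemma H1_wderiv:
  assumes "f \<in> H1 R"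
  shows "wderiv R f \<in> L2 R" "is_weak_deriv R f (wderiv R f)"
proof -
  have "\<exists>g. g \<in> L2 R \<and> is_weak_deriv R f g" using assms by (auto simp: H1_def)
  from someI_ex[OF this] show "wderiv R f \<in> L2 R" "is_weak_deriv R f (wderiv R f)"
    by (auto simp: wderiv_def)
qed

lemma C1_on_H1:
  assumes f: "C1_on R f f'" and R: "1 < R"
  shows "f \<in> H1 R" "AE r in leb R. wderiv R f r = f' r"
proof -
  have L: "f \<in> L2 R" "f' \<in> L2 R" using C1_onD[OF f] by (auto intro: L2_continuous)
  show H: "f \<in> H1 R" using L weak_deriv_C1_on[OF assms] by (auto simp: H1_def)
  show "AE r in leb R. wderiv R f r = f' r"
    using L H1_wderiv[OF H] weak_deriv_C1_on[OF assms] R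
    by (intro weak_deriv_unique) (auto intro: L2_integrable)
qed

text \<open>The weak derivative of \<open>w\<close> is almost everywhere \<open>w1\<close>, a
  constant plus the primitive of the second derivative, and \<open>w\<close> is a constant plus the
  primitive of \<open>w1\<close>. The last clause extends the integration by parts from compactly
  supported test functions to all C^1 functions vanishing at the ends, in particular to multiples of
  \<open>w\<close> and of the stream function.\<close>

lemma dom_D_regularity:
  assumes w: "w \<in> dom_D R" and R: "1 < R"
  obtains w1 where "C1_on R w w1" "AE r in leb R. wderiv R w r = w1 r"
    "wderiv R (wderiv R w) \<in> L2 R"
    "\<And>G G'. C1_on R G G' \<Longrightarrow> G 1 = 0 \<Longrightarrow> G R = 0 \<Longrightarrow>
      (LINT r|leb R. wderiv R (wderiv R w) r * G r) = - (LINT r|leb R. w1 r * G' r)"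
proof -
  define v1 v2 where "v1 = wderiv R w" "v2 = wderiv R v1"
  have H: "w \<in> H1 R" "v1 \<in> H1 R" and cw: "continuous_on {1..R} w"
    using w by (auto simp: dom_D_def v1_v2_def)
  have L: "v1 \<in> L2 R" "v2 \<in> L2 R" and d: "is_weak_deriv R w v1" "is_weak_deriv R v1 v2"
    using H1_wderiv[OF H(1)] H1_wderiv[OF H(2)] by (auto simp: v1_v2_def)
  have i: "integrable (leb R) v1" "integrable (leb R) v2" using L by (auto intro: L2_integrable)
  have iw: "integrable (leb R) w" using cw by (rule continuous_imp_integrable_real)
  obtain c where c: "AE r in leb R. v1 r = c + prim R v2 r"
    using weak_deriv_imp_AE_prim[OF d(2) i R] by blast
  define w1 where "w1 r = c + prim R v2 r" for r
  have cw1: "continuous_on {1..R} w1" unfolding w1_def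
    using i by (intro continuous_intros continuous_on_prim)
  have iw1: "integrable (leb R) w1" using cw1 by (rule continuous_imp_integrable_real)
  obtain c2 where c2: "AE r in leb R. w r = c2 + prim R v1 r"
    using weak_deriv_imp_AE_prim[OF d(1) iw i(1) R] by blast
  have prim_eq: "prim R v1 r = prim R w1 r" for r
    unfolding prim_def
  proof (rule integral_cong_AE)
    show "AE t in leb R. indicator {..r} t *\<^sub>R v1 t = indicator {..r} t *\<^sub>R w1 t"
      using c by eventually_elim (simp add: w1_def)
  qed (use i iw1 in \<open>auto intro!: borel_measurable_integrable integrable_indicator_leb\<close>)
  have "AE r in leb R. w r - (c2 + prim R w1 r) = 0" using c2 by (simp add: prim_eq)
  \<comment> \<open>Both sides are continuous, so the identity holds at every point of the interval
    and not only almost everywhere; \<open>dom_D\<close> provides the continuity of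
    \<open>w\<close>.\<close>
  then have weq: "w r - (c2 + prim R w1 r) = 0" if "r \<in> {1..R}" for r
    by (rule continuous_AE_zero[rotated]) (use R that cw iw1 in \<open>auto intro!: continuous_intros continuous_on_prim\<close>)
  have C1: "C1_on R w w1"
    unfolding C1_on_def
  proof (intro conjI ballI cw1)
    fix x assume x: "x \<in> {1..R}"
    have "(prim R w1 has_vector_derivative w1 x) (at x within {1..R})"
      using C1_on_prim[OF cw1] x by (auto simp: C1_on_def)
    then have "((\<lambda>r. c2 + prim R w1 r) has_vector_derivative 0 + w1 x) (at x within {1..R})"
      by (intro has_vector_derivative_add) auto
    then show "(w has_vector_derivative w1 x) (at x within {1..R})"
      by (intro has_vector_derivative_transform[OF x, of w "\<lambda>r. c2 + prim R w1 r"]) (use weq in auto)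
  qed
  show ?thesis
  proof (rule that[OF C1])
    show "AE r in leb R. wderiv R w r = w1 r" using c by (simp add: w1_def v1_v2_def)
    show "wderiv R (wderiv R w) \<in> L2 R" using L by (simp add: v1_v2_def)
    fix G G' assume G: "C1_on R G G'" "G 1 = 0" "G R = 0"
    have iG: "integrable (leb R) G'" "continuous_on {1..R} G'" using C1_onD[OF G(1)] by (auto intro: continuous_imp_integrable_real)
    have iP: "integrable (leb R) (\<lambda>r. G' r * prim R v2 r)"
      using iG i by (intro integrable_mult_continuous continuous_on_prim)
    have "(LINT r|leb R. w1 r * G' r) = (LINT r|leb R. c * G' r + G' r * prim R v2 r)"
      by (simp add: w1_def algebra_simps)
    also have "\<dots> = c * integral\<^sup>L (leb R) G' + (LINT r|leb R. prim R v2 r * G' r)"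
      using iP iG by (simp add: mult.commute)
    also have "\<dots> = - (LINT r|leb R. v2 r * G r)"
      using integral_C1_on[OF G(1)] integral_prim_by_parts[OF G(1) i(2)] G R by simp
    finally show "(LINT r|leb R. wderiv R (wderiv R w) r * G r) = - (LINT r|leb R. w1 r * G' r)"
      by (simp add: v1_v2_def)
  qed
qed

section \<open>Square integrable functions\<close>

abbreviation divr :: "(real \<Rightarrow> complex) \<Rightarrow> real \<Rightarrow> complex" where
  "divr f \<equiv> \<lambda>r. f r / of_real r"

lemma norm_L2_nonneg [simp]: "0 \<le> norm_L2 R f"
  by (simp add: norm_L2_def)

lemma norm_L2_sq: "(norm_L2 R f)\<^sup>2 = (LINT r|leb R. (cmod (f r))\<^sup>2)"
  by (simp add: norm_L2_def)

lemma norm_L2_cong: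
  assumes "\<And>r. r \<in> {1..R} \<Longrightarrow> cmod (f r) = cmod (g r)"
  shows "norm_L2 R f = norm_L2 R g"
  unfolding norm_L2_def using assms
  by (intro arg_cong[where f = sqrt] Bochner_Integration.integral_cong) auto

lemma norm_L2_cong_AE:
  assumes "AE r in leb R. f r = g r" "f \<in> L2 R" "g \<in> L2 R"
  shows "norm_L2 R f = norm_L2 R g"
proof -
  have "(LINT r|leb R. (cmod (f r))\<^sup>2) = (LINT r|leb R. (cmod (g r))\<^sup>2)"
    using assms by (intro integral_cong_AE) (auto simp: L2_def elim: AE_mp)
  then show ?thesis by (simp add: norm_L2_def)
qed

lemma discriminant_nonpos:
  fixes A B I :: real
  assumes "\<And>x. A * x\<^sup>2 + 2 * I * x + B \<ge> 0" "A \<ge> 0"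
  shows "I\<^sup>2 \<le> A * B"
proof (cases "A = 0")
  case True
  have "I = 0"
  proof (rule ccontr)
    assume "I \<noteq> 0"
    \<comment> \<open>At this point the polynomial, which is linear for A = 0, takes the value
      -1.\<close>
    then show False using assms(1)[of "- (B + 1) / (2 * I)"] True by (simp add: field_simps)
  qed
  then show ?thesis using True by simp
next
  case False
  then have "A > 0" using assms by simp
  then show ?thesis using assms(1)[of "- I / A"] by (simp add: field_simps power2_eq_square)
qed

lemma Cauchy_Schwarz_L2:
  assumes f: "f \<in> L2 R" and g: "g \<in> L2 R"
  shows "integrable (leb R) (\<lambda>r. cmod (f r) * cmod (g r))"
    and "(LINT r|leb R. cmod (f r) * cmod (g r)) \<le> norm_L2 R f * norm_L2 R g"
proof -
  have [measurable]: "f \<in> borel_measurable (leb R)" "g \<in> borel_measurable (leb R)"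
    and i: "integrable (leb R) (\<lambda>r. (cmod (f r))\<^sup>2)" "integrable (leb R) (\<lambda>r. (cmod (g r))\<^sup>2)"
    using f g by (auto simp: L2_def)
  show ifg: "integrable (leb R) (\<lambda>r. cmod (f r) * cmod (g r))"
  proof (rule Bochner_Integration.integrable_bound)
    show "integrable (leb R) (\<lambda>r. (cmod (f r))\<^sup>2 + (cmod (g r))\<^sup>2)" using i by simp
    show "AE r in leb R. norm (cmod (f r) * cmod (g r)) \<le> norm ((cmod (f r))\<^sup>2 + (cmod (g r))\<^sup>2)"
    proof (rule AE_I2)
      fix r
      have "2 * (cmod (f r) * cmod (g r)) \<le> (cmod (f r))\<^sup>2 + (cmod (g r))\<^sup>2"
        using sum_squares_bound[of "cmod (f r)" "cmod (g r)"] by simp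
      moreover have "0 \<le> cmod (f r) * cmod (g r)" by simp
      ultimately have "cmod (f r) * cmod (g r) \<le> (cmod (f r))\<^sup>2 + (cmod (g r))\<^sup>2"
        by linarith
      then show "norm (cmod (f r) * cmod (g r)) \<le> norm ((cmod (f r))\<^sup>2 + (cmod (g r))\<^sup>2)"
        by simp
    qed
  qed simp
  define I where "I = (LINT r|leb R. cmod (f r) * cmod (g r))"
  have "I\<^sup>2 \<le> (norm_L2 R f)\<^sup>2 * (norm_L2 R g)\<^sup>2"
  proof (rule discriminant_nonpos)
    fix x
    have "0 \<le> (LINT r|leb R. (x * cmod (f r) + cmod (g r))\<^sup>2)" by simp
    also have "\<dots> = (LINT r|leb R. x\<^sup>2 * (cmod (f r))\<^sup>2 + 2 * x * (cmod (f r) * cmod (g r)) + (cmod (g r))\<^sup>2)"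
      by (rule Bochner_Integration.integral_cong) (auto simp: power2_eq_square algebra_simps)
    also have "\<dots> = (norm_L2 R f)\<^sup>2 * x\<^sup>2 + 2 * I * x + (norm_L2 R g)\<^sup>2"
      using i ifg by (simp add: norm_L2_sq I_def)
    finally show "(norm_L2 R f)\<^sup>2 * x\<^sup>2 + 2 * I * x + (norm_L2 R g)\<^sup>2 \<ge> 0" .
  qed simp
  then have "I\<^sup>2 \<le> (norm_L2 R f * norm_L2 R g)\<^sup>2" by (simp add: power_mult_distrib)
  then show "(LINT r|leb R. cmod (f r) * cmod (g r)) \<le> norm_L2 R f * norm_L2 R g"
    unfolding I_def[symmetric] by (rule power2_le_imp_le) simp
qed

text \<open>The comparison is pointwise, so that powers of r can be moved from one factor to the
  other, for instance to pair r F with G/r.\<close>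

lemma inner_L2_bound:
  assumes f: "f \<in> L2 R" and g: "g \<in> L2 R" and c: "c \<ge> 0"
    and le: "\<And>r. r \<in> {1..R} \<Longrightarrow> cmod (F r) * cmod (G r) \<le> c * (cmod (f r) * cmod (g r))"
  shows "cmod (inner_L2 R F G) \<le> c * (norm_L2 R f * norm_L2 R g)"
proof (cases "integrable (leb R) (\<lambda>r. F r * cnj (G r))")
  case True
  have "cmod (inner_L2 R F G) \<le> (LINT r|leb R. cmod (F r * cnj (G r)))"
    unfolding inner_L2_def by (rule integral_norm_bound)
  also have "\<dots> \<le> (LINT r|leb R. c * (cmod (f r) * cmod (g r)))"
    using integrable_norm[OF True] Cauchy_Schwarz_L2(1)[OF f g] le
    by (intro integral_mono) (auto simp: norm_mult)
  also have "\<dots> = c * (LINT r|leb R. cmod (f r) * cmod (g r))" by simp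
  also have "\<dots> \<le> c * (norm_L2 R f * norm_L2 R g)"
    using Cauchy_Schwarz_L2(2)[OF f g] c by (rule mult_left_mono)
  finally show ?thesis .
next
  case False
  \<comment> \<open>The integral of a non-integrable function is 0 by default.\<close>
  then show ?thesis using c by (simp add: inner_L2_def not_integrable_integral_eq)
qed

text \<open>Minkowski's inequality combined with pointwise domination: expand the square and apply
  Cauchy-Schwarz to the cross term.\<close>

lemma norm_L2_bound2:
  assumes f: "f \<in> L2 R" and g: "g \<in> L2 R" and h: "h \<in> L2 R" and ab: "0 \<le> \<alpha>" "0 \<le> \<beta>"
    and le: "\<And>r. r \<in> {1..R} \<Longrightarrow> cmod (h r) \<le> \<alpha> * cmod (f r) + \<beta> * cmod (g r)"
  shows "norm_L2 R h \<le> \<alpha> * norm_L2 R f + \<beta> * norm_L2 R g"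
proof (rule power2_le_imp_le)
  have i: "integrable (leb R) (\<lambda>r. (cmod (f r))\<^sup>2)" "integrable (leb R) (\<lambda>r. (cmod (g r))\<^sup>2)"
    "integrable (leb R) (\<lambda>r. (cmod (h r))\<^sup>2)" and j: "integrable (leb R) (\<lambda>r. cmod (f r) * cmod (g r))"
    using f g h Cauchy_Schwarz_L2(1) by (auto simp: L2_def)
  have "(norm_L2 R h)\<^sup>2 \<le> (LINT r|leb R. \<alpha>\<^sup>2 * (cmod (f r))\<^sup>2 + 2 * \<alpha> * \<beta> * (cmod (f r) * cmod (g r)) + \<beta>\<^sup>2 * (cmod (g r))\<^sup>2)"
    unfolding norm_L2_sq
  proof (rule integral_mono)
    fix r assume "r \<in> space (leb R)"
    then have "(cmod (h r))\<^sup>2 \<le> (\<alpha> * cmod (f r) + \<beta> * cmod (g r))\<^sup>2"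
      by (intro power_mono le) auto
    also have "\<dots> = \<alpha>\<^sup>2 * (cmod (f r))\<^sup>2 + 2 * \<alpha> * \<beta> * (cmod (f r) * cmod (g r)) + \<beta>\<^sup>2 * (cmod (g r))\<^sup>2"
      by (simp add: power2_eq_square algebra_simps)
    finally show "(cmod (h r))\<^sup>2 \<le> \<dots>" .
  qed (use i j in auto)
  also have "\<dots> = \<alpha>\<^sup>2 * (norm_L2 R f)\<^sup>2 + 2 * \<alpha> * \<beta> * (LINT r|leb R. cmod (f r) * cmod (g r)) + \<beta>\<^sup>2 * (norm_L2 R g)\<^sup>2"
    using i j by (simp add: norm_L2_sq)
  also have "\<dots> \<le> \<alpha>\<^sup>2 * (norm_L2 R f)\<^sup>2 + 2 * \<alpha> * \<beta> * (norm_L2 R f * norm_L2 R g) + \<beta>\<^sup>2 * (norm_L2 R g)\<^sup>2"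
    using Cauchy_Schwarz_L2(2)[OF f g] ab by (intro add_mono mult_left_mono) auto
  also have "\<dots> = (\<alpha> * norm_L2 R f + \<beta> * norm_L2 R g)\<^sup>2"
    by (simp add: power2_eq_square algebra_simps)
  finally show "(norm_L2 R h)\<^sup>2 \<le> (\<alpha> * norm_L2 R f + \<beta> * norm_L2 R g)\<^sup>2" .
qed (use ab in auto)

lemma norm_L2_bound:
  assumes f: "f \<in> L2 R" and h: "h \<in> L2 R" and a: "0 \<le> \<alpha>"
    and le: "\<And>r. r \<in> {1..R} \<Longrightarrow> cmod (h r) \<le> \<alpha> * cmod (f r)"
  shows "norm_L2 R h \<le> \<alpha> * norm_L2 R f"
  using norm_L2_bound2[OF f f h a order_refl] le by simp

lemma inner_L2_real:
  assumes "\<And>r. r \<in> {1..R} \<Longrightarrow> f r * cnj (g r) = of_real (h r)"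
  shows "inner_L2 R f g = of_real (LINT r|leb R. h r)"
  unfolding inner_L2_def integral_complex_of_real[symmetric]
  using assms by (intro Bochner_Integration.integral_cong) auto

lemma inner_L2_self: "inner_L2 R f f = of_real ((norm_L2 R f)\<^sup>2)"
  unfolding norm_L2_sq by (rule inner_L2_real) (rule complex_norm_square[symmetric])

lemma inner_L2_integrable:
  assumes "f \<in> L2 R" "g \<in> L2 R"
  shows "integrable (leb R) (\<lambda>r. f r * cnj (g r))"
proof (rule Bochner_Integration.integrable_bound[OF Cauchy_Schwarz_L2(1)[OF assms]])
  show "(\<lambda>r. f r * cnj (g r)) \<in> borel_measurable (leb R)"
    using assms unfolding L2_def
    by (auto intro!: borel_measurable_times borel_measurable_continuous_on[of cnj] continuous_intros)
qed (simp add: norm_mult)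

lemma inner_L2_add_right:
  assumes "f \<in> L2 R" "g \<in> L2 R" "h \<in> L2 R"
  shows "inner_L2 R f (\<lambda>r. g r + h r) = inner_L2 R f g + inner_L2 R f h"
  unfolding inner_L2_def
  using inner_L2_integrable[OF assms(1,2)] inner_L2_integrable[OF assms(1,3)]
  by (simp add: distrib_left)

lemma C1_on_cnj:
  assumes "C1_on R f f'"
  shows "C1_on R (\<lambda>r. cnj (f r)) (\<lambda>r. cnj (f' r))"
  using assms unfolding C1_on_def by (auto intro: continuous_intros has_vector_derivative_cnj)

lemma C1_on_mult:
  assumes "C1_on R f f'" "C1_on R g g'"
  shows "C1_on R (\<lambda>r. f r * g r) (\<lambda>r. f r * g' r + f' r * g r)"
  using assms C1_onD[OF assms(1)] C1_onD[OF assms(2)] unfolding C1_on_def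
  by (auto intro!: continuous_intros has_vector_derivative_mult)

lemma C1_on_of_real:
  assumes "\<And>r. r \<in> {1..R} \<Longrightarrow> (\<psi> has_real_derivative \<psi>' r) (at r)" "continuous_on {1..R} \<psi>'"
  shows "C1_on R (\<lambda>r. of_real (\<psi> r)) (\<lambda>r. of_real (\<psi>' r))"
  using assms unfolding C1_on_def
  by (auto intro!: continuous_intros has_vector_derivative_of_real
      intro: has_field_derivative_at_within)

lemma continuous_on_divr: "continuous_on {1..R} f \<Longrightarrow> continuous_on {1..R} (divr f)"
  by (intro continuous_intros) auto

text \<open>The function (\<psi>/r) |u|^2 vanishes at both ends, so its derivative has integral 0.
  Solving for the part with \<psi>' leaves 2 (\<psi>/r) Re(u' cnj u), bounded through
  \<open>P\<close>, and a term of favourable sign.\<close>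

lemma weighted_trace:
  assumes u: "C1_on R u u'" "u 1 = 0" "u R = 0" and R: "1 < R"
    and \<psi>: "\<And>r. r \<in> {1..R} \<Longrightarrow> (\<psi> has_real_derivative \<psi>' r) (at r)" "continuous_on {1..R} \<psi>'"
    and P: "\<And>r. r \<in> {1..R} \<Longrightarrow> 0 \<le> \<psi> r" "\<And>r. r \<in> {1..R} \<Longrightarrow> \<psi> r \<le> P"
  shows "(LINT r|leb R. - r * \<psi>' r * (cmod (divr u r))\<^sup>2) \<le> 2 * P * (norm_L2 R u' * norm_L2 R (divr u))"
proof -
  note cu = C1_onD[OF u(1)]
  have c\<psi>: "continuous_on {1..R} \<psi>"
    using \<psi>(1) by (intro DERIV_continuous_on) (auto intro: has_field_derivative_at_within)
  define q q' where "q r = \<psi> r / r" and "q' r = \<psi>' r / r - \<psi> r / r\<^sup>2" for r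
  have q: "C1_on R (\<lambda>r. of_real (q r)) (\<lambda>r. of_real (q' r))"
  proof (rule C1_on_of_real)
    show "(q has_real_derivative q' r) (at r)" if "r \<in> {1..R}" for r
      unfolding q_def[abs_def] q'_def using that
      by (auto intro!: derivative_eq_intros \<psi>(1) simp: field_simps power2_eq_square)
    show "continuous_on {1..R} q'"
      unfolding q'_def using c\<psi> \<psi>(2) by (intro continuous_intros) auto
  qed
  \<comment> \<open>\<open>A\<close> is the derivative of q |u|^2.\<close>
  define A where "A r = q' r * (cmod (u r))\<^sup>2 + q r * (2 * Re (u' r * cnj (u r)))" for r
  have "integral\<^sup>L (leb R) (\<lambda>r. of_real (q r) * (u r * cnj (u' r) + u' r * cnj (u r))
      + of_real (q' r) * (u r * cnj (u r))) = 0"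
    using integral_C1_on[OF C1_on_mult[OF q C1_on_mult[OF u(1) C1_on_cnj[OF u(1)]]]] u R by simp
  moreover have "of_real (q r) * (u r * cnj (u' r) + u' r * cnj (u r))
      + of_real (q' r) * (u r * cnj (u r)) = complex_of_real (A r)" for r
  proof -
    have "u r * cnj (u' r) + u' r * cnj (u r) = of_real (2 * Re (u' r * cnj (u r)))"
      by (simp add: complex_eq_iff)
    moreover have "u r * cnj (u r) = of_real ((cmod (u r))\<^sup>2)"
      by (rule complex_norm_square[symmetric])
    ultimately show ?thesis by (simp add: A_def)
  qed
  ultimately have "integral\<^sup>L (leb R) A = 0" by simp
  have cA: "integrable (leb R) A" unfolding A_def[abs_def] q_def q'_def
    by (intro continuous_imp_integrable_real continuous_intros c\<psi> \<psi>(2) cu) auto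
  have cB: "integrable (leb R) (\<lambda>r. - r * \<psi>' r * (cmod (divr u r))\<^sup>2)"
    by (intro continuous_imp_integrable_real continuous_intros c\<psi> \<psi>(2) cu) auto
  have L: "u' \<in> L2 R" "divr u \<in> L2 R"
    using cu by (auto intro: L2_continuous continuous_on_divr)
  have "(LINT r|leb R. - r * \<psi>' r * (cmod (divr u r))\<^sup>2) = (LINT r|leb R. A r + - r * \<psi>' r * (cmod (divr u r))\<^sup>2)"
    using cA cB \<open>integral\<^sup>L (leb R) A = 0\<close> by simp
  also have "\<dots> \<le> (LINT r|leb R. 2 * P * (cmod (u' r) * cmod (divr u r)))"
  proof (rule integral_mono)
    fix r assume "r \<in> space (leb R)"
    then have r: "r \<in> {1..R}" "r > 0" by auto
    \<comment> \<open>Differentiating 1/r gives -\<psi> |u/r|^2, which is nonpositive and is dropped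
      next.\<close>
    have "A r + - r * \<psi>' r * (cmod (divr u r))\<^sup>2 = q r * (2 * Re (u' r * cnj (u r))) - \<psi> r * (cmod (u r) / r)\<^sup>2"
      using r by (simp add: A_def q'_def norm_divide field_simps power2_eq_square)
    also have "\<dots> \<le> q r * (2 * Re (u' r * cnj (u r)))" using P(1)[OF r(1)] by simp
    also have "\<dots> \<le> q r * (2 * (cmod (u' r) * cmod (u r)))"
      using P(1)[OF r(1)] r complex_Re_le_cmod[of "u' r * cnj (u r)"]
      by (intro mult_left_mono) (auto simp: q_def norm_mult)
    also have "\<dots> = 2 * \<psi> r * (cmod (u' r) * cmod (divr u r))"
      using r by (simp add: q_def norm_divide)
    also have "\<dots> \<le> 2 * P * (cmod (u' r) * cmod (divr u r))"
      using P(2)[OF r(1)] by (intro mult_right_mono) auto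
    finally show "A r + - r * \<psi>' r * (cmod (divr u r))\<^sup>2 \<le> 2 * P * (cmod (u' r) * cmod (divr u r))" .
  qed (use cA cB Cauchy_Schwarz_L2(1)[OF L] in auto)
  also have "\<dots> = 2 * P * (LINT r|leb R. cmod (u' r) * cmod (divr u r))" by simp
  also have "\<dots> \<le> 2 * P * (norm_L2 R u' * norm_L2 R (divr u))"
    using Cauchy_Schwarz_L2(2)[OF L] P[of 1] R by (intro mult_left_mono) auto
  finally show ?thesis .
qed

section \<open>The critical layer\<close>

text \<open>The square root of the layer weight, so that weighted integrals become squares of L^2
  norms and a single factor can be kept in a product estimate.\<close>

definition theta :: "real \<Rightarrow> real \<Rightarrow> real \<Rightarrow> real" where
  "theta lam \<eta> r = \<eta> / sqrt ((1 - lam * r\<^sup>2)\<^sup>2 + \<eta>\<^sup>2)"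

lemma theta_sq: "(theta lam \<eta> r)\<^sup>2 = \<eta>\<^sup>2 / ((1 - lam * r\<^sup>2)\<^sup>2 + \<eta>\<^sup>2)"
  by (simp add: theta_def power_divide)

lemma theta_bounds:
  assumes "\<eta> > 0"
  shows "0 \<le> theta lam \<eta> r" "theta lam \<eta> r \<le> 1"
proof -
  define s where "s = 1 - lam * r\<^sup>2"
  have pos: "sqrt (s\<^sup>2 + \<eta>\<^sup>2) > 0" using assms by (simp add: add_nonneg_pos)
  have le: "\<eta> \<le> sqrt (s\<^sup>2 + \<eta>\<^sup>2)"
    by (auto intro: real_le_rsqrt)
  show "0 \<le> theta lam \<eta> r" "theta lam \<eta> r \<le> 1"
    using assms pos le unfolding theta_def s_def[symmetric] by auto
qed

lemma continuous_on_theta: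
  assumes "\<eta> > 0" shows "continuous_on S (theta lam \<eta>)"
proof -
  have "(1 - lam * x\<^sup>2)\<^sup>2 + \<eta>\<^sup>2 > 0" for x using assms by (simp add: add_nonneg_pos)
  then have "sqrt ((1 - lam * x\<^sup>2)\<^sup>2 + \<eta>\<^sup>2) \<noteq> 0" for x by (metis less_irrefl real_sqrt_gt_0_iff)
  then show ?thesis unfolding theta_def[abs_def] by (intro continuous_intros) auto
qed

text \<open>The identity r s' = -2 (1 - s) makes -r \<psi>' for \<psi> = arctan(s/\<eta>) equal to 2
  (1 - s) \<eta>/(s^2 + \<eta>^2). This dominates the weight divided by \<eta> wherever s \<le> 1/2;
  elsewhere the weight itself is small.\<close>

lemma critical_layer_bound:
  assumes u: "C1_on R u u'" "u 1 = 0" "u R = 0" and R: "1 < R" and \<eta>: "0 < \<eta>" "\<eta> \<le> 1/2"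
  shows "(norm_L2 R (\<lambda>r. of_real (theta lam \<eta> r) * divr u r))\<^sup>2
    \<le> 8 * \<eta> * (norm_L2 R u' + norm_L2 R (divr u)) * norm_L2 R (divr u)"
proof -
  define a b where "a = norm_L2 R u'" and "b = norm_L2 R (divr u)"
  have ab: "a \<ge> 0" "b \<ge> 0" by (auto simp: a_def b_def)
  note cu = C1_onD[OF u(1)]
  have cd: "continuous_on {1..R} (divr u)" using cu by (intro continuous_on_divr)
  define s where "s r = 1 - lam * r\<^sup>2" for r
  have pos: "(s r)\<^sup>2 + \<eta>\<^sup>2 > 0" for r using \<eta> by (simp add: add_nonneg_pos)
  have sq: "(cmod (of_real (theta lam \<eta> r) * divr u r))\<^sup>2 = \<eta>\<^sup>2 / ((s r)\<^sup>2 + \<eta>\<^sup>2) * (cmod (divr u r))\<^sup>2" for r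
    by (simp only: norm_mult norm_of_real power_mult_distrib power2_abs theta_sq s_def)
  have i1: "integrable (leb R) (\<lambda>r. \<eta>\<^sup>2 / ((s r)\<^sup>2 + \<eta>\<^sup>2) * (cmod (divr u r))\<^sup>2)"
    unfolding sq[symmetric]
    by (intro continuous_imp_integrable_real continuous_intros continuous_on_theta cd \<eta>)
  have i2: "integrable (leb R) (\<lambda>r. (cmod (divr u r))\<^sup>2)"
    by (intro continuous_imp_integrable_real continuous_intros cd)
  show ?thesis
  proof (cases "lam < 0")
    \<comment> \<open>Here s \<ge> 1 on the whole interval, so there is no critical layer and the
      weight is at most \<eta>^2.\<close>
    case True
    have "(norm_L2 R (\<lambda>r. of_real (theta lam \<eta> r) * divr u r))\<^sup>2 \<le> (LINT r|leb R. 2 * \<eta> * (cmod (divr u r))\<^sup>2)"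
      unfolding norm_L2_sq sq
    proof (rule integral_mono)
      fix r assume "r \<in> space (leb R)"
      have "lam * r\<^sup>2 \<le> 0" using True by (simp add: mult_nonpos_nonneg)
      then have "s r \<ge> 1" by (simp add: s_def)
      then have "1 \<le> (s r)\<^sup>2" by simp
      then have "\<eta>\<^sup>2 / ((s r)\<^sup>2 + \<eta>\<^sup>2) \<le> \<eta>\<^sup>2 / 1" by (intro divide_left_mono) (auto simp: add_increasing2 pos)
      also have "\<dots> \<le> 2 * \<eta>" using \<eta> by (simp add: power2_eq_square)
      finally show "\<eta>\<^sup>2 / ((s r)\<^sup>2 + \<eta>\<^sup>2) * (cmod (divr u r))\<^sup>2 \<le> 2 * \<eta> * (cmod (divr u r))\<^sup>2"
        by (intro mult_right_mono) auto
    qed (use i1 i2 in auto)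
    also have "\<dots> = 2 * \<eta> * b * b" by (simp add: b_def power2_eq_square[of "norm_L2 R _"] flip: norm_L2_sq)
    also have "\<dots> \<le> 8 * \<eta> * (a + b) * b" using ab \<eta> by (intro mult_right_mono mult_mono) auto
    finally show ?thesis by (simp add: a_def b_def)
  next
    case False
    \<comment> \<open>The shift by pi/2 makes \<psi> nonnegative, with values between 0 and
      pi.\<close>
    define \<psi> \<psi>' where "\<psi> r = arctan (s r / \<eta>) + pi / 2" and "\<psi>' r = - (2 * lam * r) * \<eta> / ((s r)\<^sup>2 + \<eta>\<^sup>2)" for r
    have cs: "continuous_on {1..R} s" unfolding s_def by (intro continuous_intros)
    have d\<psi>: "(\<psi> has_real_derivative \<psi>' r) (at r)" for r
    proof -
      have "(\<psi> has_real_derivative (- (lam * (2 * r))) / \<eta> * inverse (1 + (s r / \<eta>)\<^sup>2)) (at r)"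
        unfolding \<psi>_def s_def using \<eta> by (auto intro!: derivative_eq_intros)
      moreover have "(- (lam * (2 * r))) / \<eta> * inverse (1 + (s r / \<eta>)\<^sup>2) = \<psi>' r"
      proof -
        have "1 + (s r / \<eta>)\<^sup>2 = ((s r)\<^sup>2 + \<eta>\<^sup>2) / \<eta>\<^sup>2" using \<eta> by (simp add: field_simps)
        then show ?thesis using \<eta> pos[of r] by (simp add: \<psi>'_def divide_simps power2_eq_square)
      qed
      ultimately show ?thesis by simp
    qed
    have c\<psi>': "continuous_on {1..R} \<psi>'" unfolding \<psi>'_def
      using \<eta> by (intro continuous_intros cs) auto
    have tr: "(LINT r|leb R. - r * \<psi>' r * (cmod (divr u r))\<^sup>2) \<le> 2 * pi * (a * b)"
      unfolding a_def b_def
    proof (intro weighted_trace[OF u R d\<psi> c\<psi>'])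
      fix r
      show "0 \<le> \<psi> r" "\<psi> r \<le> pi"
        using arctan_bounded[of "s r / \<eta>"] by (auto simp: \<psi>_def)
    qed
    have i3: "integrable (leb R) (\<lambda>r. - r * \<psi>' r * (cmod (divr u r))\<^sup>2)"
      by (intro continuous_imp_integrable_real continuous_intros c\<psi>' cd)
    have "(norm_L2 R (\<lambda>r. of_real (theta lam \<eta> r) * divr u r))\<^sup>2 \<le>
        (LINT r|leb R. \<eta> * (- r * \<psi>' r * (cmod (divr u r))\<^sup>2) + 2 * \<eta> * (cmod (divr u r))\<^sup>2)"
      unfolding norm_L2_sq sq
    proof (rule integral_mono)
      fix r assume "r \<in> space (leb R)"
      have e: "\<eta> * (- r * \<psi>' r) = 2 * (1 - s r) * (\<eta>\<^sup>2 / ((s r)\<^sup>2 + \<eta>\<^sup>2))"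
        by (simp add: \<psi>'_def s_def power2_eq_square)
      have nn: "0 \<le> \<eta>\<^sup>2 / ((s r)\<^sup>2 + \<eta>\<^sup>2)" by simp
      have "\<eta>\<^sup>2 / ((s r)\<^sup>2 + \<eta>\<^sup>2) \<le> \<eta> * (- r * \<psi>' r) + 2 * \<eta>"
      \<comment> \<open>For s \<le> 1/2 the factor 2 (1 - s) is at least 1. For s > 1/2 the weight
        is at most 4 \<eta>^2, hence at most 2 \<eta>, and the other term is nonnegative since lam
        \<ge> 0 gives s \<le> 1.\<close>
      proof (cases "s r \<le> 1/2")
        case True
        then have "1 * (\<eta>\<^sup>2 / ((s r)\<^sup>2 + \<eta>\<^sup>2)) \<le> 2 * (1 - s r) * (\<eta>\<^sup>2 / ((s r)\<^sup>2 + \<eta>\<^sup>2))"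
          using nn by (intro mult_right_mono) auto
        then show ?thesis unfolding e using \<eta> by simp
      next
        case s: False
        then have "1/4 \<le> (s r)\<^sup>2" using power_mono[of "1/2" "s r" 2] by (simp add: power2_eq_square)
        then have "1/4 \<le> (s r)\<^sup>2 + \<eta>\<^sup>2" by (rule add_increasing2[OF zero_le_power2])
        then have "\<eta>\<^sup>2 / ((s r)\<^sup>2 + \<eta>\<^sup>2) \<le> \<eta>\<^sup>2 / (1/4)" using pos[of r] by (intro divide_left_mono) auto
        also have "\<dots> \<le> 2 * \<eta>" using \<eta> by (simp add: power2_eq_square)
        moreover have "1 - s r \<ge> 0" using False by (simp add: s_def)
        ultimately show ?thesis unfolding e using nn by (simp add: mult_nonneg_nonneg add_increasing)
      qed
      then have "\<eta>\<^sup>2 / ((s r)\<^sup>2 + \<eta>\<^sup>2) * (cmod (divr u r))\<^sup>2 \<le> (\<eta> * (- r * \<psi>' r) + 2 * \<eta>) * (cmod (divr u r))\<^sup>2"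
        by (intro mult_right_mono) auto
      then show "\<eta>\<^sup>2 / ((s r)\<^sup>2 + \<eta>\<^sup>2) * (cmod (divr u r))\<^sup>2 \<le> \<eta> * (- r * \<psi>' r * (cmod (divr u r))\<^sup>2) + 2 * \<eta> * (cmod (divr u r))\<^sup>2"
        by (simp only: distrib_right mult.assoc)
    qed (use i1 i2 i3 in auto)
    also have "\<dots> = \<eta> * (LINT r|leb R. - r * \<psi>' r * (cmod (divr u r))\<^sup>2) + 2 * \<eta> * (LINT r|leb R. (cmod (divr u r))\<^sup>2)"
      by (subst Bochner_Integration.integral_add) (use i2 i3 in auto)
    also have "\<dots> \<le> \<eta> * (2 * pi * (a * b)) + 2 * \<eta> * b\<^sup>2"
      unfolding b_def norm_L2_sq[symmetric] using tr \<eta> by (intro add_mono mult_left_mono) (auto simp: b_def)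
    also have "\<dots> = (2 * pi) * (\<eta> * (a * b)) + 2 * \<eta> * b\<^sup>2" by simp
    \<comment> \<open>The constant 8 comes from 2 pi < 8.\<close>
    also have "\<dots> \<le> 8 * (\<eta> * (a * b)) + 8 * \<eta> * b\<^sup>2"
      using pi_less_4 ab \<eta> by (intro add_mono mult_right_mono) auto
    also have "\<dots> = 8 * \<eta> * (a + b) * b" by (simp add: power2_eq_square algebra_simps)
    finally show ?thesis by (simp add: a_def b_def)
  qed
qed

text \<open>With D = s^2 + \<eta>^2, the bounds rest on t/\<eta> = 1/sqrt D, |s| t \<le> \<eta> and
  |\<eta>^2 - s^2| \<le> D. Each estimate comes in two forms: one keeps a factor t, which later
  localises a function to the layer, the other discards it.\<close>

lemma multiplier_bounds:
  fixes s \<eta> :: real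
  assumes \<eta>: "\<eta> > 0"
  defines "t \<equiv> \<eta> / sqrt (s\<^sup>2 + \<eta>\<^sup>2)"
  shows "\<bar>s / (s\<^sup>2 + \<eta>\<^sup>2)\<bar> \<le> t / \<eta>" "\<bar>s / (s\<^sup>2 + \<eta>\<^sup>2)\<bar> \<le> 1 / \<eta>"
    "\<bar>2 * (1 - s) * (\<eta>\<^sup>2 - s\<^sup>2) / (s\<^sup>2 + \<eta>\<^sup>2)\<^sup>2\<bar> \<le> 2 * (1 + \<eta>) * t / \<eta>\<^sup>2"
    "\<bar>2 * (1 - s) * (\<eta>\<^sup>2 - s\<^sup>2) / (s\<^sup>2 + \<eta>\<^sup>2)\<^sup>2\<bar> \<le> 2 * (1 + \<eta>) / \<eta>\<^sup>2"
proof -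
  define D where "D = s\<^sup>2 + \<eta>\<^sup>2"
  have D: "D > 0" using \<eta> by (simp add: D_def add_nonneg_pos)
  have rt: "sqrt D > 0" "sqrt D * sqrt D = D" using D by auto
  have le: "\<eta> \<le> sqrt D" "\<bar>s\<bar> \<le> sqrt D" by (auto simp: D_def intro: real_le_rsqrt)
  have t: "0 \<le> t" "t \<le> 1" "\<bar>s\<bar> * t \<le> \<eta>"
    using \<eta> rt(1) le unfolding t_def D_def[symmetric] by (auto simp: field_simps intro: mult_left_mono)
  have t2: "t * t = \<eta>\<^sup>2 / D"
    unfolding t_def D_def[symmetric] by (simp only: times_divide_times_eq rt(2) power2_eq_square)
  have te: "t / \<eta> = 1 / sqrt D" using \<eta> by (simp add: t_def D_def)
  have "\<bar>s\<bar> / D \<le> sqrt D / D" using le D by (intro divide_right_mono) auto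
  also have "\<dots> = 1 / sqrt D" using rt D by (simp add: field_simps)
  finally show 1: "\<bar>s / (s\<^sup>2 + \<eta>\<^sup>2)\<bar> \<le> t / \<eta>" using D by (simp add: te D_def[symmetric] abs_div_pos[symmetric])
  also have "\<dots> \<le> 1 / \<eta>" using t \<eta> by (intro divide_right_mono) auto
  finally show "\<bar>s / (s\<^sup>2 + \<eta>\<^sup>2)\<bar> \<le> 1 / \<eta>" .
  have "\<bar>\<eta>\<^sup>2 - s\<^sup>2\<bar> \<le> D" by (auto simp: D_def abs_le_iff)
  then have "2 * \<bar>1 - s\<bar> * \<bar>\<eta>\<^sup>2 - s\<^sup>2\<bar> / D\<^sup>2 \<le> 2 * (1 + \<bar>s\<bar>) * D / D\<^sup>2"
    by (intro divide_right_mono mult_mono) auto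
  then have "\<bar>2 * (1 - s) * (\<eta>\<^sup>2 - s\<^sup>2) / D\<^sup>2\<bar> \<le> 2 * (1 + \<bar>s\<bar>) * D / D\<^sup>2"
    by (simp only: abs_mult abs_divide abs_power2 abs_numeral)
  also have "\<dots> = 2 * (1 + \<bar>s\<bar>) / D" using D by (simp add: power2_eq_square)
  also have "1 / D = t * t / \<eta>\<^sup>2" using \<eta> by (simp add: t2)
  \<comment> \<open>Of the two factors t in 1/D, one is spent on turning |s| into \<eta> and the
    other is kept.\<close>
  then have "2 * (1 + \<bar>s\<bar>) / D = 2 * (t + \<bar>s\<bar> * t) * t / \<eta>\<^sup>2"
    by (metis (no_types, lifting) distrib_right mult.assoc mult.right_neutral mult_1 times_divide_eq_right)
  also have "\<dots> \<le> 2 * (1 + \<eta>) * t / \<eta>\<^sup>2"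
    using t \<eta> by (intro divide_right_mono mult_right_mono mult_left_mono) auto
  finally show 2: "\<bar>2 * (1 - s) * (\<eta>\<^sup>2 - s\<^sup>2) / (s\<^sup>2 + \<eta>\<^sup>2)\<^sup>2\<bar> \<le> 2 * (1 + \<eta>) * t / \<eta>\<^sup>2"
    by (simp add: D_def)
  also have "\<dots> \<le> 2 * (1 + \<eta>) * 1 / \<eta>\<^sup>2"
    using t \<eta> by (intro divide_right_mono mult_left_mono) auto
  finally show "\<bar>2 * (1 - s) * (\<eta>\<^sup>2 - s\<^sup>2) / (s\<^sup>2 + \<eta>\<^sup>2)\<^sup>2\<bar> \<le> 2 * (1 + \<eta>) / \<eta>\<^sup>2" by simp
qed

text \<open>1/s regularised at scale \<eta>: the real part of 1/(s - i \<eta>), where s = 1 - lam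
  r^2.\<close>

definition layer_mult :: "real \<Rightarrow> real \<Rightarrow> real \<Rightarrow> real" where
  "layer_mult lam \<eta> r = (1 - lam * r\<^sup>2) / ((1 - lam * r\<^sup>2)\<^sup>2 + \<eta>\<^sup>2)"

definition layer_mult' :: "real \<Rightarrow> real \<Rightarrow> real \<Rightarrow> real" where
  "layer_mult' lam \<eta> r = - (2 * lam * r) * (\<eta>\<^sup>2 - (1 - lam * r\<^sup>2)\<^sup>2) / ((1 - lam * r\<^sup>2)\<^sup>2 + \<eta>\<^sup>2)\<^sup>2"

text \<open>Since lam r^2 = 1 - s, the product of r and the derivative is a function of s alone;
  hence the bounds are uniform in \<open>lam\<close> and \<open>r\<close>.\<close>

lemma layer_mult_bounds:
  assumes \<eta>: "\<eta> > 0"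
  shows "\<bar>layer_mult lam \<eta> r\<bar> \<le> theta lam \<eta> r / \<eta>" "\<bar>layer_mult lam \<eta> r\<bar> \<le> 1 / \<eta>"
    "\<bar>r * layer_mult' lam \<eta> r\<bar> \<le> 2 * (1 + \<eta>) * theta lam \<eta> r / \<eta>\<^sup>2"
    "\<bar>r * layer_mult' lam \<eta> r\<bar> \<le> 2 * (1 + \<eta>) / \<eta>\<^sup>2"
proof -
  have e: "r * layer_mult' lam \<eta> r = - (2 * (1 - (1 - lam * r\<^sup>2)) * (\<eta>\<^sup>2 - (1 - lam * r\<^sup>2)\<^sup>2) / ((1 - lam * r\<^sup>2)\<^sup>2 + \<eta>\<^sup>2)\<^sup>2)"
    by (simp add: layer_mult'_def power2_eq_square[of r])
  show "\<bar>layer_mult lam \<eta> r\<bar> \<le> theta lam \<eta> r / \<eta>" "\<bar>layer_mult lam \<eta> r\<bar> \<le> 1 / \<eta>"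
    "\<bar>r * layer_mult' lam \<eta> r\<bar> \<le> 2 * (1 + \<eta>) * theta lam \<eta> r / \<eta>\<^sup>2"
    "\<bar>r * layer_mult' lam \<eta> r\<bar> \<le> 2 * (1 + \<eta>) / \<eta>\<^sup>2"
    unfolding e abs_minus_cancel layer_mult_def theta_def
    using multiplier_bounds[OF \<eta>, of "1 - lam * r\<^sup>2"] by blast+
qed

lemma layer_mult_deriv:
  assumes \<eta>: "\<eta> > 0"
  shows "(layer_mult lam \<eta> has_real_derivative layer_mult' lam \<eta> r) (at r)"
    and "continuous_on S (layer_mult' lam \<eta>)" and "continuous_on S (layer_mult lam \<eta>)"
proof -
  have pos: "(1 - lam * r\<^sup>2)\<^sup>2 + \<eta>\<^sup>2 \<noteq> 0" for r
    using \<eta> by (metis add_nonneg_pos less_irrefl zero_le_power2 zero_less_power)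
  show "(layer_mult lam \<eta> has_real_derivative layer_mult' lam \<eta> r) (at r)"
  proof -
    define s where "s r = 1 - lam * r\<^sup>2" for r
    have num: "(s has_real_derivative - (2 * lam * r)) (at r)"
      unfolding s_def[abs_def] by (auto intro!: derivative_eq_intros)
    have den: "((\<lambda>r. (s r)\<^sup>2 + \<eta>\<^sup>2) has_real_derivative 2 * s r * (- (2 * lam * r))) (at r)"
      by (auto intro!: derivative_eq_intros num)
    have "(s r)\<^sup>2 + \<eta>\<^sup>2 \<noteq> 0" using pos[of r] by (simp add: s_def)
    from DERIV_divide[OF num den this]
    have "(layer_mult lam \<eta> has_real_derivative (- (2 * lam * r) * ((s r)\<^sup>2 + \<eta>\<^sup>2) - s r * (2 * s r * (- (2 * lam * r))))
        / (((s r)\<^sup>2 + \<eta>\<^sup>2) * ((s r)\<^sup>2 + \<eta>\<^sup>2))) (at r)"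
      by (simp add: layer_mult_def[abs_def] s_def)
    moreover have "- (2 * lam * r) * ((s r)\<^sup>2 + \<eta>\<^sup>2) - s r * (2 * s r * (- (2 * lam * r)))
        = - (2 * lam * r) * (\<eta>\<^sup>2 - (s r)\<^sup>2)"
      by (simp add: power2_eq_square algebra_simps)
    ultimately show ?thesis
      by (simp only: layer_mult'_def s_def power2_eq_square[of "_ + _"])
  qed
  show "continuous_on S (layer_mult' lam \<eta>)" "continuous_on S (layer_mult lam \<eta>)"
    unfolding layer_mult_def[abs_def] layer_mult'_def[abs_def] using \<eta> by (auto intro!: continuous_intros simp: pos)
qed

section \<open>The rescaled weak equation and its estimates\<close>

text \<open>
  \<open>T G\<close> stands for the pairing of the forcing, divided by \<open>K = \<bar>k B\<bar>\<close>, with \<open>G\<close>.  The bound on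
  \<open>T\<close> covers both norms of the forcing: \<open>n = 0\<close> for the weighted \<open>L\<^sup>2\<close> norm and \<open>n = m\<close> for the
  \<open>H\<^sup>-\<^sup>1\<close> norm; accordingly \<open>\<rho>\<close> will be \<open>c' \<eta> / r\<^sup>2\<close> or \<open>c' \<eta> / R\<^sup>2\<close>.
\<close>

locale weak_resolvent =
  fixes R lam \<eta> \<kappa> \<sigma> d m n :: real and \<rho> :: "real \<Rightarrow> real" and w w1 :: "real \<Rightarrow> complex"
    and T :: "(real \<Rightarrow> complex) \<Rightarrow> complex"
  assumes R: "R > 1" and \<eta>: "\<eta> > 0" and \<kappa>: "\<kappa> \<ge> 1" and \<sigma>: "\<bar>\<sigma>\<bar> = 1" and m: "m \<ge> 0" and n: "n \<ge> 0"
    and w: "C1_on R w w1" "w 1 = 0" "w R = 0"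
    and \<rho>: "continuous_on {1..R} \<rho>" "\<And>r. r \<in> {1..R} \<Longrightarrow> 0 \<le> \<rho> r" "\<And>r. r \<in> {1..R} \<Longrightarrow> \<rho> r \<le> d / r\<^sup>2"
    and T: "\<And>G G1. C1_on R G G1 \<Longrightarrow> G 1 = 0 \<Longrightarrow> G R = 0 \<Longrightarrow>
        T G = of_real (\<eta>^3) * (inner_L2 R w1 G1 + of_real (\<kappa>\<^sup>2 - 1/4) * inner_L2 R (divr w) (divr G))
          + \<i> * of_real \<sigma> * inner_L2 R (\<lambda>r. of_real (1 / r\<^sup>2 - lam) * w r) G
          - inner_L2 R (\<lambda>r. of_real (\<rho> r) * w r) G"
    and T_bound: "\<And>G G1. C1_on R G G1 \<Longrightarrow> G 1 = 0 \<Longrightarrow> G R = 0 \<Longrightarrow>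
        cmod (T G) \<le> n * norm_L2 R G1 + m * norm_L2 R (divr G)"
begin

abbreviation "a \<equiv> norm_L2 R w1"
abbreviation "b \<equiv> norm_L2 R (divr w)"

lemma cont_w: "continuous_on {1..R} w" "continuous_on {1..R} w1" "continuous_on {1..R} (divr w)"
  using C1_onD[OF w(1)] by (auto intro: continuous_on_divr)

lemma d_nonneg: "d \<ge> 0"
  using \<rho>(2,3)[of 1] R by auto

lemma mult_cnj: "z * cnj z = of_real ((cmod z)\<^sup>2)"
  by (rule complex_norm_square[symmetric])

text \<open>The transport term tested with \<open>w\<close> is purely imaginary, so the real part
  sees only diffusion and the shift \<rho>, and the latter costs at most d b^2.\<close>

lemma energy: "\<eta>^3 * (a\<^sup>2 + (\<kappa>\<^sup>2 - 1/4) * b\<^sup>2) \<le> n * a + m * b + d * b\<^sup>2"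
proof -
  define X where "X = (LINT r|leb R. (1 / r\<^sup>2 - lam) * (cmod (w r))\<^sup>2)"
  define Y where "Y = (LINT r|leb R. \<rho> r * (cmod (w r))\<^sup>2)"
  have X: "inner_L2 R (\<lambda>r. of_real (1 / r\<^sup>2 - lam) * w r) w = of_real X"
    unfolding X_def by (rule inner_L2_real) (simp only: mult.assoc mult_cnj of_real_mult)
  have Y: "inner_L2 R (\<lambda>r. of_real (\<rho> r) * w r) w = of_real Y"
    unfolding Y_def by (rule inner_L2_real) (simp only: mult.assoc mult_cnj of_real_mult)
  have "Y \<le> (LINT r|leb R. d * (cmod (divr w r))\<^sup>2)"
    unfolding Y_def
  proof (rule integral_mono)
    fix r assume "r \<in> space (leb R)"
    then have "\<rho> r * (cmod (w r))\<^sup>2 \<le> d / r\<^sup>2 * (cmod (w r))\<^sup>2"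
      using \<rho>(3) by (intro mult_right_mono) auto
    then show "\<rho> r * (cmod (w r))\<^sup>2 \<le> d * (cmod (divr w r))\<^sup>2"
      by (simp add: norm_divide power_divide)
  qed (intro continuous_imp_integrable_real continuous_intros \<rho> cont_w)+
  also have "\<dots> = d * b\<^sup>2" by (simp add: norm_L2_sq)
  finally have Yle: "Y \<le> d * b\<^sup>2" .
  have "Re (T w) = \<eta>^3 * (a\<^sup>2 + (\<kappa>\<^sup>2 - 1/4) * b\<^sup>2) - Y"
    unfolding T[OF w] X Y inner_L2_self by simp
  moreover have "Re (T w) \<le> n * a + m * b"
    using T_bound[OF w] complex_Re_le_cmod[of "T w"] by simp
  ultimately show ?thesis using Yle by simp
qed

text \<open>For a real multiplier \<xi> the terms with |w1|^2, |w/r|^2 and \<rho> are all real, so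
  the imaginary part retains only transport and the commutator w1 cnj(\<xi>' w). The slope bound
  2/\<eta> + 2 produces both the factor of \<open>n\<close> and, multiplied by \<eta>^3 and divided
  by \<eta>, the coefficient 2 \<eta> + 2 \<eta>^2.\<close>

lemma layer:
  assumes \<eta>2: "\<eta> \<le> 1/2"
  shows "b\<^sup>2 \<le> (n * (a + (2 / \<eta> + 2) * b) + m * b) / \<eta> + (2 * \<eta> + 2 * \<eta>\<^sup>2) * a * b + 8 * \<eta> * (a + b) * b"
proof -
  define \<xi> \<xi>' where "\<xi> r = \<eta> * layer_mult lam \<eta> r" and "\<xi>' r = \<eta> * layer_mult' lam \<eta> r" for r
  define G where "G r = of_real (\<xi> r) * w r" for r
  have C\<xi>: "C1_on R (\<lambda>r. of_real (\<xi> r)) (\<lambda>r. of_real (\<xi>' r))"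
    unfolding \<xi>_def[abs_def] \<xi>'_def[abs_def]
    by (intro C1_on_of_real continuous_intros layer_mult_deriv DERIV_cmult \<eta>)
  have c\<xi>: "continuous_on {1..R} \<xi>" "continuous_on {1..R} \<xi>'"
    unfolding \<xi>_def \<xi>'_def by (intro continuous_intros layer_mult_deriv \<eta>)+
  have \<xi>1: "\<bar>\<xi> r\<bar> \<le> 1" for r
    using mult_left_mono[OF layer_mult_bounds(2)[OF \<eta>, of lam r], of \<eta>] \<eta> by (simp add: \<xi>_def abs_mult)
  have \<xi>2: "\<bar>r * \<xi>' r\<bar> \<le> 2 / \<eta> + 2" for r
  proof -
    have "\<bar>r * \<xi>' r\<bar> = \<eta> * \<bar>r * layer_mult' lam \<eta> r\<bar>" using \<eta> by (simp add: \<xi>'_def abs_mult)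
    also have "\<dots> \<le> \<eta> * (2 * (1 + \<eta>) / \<eta>\<^sup>2)" using layer_mult_bounds(4)[OF \<eta>] \<eta> by (intro mult_left_mono) auto
    also have "\<dots> = 2 / \<eta> + 2" using \<eta> by (simp add: field_simps power2_eq_square)
    finally show ?thesis .
  qed
  define U V where "U r = of_real (\<xi> r) * w1 r" and "V r = of_real (\<xi>' r) * w r" for r
  have G: "C1_on R G (\<lambda>r. U r + V r)" "G 1 = 0" "G R = 0"
    using C1_on_mult[OF C\<xi> w(1)] w by (auto simp: G_def[abs_def] U_def V_def)
  have L: "w1 \<in> L2 R" "divr w \<in> L2 R" "U \<in> L2 R" "V \<in> L2 R" "(\<lambda>r. U r + V r) \<in> L2 R" "divr G \<in> L2 R"
    unfolding U_def[abs_def] V_def[abs_def] G_def[abs_def]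
    by (intro L2_continuous continuous_intros cont_w c\<xi> continuous_on_divr)+
  have Vle: "cmod (V r) \<le> (2 / \<eta> + 2) * cmod (divr w r)" if "r \<in> {1..R}" for r
  proof -
    have "cmod (V r) = \<bar>r * \<xi>' r\<bar> * cmod (divr w r)"
      using that by (simp add: V_def norm_mult norm_divide abs_mult)
    also have "\<dots> \<le> (2 / \<eta> + 2) * cmod (divr w r)" by (intro mult_right_mono \<xi>2) auto
    finally show ?thesis .
  qed
  have Ule: "cmod (U r) \<le> cmod (w1 r)" for r
    using mult_right_mono[OF \<xi>1, of "cmod (w1 r)"] by (simp add: U_def norm_mult)
  have G1: "norm_L2 R (\<lambda>r. U r + V r) \<le> 1 * a + (2 / \<eta> + 2) * b"
  proof (rule norm_L2_bound2[OF L(1,2,5)])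
    fix r assume "r \<in> {1..R}"
    then show "cmod (U r + V r) \<le> 1 * cmod (w1 r) + (2 / \<eta> + 2) * cmod (divr w r)"
      using norm_triangle_ineq[of "U r" "V r"] Vle[of r] Ule[of r] by simp
  qed (use \<eta> in auto)
  have G0: "norm_L2 R (divr G) \<le> 1 * b"
  proof (rule norm_L2_bound[OF L(2,6)])
    fix r
    show "cmod (divr G r) \<le> 1 * cmod (divr w r)"
      using mult_right_mono[OF \<xi>1, of "cmod (divr w r)"] by (simp add: G_def norm_mult norm_divide)
  qed auto
  have TG: "cmod (T G) \<le> n * (a + (2 / \<eta> + 2) * b) + m * b"
    using T_bound[OF G] mult_left_mono[OF G1 n] mult_left_mono[OF G0 m] by simp
  define X where "X = (LINT r|leb R. (1 / r\<^sup>2 - lam) * \<xi> r * (cmod (w r))\<^sup>2)"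
  have X: "inner_L2 R (\<lambda>r. of_real (1 / r\<^sup>2 - lam) * w r) G = of_real X"
    unfolding X_def
    by (rule inner_L2_real) (simp add: G_def mult.assoc mult.left_commute del: of_real_diff flip: complex_norm_square)
  define Y where "Y = (LINT r|leb R. \<rho> r * \<xi> r * (cmod (w r))\<^sup>2)"
  have Y: "inner_L2 R (\<lambda>r. of_real (\<rho> r) * w r) G = of_real Y"
    unfolding Y_def
    by (rule inner_L2_real) (simp add: G_def mult.assoc mult.left_commute flip: complex_norm_square)
  define Z where "Z = (LINT r|leb R. \<xi> r * (cmod (divr w r))\<^sup>2)"
  have Z: "inner_L2 R (divr w) (divr G) = of_real Z"
    unfolding Z_def
    by (rule inner_L2_real) (simp add: G_def norm_divide power_divide power2_eq_square[of r for r] flip: complex_norm_square)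
  define W where "W = (LINT r|leb R. \<xi> r * (cmod (w1 r))\<^sup>2)"
  have W: "inner_L2 R w1 U = of_real W"
    unfolding W_def
    by (rule inner_L2_real) (simp add: U_def mult.left_commute flip: complex_norm_square)
  \<comment> \<open>\<open>U\<close> contributes a real number, so only \<open>V\<close>, the part
    with \<xi>', reaches the imaginary part.\<close>
  have split: "inner_L2 R w1 (\<lambda>r. U r + V r) = of_real W + inner_L2 R w1 V"
    using inner_L2_add_right[OF L(1,3,4)] W by simp
  have "Im (T G) = \<eta>^3 * Im (inner_L2 R w1 V) + \<sigma> * X"
    unfolding T[OF G] X Y Z split by simp
  then have "\<sigma> * X = Im (T G) - \<eta>^3 * Im (inner_L2 R w1 V)" by simp
  then have "\<bar>X\<bar> \<le> \<bar>Im (T G)\<bar> + \<eta>^3 * \<bar>Im (inner_L2 R w1 V)\<bar>"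
    using \<sigma> \<eta> abs_triangle_ineq4[of "Im (T G)" "\<eta>^3 * Im (inner_L2 R w1 V)"]
    by (metis abs_mult abs_of_pos mult_1 zero_less_power)
  also have "\<dots> \<le> cmod (T G) + \<eta>^3 * cmod (inner_L2 R w1 V)"
    using \<eta> by (intro add_mono mult_left_mono abs_Im_le_cmod) auto
  also have "cmod (inner_L2 R w1 V) \<le> (2 / \<eta> + 2) * (a * b)"
  proof (rule inner_L2_bound[OF L(1,2)])
    fix r assume "r \<in> {1..R}"
    from mult_left_mono[OF Vle[OF this], of "cmod (w1 r)"]
    show "cmod (w1 r) * cmod (V r) \<le> (2 / \<eta> + 2) * (cmod (w1 r) * cmod (divr w r))"
      by (simp add: mult.left_commute)
  qed (use \<eta> in auto)
  finally have Xle: "\<bar>X\<bar> \<le> (n * (a + (2 / \<eta> + 2) * b) + m * b) + \<eta>^3 * ((2 / \<eta> + 2) * (a * b))"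
    using TG \<eta> by (simp add: mult_left_mono)
  \<comment> \<open>The splitting of 1 from the overview, applied to |w/r|^2: the part with s^2/(s^2
    + \<eta>^2) integrates to X/\<eta>, the part with \<eta>^2/(s^2 + \<eta>^2) to Q^2.\<close>
  define Q where "Q = norm_L2 R (\<lambda>r. of_real (theta lam \<eta> r) * divr w r)"
  have "b\<^sup>2 = X / \<eta> + Q\<^sup>2"
  proof -
    have "(LINT r|leb R. (cmod (divr w r))\<^sup>2) = (LINT r|leb R. (1 / r\<^sup>2 - lam) * \<xi> r * (cmod (w r))\<^sup>2 / \<eta>
        + (cmod (of_real (theta lam \<eta> r) * divr w r))\<^sup>2)"
    proof (rule Bochner_Integration.integral_cong[OF refl])
      fix r assume "r \<in> space (leb R)"
      then have r: "r > 0" by simp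
      define s where "s = 1 - lam * r\<^sup>2"
      have D: "s\<^sup>2 + \<eta>\<^sup>2 > 0" using \<eta> by (simp add: add_nonneg_pos)
      have "(1 / r\<^sup>2 - lam) * (cmod (w r))\<^sup>2 = s * (cmod (divr w r))\<^sup>2"
        using r by (simp add: s_def norm_divide power_divide field_simps)
      then have "(1 / r\<^sup>2 - lam) * \<xi> r * (cmod (w r))\<^sup>2 / \<eta> = s\<^sup>2 / (s\<^sup>2 + \<eta>\<^sup>2) * (cmod (divr w r))\<^sup>2"
        using \<eta> by (simp add: \<xi>_def layer_mult_def s_def[symmetric] power2_eq_square[of s] mult_ac)
      moreover have "(cmod (of_real (theta lam \<eta> r) * divr w r))\<^sup>2 = \<eta>\<^sup>2 / (s\<^sup>2 + \<eta>\<^sup>2) * (cmod (divr w r))\<^sup>2"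
        by (simp only: norm_mult norm_of_real power_mult_distrib power2_abs theta_sq s_def)
      moreover have "s\<^sup>2 / (s\<^sup>2 + \<eta>\<^sup>2) + \<eta>\<^sup>2 / (s\<^sup>2 + \<eta>\<^sup>2) = 1"
        using D \<eta> by (simp flip: add_divide_distrib)
      ultimately show "(cmod (divr w r))\<^sup>2 = (1 / r\<^sup>2 - lam) * \<xi> r * (cmod (w r))\<^sup>2 / \<eta>
        + (cmod (of_real (theta lam \<eta> r) * divr w r))\<^sup>2"
        by (simp only: distrib_right[symmetric] mult_1)
    qed
    also have "\<dots> = (LINT r|leb R. (1 / r\<^sup>2 - lam) * \<xi> r * (cmod (w r))\<^sup>2 / \<eta>)
        + (LINT r|leb R. (cmod (of_real (theta lam \<eta> r) * divr w r))\<^sup>2)"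
    proof (rule Bochner_Integration.integral_add)
      show "integrable (leb R) (\<lambda>r. (1 / r\<^sup>2 - lam) * \<xi> r * (cmod (w r))\<^sup>2 / \<eta>)"
        using \<eta> by (intro continuous_imp_integrable_real continuous_intros cont_w c\<xi>) auto
      show "integrable (leb R) (\<lambda>r. (cmod (of_real (theta lam \<eta> r) * divr w r))\<^sup>2)"
        using \<eta> by (intro continuous_imp_integrable_real continuous_intros cont_w continuous_on_theta)
    qed
    finally show ?thesis by (simp add: X_def Q_def norm_L2_sq)
  qed
  also have "X / \<eta> \<le> ((n * (a + (2 / \<eta> + 2) * b) + m * b) + \<eta>^3 * ((2 / \<eta> + 2) * (a * b))) / \<eta>"
    using Xle \<eta> by (intro divide_right_mono) auto
  also have "\<dots> = (n * (a + (2 / \<eta> + 2) * b) + m * b) / \<eta> + (2 * \<eta> + 2 * \<eta>\<^sup>2) * a * b"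
    using \<eta> by (simp add: field_simps power2_eq_square power3_eq_cube)
  also have "Q\<^sup>2 \<le> 8 * \<eta> * (a + b) * b"
    unfolding Q_def by (rule critical_layer_bound[OF w R \<eta> \<eta>2])
  finally show ?thesis by simp
qed

text \<open>Away from the layer, <w, \<phi>> equals the transport term tested with a multiple of
  \<phi>, and the equation replaces it by forcing, diffusion and shift. All these terms contain
  either the localised norm \<open>Q\<close>, which is small by the layer bound, or \<open>p\<close>
  with one power of \<eta> fewer in the denominator.\<close>

lemma stream_split:
  assumes \<phi>: "C1_on R \<phi> \<phi>1" "\<phi> 1 = 0" "\<phi> R = 0"
    and \<eta>2: "\<eta> \<le> 1/2"
  defines "p \<equiv> norm_L2 R \<phi>1" and "Q \<equiv> norm_L2 R (\<lambda>r. of_real (theta lam \<eta> r) * divr \<phi> r)"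
  shows "cmod (inner_L2 R w \<phi>) \<le> R\<^sup>2 * (n * (5 * Q / \<eta>\<^sup>2 + p / \<eta>) + m * Q / \<eta>
    + \<eta>^3 * a * (5 * Q / \<eta>\<^sup>2 + p / \<eta>) + \<eta>\<^sup>2 * \<kappa>\<^sup>2 * b * Q + d * b * Q / \<eta> + b * Q)"
proof -
  define th where "th r = of_real (theta lam \<eta> r) * divr \<phi> r" for r
  have cphi: "continuous_on {1..R} \<phi>" "continuous_on {1..R} \<phi>1" "continuous_on {1..R} (divr \<phi>)"
    using C1_onD[OF \<phi>(1)] by (auto intro: continuous_on_divr)
  \<comment> \<open>The factor r^2 cancels the 1/r^2 of the transport weight: (1/r^2 - lam) \<xi> =
    s^2/(s^2 + \<eta>^2). It is paid for by R^2.\<close>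
  define \<xi> \<xi>' where "\<xi> r = r\<^sup>2 * layer_mult lam \<eta> r" and "\<xi>' r = 2 * r * layer_mult lam \<eta> r + r\<^sup>2 * layer_mult' lam \<eta> r" for r
  define G G1 where "G r = of_real (\<xi> r) * \<phi> r" and "G1 r = of_real (\<xi> r) * \<phi>1 r + of_real (\<xi>' r) * \<phi> r" for r
  have c\<xi>: "continuous_on {1..R} \<xi>" "continuous_on {1..R} \<xi>'"
    unfolding \<xi>_def \<xi>'_def by (intro continuous_intros layer_mult_deriv \<eta>)+
  have C\<xi>: "C1_on R (\<lambda>r. of_real (\<xi> r)) (\<lambda>r. of_real (\<xi>' r))"
  proof (intro C1_on_of_real c\<xi>)
    fix r
    show "(\<xi> has_real_derivative \<xi>' r) (at r)"
      unfolding \<xi>_def[abs_def] \<xi>'_def by (auto intro!: derivative_eq_intros layer_mult_deriv(1) \<eta>)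
  qed
  have G: "C1_on R G G1" "G 1 = 0" "G R = 0"
    using C1_on_mult[OF C\<xi> \<phi>(1)] \<phi> by (auto simp: G_def[abs_def] G1_def[abs_def])
  have L: "w1 \<in> L2 R" "divr w \<in> L2 R" "G1 \<in> L2 R" "divr G \<in> L2 R" "th \<in> L2 R" "\<phi>1 \<in> L2 R"
    unfolding G_def[abs_def] G1_def[abs_def] th_def[abs_def]
    by (intro L2_continuous continuous_intros cont_w c\<xi> cphi continuous_on_divr continuous_on_theta \<eta>)+
  have p0: "p \<ge> 0" "Q \<ge> 0" by (auto simp: p_def Q_def)
  have Q: "norm_L2 R th = Q" by (simp add: Q_def th_def[abs_def])
  have rR: "r\<^sup>2 \<le> R\<^sup>2" if "r \<in> {1..R}" for r using that by (intro power_mono) auto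
  have gle: "cmod (divr G r) \<le> r\<^sup>2 / \<eta> * cmod (th r)" for r
  proof -
    have "cmod (divr G r) = r\<^sup>2 * (\<bar>layer_mult lam \<eta> r\<bar> * cmod (divr \<phi> r))"
      by (simp add: G_def \<xi>_def norm_mult norm_divide abs_mult norm_power)
    also have "\<dots> \<le> r\<^sup>2 * (theta lam \<eta> r / \<eta> * cmod (divr \<phi> r))"
      by (intro mult_left_mono mult_right_mono layer_mult_bounds \<eta>) auto
    also have "\<dots> = r\<^sup>2 / \<eta> * cmod (th r)"
      using theta_bounds(1)[OF \<eta>, of lam r] by (simp add: th_def norm_mult norm_divide)
    finally show ?thesis .
  qed
  have gleR: "cmod (divr G r) \<le> R\<^sup>2 / \<eta> * cmod (th r)" if "r \<in> {1..R}" for r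
  proof -
    have "r\<^sup>2 / \<eta> * cmod (th r) \<le> R\<^sup>2 / \<eta> * cmod (th r)"
      using rR[OF that] \<eta> by (intro mult_right_mono divide_right_mono) auto
    then show ?thesis using gle[of r] by simp
  qed
  have g1le: "cmod (G1 r) \<le> R\<^sup>2 * 5 / \<eta>\<^sup>2 * cmod (th r) + R\<^sup>2 / \<eta> * cmod (\<phi>1 r)" if r: "r \<in> {1..R}" for r
  proof -
    have t0: "theta lam \<eta> r \<ge> 0" by (rule theta_bounds[OF \<eta>])
    have "cmod (G1 r) \<le> cmod (of_real (\<xi> r) * \<phi>1 r) + cmod (of_real (\<xi>' r) * \<phi> r)"
      unfolding G1_def by (rule norm_triangle_ineq)
    also have "cmod (of_real (\<xi> r) * \<phi>1 r) = r\<^sup>2 * (\<bar>layer_mult lam \<eta> r\<bar> * cmod (\<phi>1 r))"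
      by (simp add: \<xi>_def norm_mult abs_mult norm_power)
    also have "\<dots> \<le> R\<^sup>2 * (1 / \<eta> * cmod (\<phi>1 r))"
      using rR[OF r] by (intro mult_mono mult_right_mono layer_mult_bounds \<eta>) auto
    also have "cmod (of_real (\<xi>' r) * \<phi> r) = r\<^sup>2 * (\<bar>2 * layer_mult lam \<eta> r + r * layer_mult' lam \<eta> r\<bar> * cmod (divr \<phi> r))"
    proof -
      have "\<xi>' r = r * (2 * layer_mult lam \<eta> r + r * layer_mult' lam \<eta> r)"
        by (simp add: \<xi>'_def power2_eq_square algebra_simps)
      then have "cmod (of_real (\<xi>' r) * \<phi> r) = \<bar>r\<bar> * \<bar>2 * layer_mult lam \<eta> r + r * layer_mult' lam \<eta> r\<bar> * cmod (\<phi> r)"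
        by (simp only: norm_mult norm_of_real abs_mult)
      then show ?thesis using r by (simp add: norm_divide power2_eq_square)
    qed
    also have "\<dots> \<le> R\<^sup>2 * (5 * theta lam \<eta> r / \<eta>\<^sup>2 * cmod (divr \<phi> r))"
    proof (intro mult_mono mult_right_mono rR r)
      have "\<bar>2 * layer_mult lam \<eta> r + r * layer_mult' lam \<eta> r\<bar> \<le> 2 * \<bar>layer_mult lam \<eta> r\<bar> + \<bar>r * layer_mult' lam \<eta> r\<bar>"
        by (rule order_trans[OF abs_triangle_ineq]) simp
      also have "\<dots> \<le> 2 * (theta lam \<eta> r / \<eta>) + 2 * (1 + \<eta>) * theta lam \<eta> r / \<eta>\<^sup>2"
        by (intro add_mono mult_left_mono layer_mult_bounds \<eta>) auto
      also have "\<dots> = (2 + 4 * \<eta>) * theta lam \<eta> r / \<eta>\<^sup>2"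
        using \<eta> by (simp add: field_simps power2_eq_square)
      \<comment> \<open>The coefficient 2 + 4 \<eta> is at most 4 for \<eta> \<le> 1/2.\<close>
      also have "\<dots> \<le> 5 * theta lam \<eta> r / \<eta>\<^sup>2"
        using \<eta>2 t0 by (intro divide_right_mono mult_right_mono) auto
      finally show "\<bar>2 * layer_mult lam \<eta> r + r * layer_mult' lam \<eta> r\<bar> \<le> 5 * theta lam \<eta> r / \<eta>\<^sup>2" .
    qed (use t0 in auto)
    also have "\<dots> = R\<^sup>2 * 5 / \<eta>\<^sup>2 * cmod (th r)"
      using t0 by (simp add: th_def norm_mult norm_divide)
    finally show ?thesis by simp
  qed
  define H where "H = R\<^sup>2 * (5 * Q / \<eta>\<^sup>2 + p / \<eta>)"
  have NG1: "norm_L2 R G1 \<le> H"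
    using norm_L2_bound2[OF L(5,6,3), of "R\<^sup>2 * 5 / \<eta>\<^sup>2" "R\<^sup>2 / \<eta>"] g1le \<eta>
    by (simp add: H_def Q p_def algebra_simps)
  have NG: "norm_L2 R (divr G) \<le> R\<^sup>2 / \<eta> * Q"
    using norm_L2_bound[OF L(5,4), of "R\<^sup>2 / \<eta>"] gleR \<eta> by (simp add: Q)
  have H0: "H \<ge> 0" using p0 \<eta> by (simp add: H_def)
  have "cmod (T G) \<le> n * norm_L2 R G1 + m * norm_L2 R (divr G)" by (rule T_bound[OF G])
  also have "\<dots> \<le> n * H + m * (R\<^sup>2 / \<eta> * Q)"
    using NG1 NG n m by (intro add_mono mult_left_mono) auto
  finally have B1: "cmod (T G) \<le> n * H + m * (R\<^sup>2 / \<eta> * Q)" .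
  have "cmod (inner_L2 R w1 G1) \<le> 1 * (a * norm_L2 R G1)"
    by (rule inner_L2_bound[OF L(1,3)]) auto
  also have "\<dots> \<le> a * H" using NG1 by (simp add: mult_left_mono)
  finally have B2: "cmod (inner_L2 R w1 G1) \<le> a * H" .
  have "cmod (inner_L2 R (divr w) (divr G)) \<le> 1 * (b * norm_L2 R (divr G))"
    by (rule inner_L2_bound[OF L(2,4)]) auto
  also have "\<dots> \<le> b * (R\<^sup>2 / \<eta> * Q)" using mult_left_mono[OF NG, of b] by simp
  finally have B3: "cmod (inner_L2 R (divr w) (divr G)) \<le> b * (R\<^sup>2 / \<eta> * Q)" .
  have B4: "cmod (inner_L2 R (\<lambda>r. of_real (\<rho> r) * w r) G) \<le> (d * R\<^sup>2 / \<eta>) * (b * norm_L2 R th)"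
  proof (rule inner_L2_bound[OF L(2,5)])
    fix r assume r: "r \<in> {1..R}"
    then have r0: "r > 0" by simp
    \<comment> \<open>The bound \<rho> \<le> d/r^2 exactly compensates the r^2 that arises from
      dividing both functions by r.\<close>
    have "cmod (of_real (\<rho> r) * w r) * cmod (G r) = (\<rho> r * r\<^sup>2) * (cmod (divr w r) * cmod (divr G r))"
      using r0 \<rho>(2)[OF r] by (simp add: norm_mult norm_divide power2_eq_square)
    also have "\<dots> \<le> d * (cmod (divr w r) * (R\<^sup>2 / \<eta> * cmod (th r)))"
      using r0 \<rho>(3)[OF r] d_nonneg by (intro mult_mono gleR r) (auto simp: field_simps)
    finally show "cmod (of_real (\<rho> r) * w r) * cmod (G r) \<le> d * R\<^sup>2 / \<eta> * (cmod (divr w r) * cmod (th r))"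
      by (simp add: mult_ac)
  qed (use d_nonneg \<eta> in auto)
  define I where "I = inner_L2 R (\<lambda>r. of_real (1 / r\<^sup>2 - lam) * w r) G"
  define P where "P = cmod (T G) + \<eta>^3 * (cmod (inner_L2 R w1 G1) + (\<kappa>\<^sup>2 - 1/4) * cmod (inner_L2 R (divr w) (divr G)))
      + cmod (inner_L2 R (\<lambda>r. of_real (\<rho> r) * w r) G)"
  have k0: "\<kappa>\<^sup>2 - 1/4 \<ge> 0" using power_mono[OF \<kappa>, of 2] by simp
  \<comment> \<open>The equation solved for the transport term; its modulus is that of
    \<open>I\<close> since |\<sigma>| = 1.\<close>
  have "\<i> * of_real \<sigma> * I = T G - of_real (\<eta>^3) * (inner_L2 R w1 G1 + of_real (\<kappa>\<^sup>2 - 1/4) * inner_L2 R (divr w) (divr G))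
      + inner_L2 R (\<lambda>r. of_real (\<rho> r) * w r) G"
    using T[OF G] by (simp add: I_def)
  then have "cmod (\<i> * of_real \<sigma> * I) \<le> cmod (T G) + cmod (of_real (\<eta>^3) * (inner_L2 R w1 G1 + of_real (\<kappa>\<^sup>2 - 1/4) * inner_L2 R (divr w) (divr G)))
      + cmod (inner_L2 R (\<lambda>r. of_real (\<rho> r) * w r) G)"
    using norm_triangle_ineq norm_triangle_ineq4
    by (smt (verit, best))
  also have "cmod (of_real (\<eta>^3) * (inner_L2 R w1 G1 + of_real (\<kappa>\<^sup>2 - 1/4) * inner_L2 R (divr w) (divr G)))
      = \<eta>^3 * cmod (inner_L2 R w1 G1 + of_real (\<kappa>\<^sup>2 - 1/4) * inner_L2 R (divr w) (divr G))"
    using \<eta> by (simp only: norm_mult norm_of_real) simp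
  also have "cmod (inner_L2 R w1 G1 + of_real (\<kappa>\<^sup>2 - 1/4) * inner_L2 R (divr w) (divr G))
      \<le> cmod (inner_L2 R w1 G1) + (\<kappa>\<^sup>2 - 1/4) * cmod (inner_L2 R (divr w) (divr G))"
    by (rule order_trans[OF norm_triangle_ineq]) (use k0 in \<open>simp add: norm_mult del: of_real_diff\<close>)
  finally have "cmod I \<le> P"
    using \<sigma> \<eta> by (simp add: norm_mult P_def mult_left_mono)
  also have "P \<le> (n * H + m * (R\<^sup>2 / \<eta> * Q)) + \<eta>^3 * (a * H + \<kappa>\<^sup>2 * (b * (R\<^sup>2 / \<eta> * Q))) + (d * R\<^sup>2 / \<eta>) * (b * Q)"
    unfolding P_def using B1 B2 B3 B4[unfolded Q] \<eta> k0 p0 by (intro add_mono mult_left_mono mult_mono) auto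
  finally have BI: "cmod I \<le> \<dots>" .
  \<comment> \<open>The layer part carries theta squared: one factor goes into \<open>th\<close>,
    the other is bounded by 1.\<close>
  define J where "J = inner_L2 R w (\<lambda>r. of_real ((theta lam \<eta> r)\<^sup>2) * \<phi> r)"
  have BJ: "cmod J \<le> R\<^sup>2 * (b * norm_L2 R th)"
    unfolding J_def
  proof (rule inner_L2_bound[OF L(2,5)])
    fix r assume r: "r \<in> {1..R}"
    then have r0: "r > 0" by simp
    have "cmod (w r) * cmod (of_real ((theta lam \<eta> r)\<^sup>2) * \<phi> r) = r\<^sup>2 * (theta lam \<eta> r * (cmod (divr w r) * cmod (th r)))"
      using r0 theta_bounds(1)[OF \<eta>, of lam r]
      by (simp add: th_def norm_mult norm_divide power2_eq_square)
    also have "\<dots> \<le> R\<^sup>2 * (1 * (cmod (divr w r) * cmod (th r)))"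
      using theta_bounds(1,2)[OF \<eta>, of lam r] by (intro mult_mono rR r mult_right_mono) auto
    finally show "cmod (w r) * cmod (of_real ((theta lam \<eta> r)\<^sup>2) * \<phi> r) \<le> R\<^sup>2 * (cmod (divr w r) * cmod (th r))" by simp
  qed auto
  have "inner_L2 R w \<phi> = inner_L2 R w (\<lambda>r. of_real ((1 / r\<^sup>2 - lam) * \<xi> r) * \<phi> r + of_real ((theta lam \<eta> r)\<^sup>2) * \<phi> r)"
    unfolding inner_L2_def
  proof (rule Bochner_Integration.integral_cong[OF refl])
    fix r assume "r \<in> space (leb R)"
    then have r: "r > 0" by simp
    define s where "s = 1 - lam * r\<^sup>2"
    have D: "s\<^sup>2 + \<eta>\<^sup>2 > 0" using \<eta> by (simp add: add_nonneg_pos)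
    have "(1 / r\<^sup>2 - lam) * \<xi> r = s * layer_mult lam \<eta> r"
      using r by (simp add: s_def \<xi>_def field_simps)
    then have "(1 / r\<^sup>2 - lam) * \<xi> r + (theta lam \<eta> r)\<^sup>2 = 1"
      using D by (simp add: layer_mult_def theta_sq s_def[symmetric] power2_eq_square[of s] flip: add_divide_distrib)
    then have "of_real ((1 / r\<^sup>2 - lam) * \<xi> r) * \<phi> r + of_real ((theta lam \<eta> r)\<^sup>2) * \<phi> r = \<phi> r"
      by (simp only: distrib_right[symmetric] of_real_add[symmetric]) simp
    then show "w r * cnj (\<phi> r) = w r * cnj (of_real ((1 / r\<^sup>2 - lam) * \<xi> r) * \<phi> r + of_real ((theta lam \<eta> r)\<^sup>2) * \<phi> r)"
      by simp
  qed
  also have "\<dots> = inner_L2 R w (\<lambda>r. of_real ((1 / r\<^sup>2 - lam) * \<xi> r) * \<phi> r) + J"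
    unfolding J_def
    by (intro inner_L2_add_right L2_continuous continuous_intros cont_w cphi c\<xi> continuous_on_theta \<eta>) auto
  also have "inner_L2 R w (\<lambda>r. of_real ((1 / r\<^sup>2 - lam) * \<xi> r) * \<phi> r) = I"
    unfolding I_def inner_L2_def G_def by (intro Bochner_Integration.integral_cong) (auto simp: mult_ac)
  finally have "cmod (inner_L2 R w \<phi>) \<le> cmod I + cmod J" by (simp add: norm_triangle_ineq)
  also have "\<dots> \<le> (n * H + m * (R\<^sup>2 / \<eta> * Q)) + \<eta>^3 * (a * H + \<kappa>\<^sup>2 * (b * (R\<^sup>2 / \<eta> * Q))) + (d * R\<^sup>2 / \<eta>) * (b * Q) + R\<^sup>2 * (b * Q)"
    using BI BJ by (simp add: Q)
  also have "\<eta>^3 * (a * H + \<kappa>\<^sup>2 * (b * (R\<^sup>2 / \<eta> * Q))) = R\<^sup>2 * (\<eta>^3 * a * (5 * Q / \<eta>\<^sup>2 + p / \<eta>) + \<eta>\<^sup>2 * \<kappa>\<^sup>2 * b * Q)"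
    using \<eta> by (simp add: H_def power3_eq_cube power2_eq_square distrib_left mult_ac)
  finally show ?thesis by (simp add: H_def algebra_simps)
qed

end

section \<open>Numerical consequences of the estimates\<close>

lemma le_of_quadratic:
  fixes x y :: real
  assumes "x * x \<le> y * x" "0 \<le> x" "0 \<le> y" shows "x \<le> y"
  using assms by (cases "x = 0") (auto simp: mult_le_cancel_right)

text \<open>Keeps the potential coercive down to |k| = 1, with a coefficient comparable to
  \<kappa>^2.\<close>

lemma three_quarters_sq_le: "3/4 * \<kappa>\<^sup>2 \<le> \<kappa>\<^sup>2 - 1/4" if "\<kappa> \<ge> 1" for \<kappa> :: real
  using power_mono[OF that, of 2] by simp

section \<open>Linear bounds for \<open>a\<close> and \<open>b\<close> in the two regimes\<close>

context
  fixes \<eta> \<kappa> a b c' :: real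
  assumes pos: "\<eta> > 0" "\<kappa> \<ge> 1" "a \<ge> 0" "b \<ge> 0" and c': "0 \<le> c'" "c' \<le> 1/4000"
begin

text \<open>Here 1 \<le> 256 (\<eta> \<kappa>)^2, so the shift c' \<eta> b^2 is at most a quarter of
  \<eta>^3 \<kappa>^2 b^2. Diffusion supplies three quarters of it, and one half remains.\<close>

lemma elliptic_energy:
  assumes t: "1/16 \<le> \<eta> * \<kappa>" and E: "\<eta>^3 * (a\<^sup>2 + (\<kappa>\<^sup>2 - 1/4) * b\<^sup>2) \<le> S + c' * \<eta> * b\<^sup>2"
  shows "\<eta>^3 * a\<^sup>2 + \<eta>^3 * \<kappa>\<^sup>2 * b\<^sup>2 / 2 \<le> S"
proof -
  have "(1/16)\<^sup>2 \<le> (\<eta> * \<kappa>)\<^sup>2" using t by (intro power_mono) auto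
  then have "1 \<le> 256 * (\<eta> * \<kappa>)\<^sup>2" by (simp add: power2_eq_square)
  then have "c' * 1 \<le> 1/4000 * (256 * (\<eta> * \<kappa>)\<^sup>2)" using c' by (intro mult_mono) auto
  also have "\<dots> \<le> (\<eta> * \<kappa>)\<^sup>2 / 4" by simp
  finally have "c' * (\<eta> * b\<^sup>2) \<le> (\<eta> * \<kappa>)\<^sup>2 / 4 * (\<eta> * b\<^sup>2)"
    using pos by (intro mult_right_mono) auto
  then have 1: "c' * \<eta> * b\<^sup>2 \<le> \<eta>^3 * \<kappa>\<^sup>2 * b\<^sup>2 / 4"
    by (simp add: power2_eq_square power3_eq_cube mult_ac)
  have "\<eta>^3 * (3/4 * \<kappa>\<^sup>2 * b\<^sup>2) \<le> \<eta>^3 * ((\<kappa>\<^sup>2 - 1/4) * b\<^sup>2)"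
    using pos three_quarters_sq_le[OF pos(2)] by (intro mult_left_mono mult_right_mono) auto
  with 1 E show ?thesis by (simp add: distrib_left)
qed

text \<open>Energy alone bounds \<eta>^3 \<kappa>^2 b linearly after one factor b is cancelled. As
  \<eta>^2 \<kappa>^2 \<ge> 1/256, this also bounds \<eta> b, and then \<eta>^4 a^2 \<le> m (\<eta>
  b).\<close>

lemma elliptic_strong:
  assumes m: "m \<ge> 0" and t: "1/16 \<le> \<eta> * \<kappa>" and E: "\<eta>^3 * (a\<^sup>2 + (\<kappa>\<^sup>2 - 1/4) * b\<^sup>2) \<le> m * b + c' * \<eta> * b\<^sup>2"
  shows "\<eta> * b \<le> 512 * m" "\<eta>\<^sup>2 * a \<le> 512 * m" "\<eta>^3 * \<kappa>\<^sup>2 * b \<le> 2 * m"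
proof -
  have e: "\<eta>^3 * a\<^sup>2 + \<eta>^3 * \<kappa>\<^sup>2 * b\<^sup>2 / 2 \<le> m * b" by (rule elliptic_energy[OF t E])
  have nn: "0 \<le> \<eta>^3 * a\<^sup>2" "0 \<le> \<eta>^3 * \<kappa>\<^sup>2 * b\<^sup>2" "0 \<le> \<eta>^3 * \<kappa>\<^sup>2" using pos by auto
  have "(\<eta>^3 * \<kappa>\<^sup>2 * b) * (\<eta>^3 * \<kappa>\<^sup>2 * b) = (\<eta>^3 * \<kappa>\<^sup>2) * (\<eta>^3 * \<kappa>\<^sup>2 * b\<^sup>2)"
    by (simp add: power2_eq_square)
  also have "\<dots> \<le> (\<eta>^3 * \<kappa>\<^sup>2) * (2 * m * b)" using e nn by (intro mult_left_mono) auto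
  also have "\<dots> = (2 * m) * (\<eta>^3 * \<kappa>\<^sup>2 * b)" by simp
  finally show 1: "\<eta>^3 * \<kappa>\<^sup>2 * b \<le> 2 * m"
    by (rule le_of_quadratic) (use pos m in auto)
  have "(1/16)\<^sup>2 \<le> (\<eta> * \<kappa>)\<^sup>2" using t by (intro power_mono) auto
  then have "1/256 * (\<eta> * b) \<le> (\<eta> * \<kappa>)\<^sup>2 * (\<eta> * b)"
    using pos by (intro mult_right_mono) (auto simp: power2_eq_square)
  also have "\<dots> = \<eta>^3 * \<kappa>\<^sup>2 * b" by (simp add: power2_eq_square power3_eq_cube mult_ac)
  finally show 2: "\<eta> * b \<le> 512 * m" using 1 by simp
  have "(\<eta>\<^sup>2 * a)\<^sup>2 = \<eta> * (\<eta>^3 * a\<^sup>2)" by (simp add: power2_eq_square power3_eq_cube mult_ac)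
  also have "\<eta>^3 * a\<^sup>2 \<le> m * b" using e nn by linarith
  then have "\<eta> * (\<eta>^3 * a\<^sup>2) \<le> \<eta> * (m * b)" using pos by (intro mult_left_mono) auto
  also have "\<dots> = m * (\<eta> * b)" by simp
  also have "\<dots> \<le> m * (512 * m)" using 2 m by (intro mult_left_mono) auto
  also have "\<dots> \<le> (512 * m)\<^sup>2" by (simp add: power2_eq_square)
  finally show "\<eta>\<^sup>2 * a \<le> 512 * m" by (rule power2_le_imp_le) (use m in auto)
qed

text \<open>In the variables Y, Z the energy is a quadratic form bounded by a linear one; completing
  squares confines (Y, Z) to an ellipse of size n.\<close>

lemma elliptic_weak:
  assumes n: "n \<ge> 0" and t: "1/16 \<le> \<eta> * \<kappa>" and E: "\<eta>^3 * (a\<^sup>2 + (\<kappa>\<^sup>2 - 1/4) * b\<^sup>2) \<le> n * a + n * b + c' * \<eta> * b\<^sup>2"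
  shows "\<eta>^3 * a \<le> 3 * n" "\<eta>^3 * \<kappa> * b \<le> 3 * n" "\<eta>\<^sup>2 * b \<le> 48 * n"
proof -
  define Y Z where "Y = \<eta>^3 * a" and "Z = \<eta>^3 * \<kappa> * b"
  have e: "\<eta>^3 * a\<^sup>2 + \<eta>^3 * \<kappa>\<^sup>2 * b\<^sup>2 / 2 \<le> n * a + n * b" by (rule elliptic_energy[OF t]) (use E in simp)
  also have "\<dots> \<le> n * (a + \<kappa> * b)"
    using n pos mult_right_mono[of 1 \<kappa> b] by (simp add: distrib_left mult_left_mono)
  finally have "\<eta>^3 * (\<eta>^3 * a\<^sup>2 + \<eta>^3 * \<kappa>\<^sup>2 * b\<^sup>2 / 2) \<le> \<eta>^3 * (n * (a + \<kappa> * b))"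
    using pos by (intro mult_left_mono) auto
  moreover have "\<eta>^3 * (\<eta>^3 * a\<^sup>2 + \<eta>^3 * \<kappa>\<^sup>2 * b\<^sup>2 / 2) = Y\<^sup>2 + Z\<^sup>2 / 2"
    "\<eta>^3 * (n * (a + \<kappa> * b)) = n * Y + n * Z"
    by (auto simp: Y_def Z_def power2_eq_square algebra_simps)
  ultimately have q: "Y\<^sup>2 + Z\<^sup>2 / 2 \<le> n * Y + n * Z" by simp
  \<comment> \<open>The right side is the sum n^2/4 + n^2/2 of the completed squares.\<close>
  have sq: "(Y - n/2)\<^sup>2 + (Z - n)\<^sup>2 / 2 \<le> 3/4 * n\<^sup>2"
  proof -
    have "(Y - n/2)\<^sup>2 = Y\<^sup>2 - n * Y + n\<^sup>2 / 4" "(Z - n)\<^sup>2 = Z\<^sup>2 - 2 * (n * Z) + n\<^sup>2"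
      by (simp_all add: power2_eq_square algebra_simps)
    then show ?thesis using q by linarith
  qed
  have "(Y - n/2)\<^sup>2 \<le> 3/4 * n\<^sup>2" "(Z - n)\<^sup>2 / 2 \<le> 3/4 * n\<^sup>2"
    using sq zero_le_power2[of "Y - n/2"] zero_le_power2[of "Z - n"] by linarith+
  moreover have "(2 * n)\<^sup>2 = 4 * n\<^sup>2" by (simp add: power_mult_distrib)
  ultimately have "(Y - n/2)\<^sup>2 \<le> (2 * n)\<^sup>2" "(Z - n)\<^sup>2 \<le> (2 * n)\<^sup>2"
    using zero_le_power2[of n] by linarith+
  then have "Y - n/2 \<le> 2 * n" "Z - n \<le> 2 * n"
    using n power2_le_imp_le[of "Y - n/2" "2 * n"] power2_le_imp_le[of "Z - n" "2 * n"] by auto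
  then show 1: "\<eta>^3 * a \<le> 3 * n" "\<eta>^3 * \<kappa> * b \<le> 3 * n" using n by (auto simp: Y_def Z_def)
  have "1/16 * (\<eta>\<^sup>2 * b) \<le> \<eta> * \<kappa> * (\<eta>\<^sup>2 * b)" using t pos by (intro mult_right_mono) auto
  also have "\<dots> = \<eta>^3 * \<kappa> * b" by (simp add: power2_eq_square power3_eq_cube mult_ac)
  finally show "\<eta>\<^sup>2 * b \<le> 48 * n" using 1 by simp
qed

lemma eta_le_sixteenth: assumes t: "\<eta> * \<kappa> \<le> 1/16" shows "\<eta> \<le> 1/16"
proof -
  have "\<eta> * 1 \<le> \<eta> * \<kappa>" using pos by (intro mult_left_mono) auto
  then show ?thesis using t by linarith
qed

text \<open>The threshold 1/16 makes 8 \<eta> b^2 at most b^2/2, which the left side of the layer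
  estimate absorbs. What is left has coefficient 3 + 8 = 11.\<close>

lemma layer_terms_le:
  assumes t: "\<eta> * \<kappa> \<le> 1/16"
  shows "(2 * \<eta> + 2 * \<eta>\<^sup>2) * a * b + 8 * \<eta> * (a + b) * b \<le> 11 * \<eta> * a * b + b\<^sup>2 / 2"
proof -
  have "2 * \<eta>\<^sup>2 \<le> \<eta>" using eta_le_sixteenth[OF t] pos by (simp add: power2_eq_square)
  then have "(2 * \<eta> + 2 * \<eta>\<^sup>2) * (a * b) \<le> 3 * \<eta> * (a * b)" using pos by (intro mult_right_mono) auto
  moreover have "8 * \<eta> * (b * b) \<le> 1/2 * (b * b)" using eta_le_sixteenth[OF t] by (intro mult_right_mono) auto
  ultimately show ?thesis by (simp add: power2_eq_square algebra_simps)
qed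

text \<open>In the scale-free variables X = \<eta> b and Y = \<eta>^2 a the layer estimate reads X
  \<le> 2 m + 22 Y and the energy Y^2 \<le> m X + c' X^2. Substituting the first into the second
  closes because 484 c' < 1.\<close>

lemma viscous_strong:
  assumes m: "m \<ge> 0" and t: "\<eta> * \<kappa> \<le> 1/16"
    and E: "\<eta>^3 * (a\<^sup>2 + (\<kappa>\<^sup>2 - 1/4) * b\<^sup>2) \<le> m * b + c' * \<eta> * b\<^sup>2"
    and L: "b\<^sup>2 \<le> m * b / \<eta> + (2 * \<eta> + 2 * \<eta>\<^sup>2) * a * b + 8 * \<eta> * (a + b) * b"
  shows "\<eta> * b \<le> 800 * m" "\<eta>\<^sup>2 * a \<le> 32 * m"
proof -
  define X Y where "X = \<eta> * b" and "Y = \<eta>\<^sup>2 * a"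
  have XY: "X \<ge> 0" "Y \<ge> 0" using pos by (auto simp: X_def Y_def)
  have "b\<^sup>2 \<le> 2 * (m * b / \<eta>) + 22 * \<eta> * a * b" using L layer_terms_le[OF t] by linarith
  then have "\<eta>\<^sup>2 * b\<^sup>2 \<le> \<eta>\<^sup>2 * (2 * (m * b / \<eta>) + 22 * \<eta> * a * b)" using pos by (intro mult_left_mono) auto
  also have "\<dots> = (2 * m + 22 * Y) * X" using pos by (simp add: X_def Y_def power2_eq_square algebra_simps)
  finally have "X * X \<le> (2 * m + 22 * Y) * X" by (simp add: X_def power2_eq_square mult_ac)
  then have X: "X \<le> 2 * m + 22 * Y" by (rule le_of_quadratic) (use XY m in auto)
  have "\<eta>^3 * a\<^sup>2 \<le> \<eta>^3 * (a\<^sup>2 + (\<kappa>\<^sup>2 - 1/4) * b\<^sup>2)"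
  proof -
    have "0 \<le> \<kappa>\<^sup>2 - 1/4" using three_quarters_sq_le[OF pos(2)] zero_le_power2[of \<kappa>] by linarith
    then show ?thesis using pos by (intro mult_left_mono) auto
  qed
  from order_trans[OF this E]
  have "\<eta> * (\<eta>^3 * a\<^sup>2) \<le> \<eta> * (m * b + c' * \<eta> * b\<^sup>2)" using pos by (intro mult_left_mono) auto
  then have "Y\<^sup>2 \<le> m * X + c' * X\<^sup>2"
    by (simp add: X_def Y_def power2_eq_square power3_eq_cube algebra_simps)
  also have "\<dots> \<le> m * X + 1/4000 * X\<^sup>2"
    using mult_right_mono[OF c'(2) zero_le_power2[of X]] by simp
  also have "\<dots> \<le> m * (2 * m + 22 * Y) + 1/4000 * (2 * m + 22 * Y)\<^sup>2"
    using X XY m by (intro add_mono mult_left_mono power_mono) auto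
  finally have q: "Y\<^sup>2 \<le> m * (2 * m + 22 * Y) + 1/4000 * (2 * m + 22 * Y)\<^sup>2" .
  show Yb: "\<eta>\<^sup>2 * a \<le> 32 * m"
  proof (rule ccontr)
    assume "\<not> ?thesis"
    then have Yg: "Y > 32 * m" by (simp add: Y_def)
    then have 1: "m * m \<le> Y / 32 * (Y / 32)" "m * Y \<le> Y / 32 * Y"
      using m XY Yg by (intro mult_mono; simp)+
    have "Y > 0" using Yg m by simp
    \<comment> \<open>For Y > 32 m the three inequalities give 4000 D \<le> 3245 D with D > 0.
      Naming the products makes this a linear contradiction.\<close>
    define D A B where "D = Y * Y" and "A = m * m" and "B = m * Y"
    have "D > 0" using \<open>Y > 0\<close> by (simp add: D_def)
    moreover have "4000 * D \<le> 8004 * A + 88088 * B + 484 * D"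
      using q by (simp add: D_def A_def B_def power2_eq_square algebra_simps)
    moreover have "1024 * A \<le> D" "32 * B \<le> D" using 1 by (simp_all add: D_def A_def B_def)
    ultimately show False by linarith
  qed
  show "\<eta> * b \<le> 800 * m" using X Yb m by (simp add: X_def Y_def)
qed

text \<open>The same loop with one more power of \<eta>. Roughly, the layer gives X^2 \<le> 74 n^2 +
  970 Y^2, and the energy returns only a small multiple of X^2, so the Y^2 on its right side can be
  absorbed.\<close>

lemma viscous_weak:
  assumes n: "n \<ge> 0" and t: "\<eta> * \<kappa> \<le> 1/16"
    and E: "\<eta>^3 * (a\<^sup>2 + (\<kappa>\<^sup>2 - 1/4) * b\<^sup>2) \<le> n * a + n * b + c' * \<eta> * b\<^sup>2"
    and L: "b\<^sup>2 \<le> (n * (a + (2 / \<eta> + 2) * b) + n * b) / \<eta> + (2 * \<eta> + 2 * \<eta>\<^sup>2) * a * b + 8 * \<eta> * (a + b) * b"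
  shows "\<eta>^3 * a \<le> 70 * n" "\<eta>^3 * \<kappa> * b \<le> 100 * n" "\<eta>\<^sup>2 * b \<le> 2100 * n"
proof -
  define X Y Z where "X = \<eta>\<^sup>2 * b" and "Y = \<eta>^3 * a" and "Z = \<eta>^3 * \<kappa> * b"
  have XYZ: "X \<ge> 0" "Y \<ge> 0" "Z \<ge> 0" using pos by (auto simp: X_def Y_def Z_def)
  note es = eta_le_sixteenth[OF t]
  have "b\<^sup>2 / 2 \<le> (n * (a + (2 / \<eta> + 2) * b) + n * b) / \<eta> + 11 * \<eta> * a * b" using L layer_terms_le[OF t] by linarith
  then have "\<eta>^4 * (b\<^sup>2 / 2) \<le> \<eta>^4 * ((n * (a + (2 / \<eta> + 2) * b) + n * b) / \<eta> + 11 * \<eta> * a * b)"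
    using pos by (intro mult_left_mono) auto
  also have "\<dots> = n * Y + (2 + 3 * \<eta>) * (n * X) + 11 * (X * Y)"
    using pos by (simp add: X_def Y_def field_simps eval_nat_numeral)
  also have "\<dots> \<le> n * Y + 3 * (n * X) + 11 * (X * Y)"
    using es n XYZ by (intro add_mono mult_right_mono) auto
  finally have X: "X * X \<le> 2 * (n * Y) + 6 * (n * X) + 22 * (X * Y)"
    by (simp add: X_def eval_nat_numeral mult_ac)
  have "\<eta>^3 * (a\<^sup>2 + 3/4 * \<kappa>\<^sup>2 * b\<^sup>2) \<le> \<eta>^3 * (a\<^sup>2 + (\<kappa>\<^sup>2 - 1/4) * b\<^sup>2)"
    using pos three_quarters_sq_le[OF pos(2)] by (intro mult_left_mono add_mono mult_right_mono) auto
  from order_trans[OF this E]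
  have "\<eta>^3 * (\<eta>^3 * (a\<^sup>2 + 3/4 * \<kappa>\<^sup>2 * b\<^sup>2)) \<le> \<eta>^3 * (n * a + n * b + c' * \<eta> * b\<^sup>2)"
    using pos by (intro mult_left_mono) auto
  then have "Y * Y + 3/4 * (Z * Z) \<le> n * Y + \<eta> * (n * X) + c' * (X * X)"
    by (simp add: X_def Y_def Z_def eval_nat_numeral algebra_simps)
  also have "\<dots> \<le> n * Y + 1 * (n * X) + 1/4000 * (X * X)"
    using es n XYZ c' by (intro add_mono mult_right_mono) auto
  finally have q: "Y * Y + 3/4 * (Z * Z) \<le> n * Y + n * X + 1/4000 * (X * X)" by simp
  have s1: "2 * (n * Y) \<le> n * n + Y * Y" using sum_squares_bound[of n Y] by (simp add: power2_eq_square)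
  have s2: "6 * (n * X) \<le> X * X / 4 + 36 * (n * n)"
    using sum_squares_bound[of "6 * n" "X / 2"] by (simp add: power2_eq_square mult.commute add.commute)
  have s3: "22 * (X * Y) \<le> X * X / 4 + 484 * (Y * Y)"
    using sum_squares_bound[of "22 * Y" "X / 2"] by (simp add: power2_eq_square mult_ac)
  \<comment> \<open>The weight 1/4000 matches c': the two X^2 terms together cost 970/2000 of Y^2,
    and with the 1/4 from \<open>s5\<close> this stays below 1.\<close>
  have s4: "n * X \<le> X * X / 4000 + 1000 * (n * n)"
    using sum_squares_bound[of "2000 * n" "X"] by (simp add: power2_eq_square mult_ac)
  have s5: "n * Y \<le> n * n + Y * Y / 4" using sum_squares_bound[of n "Y / 2"] by (simp add: power2_eq_square)
  have ZZ: "0 \<le> Z * Z" by simp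
  have Y2: "Y * Y \<le> 4000 * (n * n)" using q X s1 s2 s3 s4 s5 ZZ zero_le_square[of n] by argo
  have nn: "0 \<le> n * n" by simp
  have "Y * Y \<le> 4900 * (n * n)" using Y2 nn by linarith
  then have "Y\<^sup>2 \<le> (70 * n)\<^sup>2" by (simp add: power2_eq_square)
  then show Yb: "\<eta>^3 * a \<le> 70 * n" unfolding Y_def[symmetric] by (rule power2_le_imp_le) (use n in auto)
  have X2: "X * X \<le> 4000000 * (n * n)" using X s1 s2 s3 Y2 zero_le_square[of n] by argo
  then have "X * X \<le> 4410000 * (n * n)" using nn by linarith
  then have "X\<^sup>2 \<le> (2100 * n)\<^sup>2" by (simp add: power2_eq_square)
  then show "\<eta>\<^sup>2 * b \<le> 2100 * n" unfolding X_def[symmetric] by (rule power2_le_imp_le) (use n in auto)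
  have "Z * Z \<le> 10000 * (n * n)" using q s4 s5 X2 Y2 zero_le_square[of n] zero_le_square[of Y] by argo
  then have "Z\<^sup>2 \<le> (100 * n)\<^sup>2" by (simp add: power2_eq_square)
  then show "\<eta>^3 * \<kappa> * b \<le> 100 * n" unfolding Z_def[symmetric] by (rule power2_le_imp_le) (use n in auto)
qed

section \<open>Bounds for the stream function in the two regimes\<close>

context
  fixes p q Q E R2 :: real
  assumes pq: "p \<ge> 0" "q \<ge> 0" "Q \<ge> 0" "R2 \<ge> 0" and E_def: "E = p + \<kappa> * q"
begin

lemma E_facts: "0 \<le> E" "p \<le> E" "\<kappa> * q \<le> E" "p + q \<le> E"
  using pos pq mult_right_mono[OF pos(2) pq(2)] by (auto simp: E_def)

text \<open>Since \<kappa> q \<le> E, multiplying by \<kappa> turns the factor q into E, and one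
  factor \<kappa> E cancels.\<close>

lemma elliptic_stream:
  assumes e: "E\<^sup>2 \<le> 3 * R2 * b * q"
  shows "\<kappa> * E \<le> 3 * R2 * b"
proof -
  have "\<kappa> * E\<^sup>2 \<le> \<kappa> * (3 * R2 * b * q)" using e pos by (intro mult_left_mono) auto
  also have "\<dots> = 3 * R2 * b * (\<kappa> * q)" by simp
  also have "\<dots> \<le> 3 * R2 * b * E" using E_facts pos pq by (intro mult_left_mono) auto
  finally have "(\<kappa> * E) * (\<kappa> * E) \<le> (3 * R2 * b) * (\<kappa> * E)"
    using pos mult_left_mono[of "\<kappa> * E\<^sup>2" "3 * R2 * b * E" \<kappa>] by (simp add: power2_eq_square mult_ac)
  then show ?thesis by (rule le_of_quadratic) (use E_facts pos pq in auto)
qed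

text \<open>With h^2 = \<eta> \<kappa> the previous bounds combine to h^6 E \<le> 6 R2 m, five
  powers of h more than wanted.\<close>

lemma stream_elliptic_strong:
  assumes m: "m \<ge> 0" and t: "1/16 \<le> \<eta> * \<kappa>" and e: "E\<^sup>2 \<le> 3 * R2 * b * q" and b: "\<eta>^3 * \<kappa>\<^sup>2 * b \<le> 2 * m"
  shows "sqrt (\<eta> * \<kappa>) * E \<le> 6144 * R2 * m"
proof -
  define h where "h = sqrt (\<eta> * \<kappa>)"
  have h2: "h\<^sup>2 = \<eta> * \<kappa>" using pos by (simp add: h_def)
  have h: "h \<ge> 1/4" unfolding h_def using t by (intro real_le_rsqrt) (simp add: power2_eq_square)
  have h6: "h^6 = \<eta>^3 * \<kappa>\<^sup>2 * \<kappa>"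
    using h2 by (simp add: power_mult[of h 2 3, simplified] eval_nat_numeral mult_ac)
  have "h^6 * (\<kappa> * E) \<le> h^6 * (3 * R2 * b)"
    using elliptic_stream[OF e] by (intro mult_left_mono) auto
  also have "\<dots> = 3 * R2 * \<kappa> * (\<eta>^3 * \<kappa>\<^sup>2 * b)" by (simp add: h6)
  also have "\<dots> \<le> 3 * R2 * \<kappa> * (2 * m)" using b pq pos by (intro mult_left_mono) auto
  finally have "\<kappa> * (h^6 * E) \<le> \<kappa> * (6 * R2 * m)" by (simp add: mult_ac)
  then have 1: "h^6 * E \<le> 6 * R2 * m" using pos by simp
  \<comment> \<open>As h \<ge> 1/4, the five spare powers cost 4^5, and 6 * 4^5 = 6144.\<close>
  have "(1/4)^5 * (h * E) \<le> h^5 * (h * E)"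
    using h E_facts by (intro mult_right_mono power_mono) auto
  also have "\<dots> = h^6 * E" by (simp add: eval_nat_numeral)
  finally show ?thesis using 1 by (simp add: h_def eval_nat_numeral)
qed

text \<open>With g^2 = \<eta>, the available quantity \<eta>^3 \<kappa> (\<kappa> E) is g^3 E times
  g^3 \<kappa>^2. The extra factor is (g^2 \<kappa>) (g \<kappa>), at least 1/64 in this regime;
  here \<kappa> \<ge> 1 gives g \<kappa> \<ge> 1/4. The constant is 64 * 9 = 576.\<close>

lemma stream_elliptic_weak:
  assumes n: "n \<ge> 0" and t: "1/16 \<le> \<eta> * \<kappa>" and e: "E\<^sup>2 \<le> 3 * R2 * b * q" and b: "\<eta>^3 * \<kappa> * b \<le> 3 * n"
  shows "(sqrt \<eta>)^3 * E \<le> 576 * R2 * n"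
proof -
  define g where "g = sqrt \<eta>"
  have g2: "g\<^sup>2 = \<eta>" and g0: "g > 0" using pos by (auto simp: g_def)
  have gk: "1/16 \<le> g\<^sup>2 * \<kappa>" using t g2 by simp
  have "(1/4)\<^sup>2 \<le> (g * \<kappa>)\<^sup>2"
  proof -
    have "g\<^sup>2 * \<kappa> * 1 \<le> g\<^sup>2 * \<kappa> * \<kappa>" using pos g2 by (intro mult_left_mono) auto
    then show ?thesis using gk by (simp add: power2_eq_square mult_ac)
  qed
  then have gk': "1/4 \<le> g * \<kappa>" by (rule power2_le_imp_le) (use g0 pos in auto)
  have "1/16 * (1/4) \<le> (g\<^sup>2 * \<kappa>) * (g * \<kappa>)" using gk gk' pos by (intro mult_mono) auto
  then have "1/64 * (g^3 * E) \<le> (g^3 * \<kappa>\<^sup>2) * (g^3 * E)"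
    using g0 E_facts by (intro mult_right_mono) (auto simp: eval_nat_numeral mult_ac)
  also have "\<dots> = \<eta>^3 * \<kappa> * (\<kappa> * E)" by (simp add: g2[symmetric] eval_nat_numeral mult_ac)
  also have "\<dots> \<le> \<eta>^3 * \<kappa> * (3 * R2 * b)" using elliptic_stream[OF e] pos by (intro mult_left_mono) auto
  also have "\<dots> = 3 * R2 * (\<eta>^3 * \<kappa> * b)" by simp
  also have "\<dots> \<le> 3 * R2 * (3 * n)" using b pq by (intro mult_left_mono) auto
  finally show ?thesis by (simp add: g_def)
qed

text \<open>The layer bound is linear in q, and q \<le> E/\<kappa> gains a factor 1/\<kappa>:
  \<kappa> Q^2 \<le> 8 \<eta> E^2. The first conclusion keeps this gain, the second discards it
  through \<kappa> \<ge> 1; 3 replaces sqrt 8.\<close>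

lemma Q_bound:
  assumes "Q\<^sup>2 \<le> 8 * \<eta> * (p + q) * q"
  shows "sqrt (\<eta> * \<kappa>) * Q \<le> 3 * \<eta> * E" "Q \<le> 3 * sqrt \<eta> * E"
proof -
  have "\<kappa> * Q\<^sup>2 \<le> \<kappa> * (8 * \<eta> * (p + q) * q)" using assms pos by (intro mult_left_mono) auto
  also have "\<dots> = 8 * \<eta> * (p + q) * (\<kappa> * q)" by simp
  also have "\<dots> \<le> 8 * \<eta> * E * E" using E_facts pos pq by (intro mult_mono mult_left_mono) auto
  finally have 1: "\<kappa> * Q\<^sup>2 \<le> 8 * \<eta> * E\<^sup>2" by (simp add: power2_eq_square mult_ac)
  have "(sqrt (\<eta> * \<kappa>) * Q)\<^sup>2 = \<eta> * (\<kappa> * Q\<^sup>2)" using pos by (simp add: power_mult_distrib)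
  also have "\<dots> \<le> \<eta> * (8 * \<eta> * E\<^sup>2)" using 1 pos by (intro mult_left_mono) auto
  also have "\<dots> = 8 * (\<eta> * E)\<^sup>2" by (simp add: power2_eq_square)
  also have "\<dots> \<le> 9 * (\<eta> * E)\<^sup>2" by simp
  also have "\<dots> = (3 * \<eta> * E)\<^sup>2" by (simp add: power_mult_distrib)
  finally show "sqrt (\<eta> * \<kappa>) * Q \<le> 3 * \<eta> * E" by (rule power2_le_imp_le) (use pos E_facts in auto)
  have "1 * Q\<^sup>2 \<le> \<kappa> * Q\<^sup>2" using pos by (intro mult_right_mono) auto
  moreover have "0 \<le> \<eta> * E\<^sup>2" using pos by simp
  ultimately have "Q\<^sup>2 \<le> 9 * (\<eta> * E\<^sup>2)" using 1 by linarith
  also have "\<dots> = (3 * sqrt \<eta> * E)\<^sup>2" using pos by (simp add: power_mult_distrib)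
  finally show "Q \<le> 3 * sqrt \<eta> * E" by (rule power2_le_imp_le) (use pos E_facts in auto)
qed

text \<open>For \<eta> \<kappa> \<le> 1/16 the zeroth-order diffusion term and the shift are each no
  larger than the layer term b Q.\<close>

lemma stream_terms:
  assumes t: "\<eta> * \<kappa> \<le> 1/16"
  shows "\<eta>\<^sup>2 * \<kappa>\<^sup>2 * b * Q + c' * \<eta> * b * Q / \<eta> + b * Q \<le> 3 * b * Q"
proof -
  have "(\<eta> * \<kappa>)\<^sup>2 \<le> 1\<^sup>2" using t pos by (intro power_mono) auto
  then have "(\<eta> * \<kappa>)\<^sup>2 * (b * Q) \<le> 1 * (b * Q)" using pos pq by (intro mult_right_mono) auto
  moreover have "c' * (b * Q) \<le> 1 * (b * Q)" using pos pq c' by (intro mult_right_mono) auto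
  moreover have "\<eta>\<^sup>2 * \<kappa>\<^sup>2 * b * Q = (\<eta> * \<kappa>)\<^sup>2 * (b * Q)" "c' * \<eta> * b * Q / \<eta> = c' * (b * Q)"
    using pos by (simp_all add: power_mult_distrib)
  ultimately show ?thesis by linarith
qed

text \<open>Multiplication by h = sqrt(\<eta> \<kappa>) turns Q/\<eta> into at most 3 E by
  \<open>Q_bound\<close>, so the right side is linear in E and E cancels. The coefficients are 2561
  = 1 + 160 + 2400 and 23145 = 3 (3 * 2561 + 32).\<close>

lemma stream_viscous_strong:
  assumes m: "m \<ge> 0" and t: "\<eta> * \<kappa> \<le> 1/16"
    and e: "E\<^sup>2 \<le> 3 * (R2 * (m * Q / \<eta> + \<eta>^3 * a * (5 * Q / \<eta>\<^sup>2 + p / \<eta>) + \<eta>\<^sup>2 * \<kappa>\<^sup>2 * b * Q + c' * \<eta> * b * Q / \<eta> + b * Q))"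
    and Q: "Q\<^sup>2 \<le> 8 * \<eta> * (p + q) * q"
    and b: "\<eta> * b \<le> 800 * m" and a: "\<eta>\<^sup>2 * a \<le> 32 * m"
  shows "sqrt (\<eta> * \<kappa>) * E \<le> 24000 * R2 * m"
proof -
  define h where "h = sqrt (\<eta> * \<kappa>)"
  have h: "h \<ge> 0" "h \<le> 1" using pos t by (auto simp: h_def)
  have Qe: "0 \<le> Q / \<eta>" using pos pq by simp
  have "\<eta>^3 * a * (5 * Q / \<eta>\<^sup>2 + p / \<eta>) = (\<eta>\<^sup>2 * a) * (5 * (Q / \<eta>) + p)"
    using pos by (simp add: field_simps eval_nat_numeral)
  also have "\<dots> \<le> (32 * m) * (5 * (Q / \<eta>) + E)"
    by (rule mult_mono) (use a Qe E_facts pq m pos in auto)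
  finally have 1: "\<eta>^3 * a * (5 * Q / \<eta>\<^sup>2 + p / \<eta>) \<le> 160 * m * (Q / \<eta>) + 32 * m * E" by (simp add: algebra_simps)
  have "b * Q = (\<eta> * b) * (Q / \<eta>)" using pos by simp
  also have "\<dots> \<le> 800 * m * (Q / \<eta>)" using b Qe by (intro mult_right_mono)
  finally have 2: "3 * b * Q \<le> 2400 * m * (Q / \<eta>)" by simp
  have sum: "m * Q / \<eta> + \<eta>^3 * a * (5 * Q / \<eta>\<^sup>2 + p / \<eta>) + \<eta>\<^sup>2 * \<kappa>\<^sup>2 * b * Q + c' * \<eta> * b * Q / \<eta> + b * Q
      \<le> 2561 * m * (Q / \<eta>) + 32 * m * E"
  proof -
    have "m * Q / \<eta> = m * (Q / \<eta>)" by simp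
    then show ?thesis using stream_terms[OF t] 1 2 by linarith
  qed
  have "E\<^sup>2 \<le> 3 * (R2 * (2561 * m * (Q / \<eta>) + 32 * m * E))"
    using e mult_left_mono[OF sum pq(4)] by simp
  then have "h * E\<^sup>2 \<le> h * (3 * (R2 * (2561 * m * (Q / \<eta>) + 32 * m * E)))" using h by (intro mult_left_mono)
  also have "\<dots> = 3 * (R2 * m) * (2561 * (h * Q / \<eta>) + 32 * (h * E))" by (simp add: algebra_simps)
  also have "\<dots> \<le> 3 * (R2 * m) * (2561 * (3 * E) + 32 * (1 * E))"
  proof (intro mult_left_mono add_mono mult_right_mono)
    show "h * Q / \<eta> \<le> 3 * E" using Q_bound(1)[OF Q] pos by (simp add: h_def field_simps)
  qed (use h E_facts pq m in auto)
  also have "\<dots> = (23145 * R2 * m) * E" by (simp add: algebra_simps)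
  finally have "(h * E) * (h * E) \<le> (23145 * R2 * m) * (h * E)"
    using h mult_left_mono[of "h * E\<^sup>2" "(23145 * R2 * m) * E" h] by (simp add: power2_eq_square mult_ac)
  then have "h * E \<le> 23145 * R2 * m" by (rule le_of_quadratic) (use h E_facts pq m in auto)
  also have "\<dots> \<le> 24000 * R2 * m" using pq m by (intro mult_right_mono) auto
  finally show ?thesis by (simp add: h_def)
qed

text \<open>Now Q/\<eta>^2 appears; multiplication by g^4 = \<eta>^2 and Q \<le> 3 g E leave g E on
  the right, and g E cancels. The coefficients are 6656 = 5 + 1 + 350 + 6300, 71 = 1 + 70 and 60117
  = 3 (3 * 6656 + 71).\<close>

lemma stream_viscous_weak:
  assumes n: "n \<ge> 0" and t: "\<eta> * \<kappa> \<le> 1/16"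
    and e: "E\<^sup>2 \<le> 3 * (R2 * (n * (5 * Q / \<eta>\<^sup>2 + p / \<eta>) + n * Q / \<eta> + \<eta>^3 * a * (5 * Q / \<eta>\<^sup>2 + p / \<eta>) + \<eta>\<^sup>2 * \<kappa>\<^sup>2 * b * Q + c' * \<eta> * b * Q / \<eta> + b * Q))"
    and Q: "Q\<^sup>2 \<le> 8 * \<eta> * (p + q) * q"
    and b: "\<eta>\<^sup>2 * b \<le> 2100 * n" and a: "\<eta>^3 * a \<le> 70 * n"
  shows "(sqrt \<eta>)^3 * E \<le> 61000 * R2 * n"
proof -
  define g where "g = sqrt \<eta>"
  have g2: "g\<^sup>2 = \<eta>" and g0: "g > 0" using pos by (auto simp: g_def)
  have g1: "g \<le> 1" using eta_le_sixteenth[OF t] by (simp add: g_def)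
  define V where "V = 5 * Q / \<eta>\<^sup>2 + p / \<eta>"
  have V: "V \<ge> 0" using pos pq by (simp add: V_def)
  have Qe: "0 \<le> Q / \<eta>\<^sup>2" using pos pq by simp
  have 1: "\<eta>^3 * a * V \<le> 70 * n * V" using a V by (intro mult_right_mono)
  have "b * Q = (\<eta>\<^sup>2 * b) * (Q / \<eta>\<^sup>2)" using pos by simp
  also have "\<dots> \<le> 2100 * n * (Q / \<eta>\<^sup>2)" using b Qe by (intro mult_right_mono)
  finally have 2: "3 * b * Q \<le> 6300 * n * (Q / \<eta>\<^sup>2)" by simp
  have "Q / \<eta> = \<eta> * (Q / \<eta>\<^sup>2)" using pos by (simp add: power2_eq_square)
  also have "\<dots> \<le> 1 * (Q / \<eta>\<^sup>2)" using eta_le_sixteenth[OF t] Qe by (intro mult_right_mono) auto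
  finally have 3: "n * Q / \<eta> \<le> n * (Q / \<eta>\<^sup>2)" using n mult_left_mono[of "Q / \<eta>" "Q / \<eta>\<^sup>2" n] by simp
  have Vle: "V \<le> 5 * (Q / \<eta>\<^sup>2) + E / \<eta>" using E_facts pos by (simp add: V_def divide_right_mono)
  have sum: "n * V + n * Q / \<eta> + \<eta>^3 * a * V + \<eta>\<^sup>2 * \<kappa>\<^sup>2 * b * Q + c' * \<eta> * b * Q / \<eta> + b * Q
      \<le> n * (6656 * (Q / \<eta>\<^sup>2) + 71 * (E / \<eta>))"
  proof -
    define x y where "x = n * (Q / \<eta>\<^sup>2)" and "y = n * (E / \<eta>)"
    have "n * V \<le> n * (5 * (Q / \<eta>\<^sup>2) + E / \<eta>)" by (rule mult_left_mono[OF Vle n])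
    also have "\<dots> = 5 * x + y" by (simp add: x_def y_def algebra_simps)
    finally have "n * V \<le> 5 * x + y" .
    moreover have "\<eta>^3 * a * V \<le> 70 * (n * V)" "3 * b * Q \<le> 6300 * x" "n * Q / \<eta> \<le> x"
      using 1 2 3 by (simp_all add: x_def mult.assoc)
    ultimately have "n * V + n * Q / \<eta> + \<eta>^3 * a * V + \<eta>\<^sup>2 * \<kappa>\<^sup>2 * b * Q + c' * \<eta> * b * Q / \<eta> + b * Q
        \<le> 6656 * x + 71 * y"
      using stream_terms[OF t] by linarith
    then show ?thesis by (simp add: x_def y_def algebra_simps)
  qed
  have "E\<^sup>2 \<le> 3 * (R2 * (n * (6656 * (Q / \<eta>\<^sup>2) + 71 * (E / \<eta>))))"
    using e[folded V_def] mult_left_mono[OF sum pq(4)] by simp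
  then have "g^4 * E\<^sup>2 \<le> g^4 * (3 * (R2 * (n * (6656 * (Q / \<eta>\<^sup>2) + 71 * (E / \<eta>)))))"
    using g0 by (intro mult_left_mono) auto
  also have "\<dots> = 3 * (R2 * n) * (6656 * Q + 71 * (g * (g * E)))"
    using g0 by (simp add: g2[symmetric] field_simps eval_nat_numeral)
  also have "\<dots> \<le> 3 * (R2 * n) * (6656 * (3 * g * E) + 71 * (1 * (g * E)))"
    using Q_bound(2)[OF Q] g0 g1 E_facts pq n
    by (intro mult_left_mono add_mono mult_right_mono) (auto simp: g_def)
  also have "\<dots> = (60117 * R2 * n) * (g * E)" by (simp add: algebra_simps)
  finally have "g * (g^3 * E\<^sup>2) \<le> g * ((60117 * R2 * n) * E)" by (simp add: eval_nat_numeral mult_ac)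
  then have "g^3 * E\<^sup>2 \<le> (60117 * R2 * n) * E" using g0 by simp
  then have "(g^3 * E) * (g^3 * E) \<le> (60117 * R2 * n) * (g^3 * E)"
    using g0 mult_left_mono[of "g^3 * E\<^sup>2" "(60117 * R2 * n) * E" "g^3"] by (simp add: power2_eq_square mult_ac)
  then have "g^3 * E \<le> 60117 * R2 * n" by (rule le_of_quadratic) (use g0 E_facts pq n in auto)
  also have "\<dots> \<le> 61000 * R2 * n" using pq n by (intro mult_right_mono) auto
  finally show ?thesis by (simp add: g_def)
qed

end

end

section \<open>The resolvent equation\<close>

lemma L2_mult_continuous:
  assumes f: "f \<in> L2 R" and c: "continuous_on {1..R} (p :: real \<Rightarrow> complex)"
  shows "(\<lambda>r. p r * f r) \<in> L2 R"
proof -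
  have "bounded (p ` {1..R})" using c by (intro compact_imp_bounded compact_continuous_image) auto
  then obtain K where K: "\<And>x. x \<in> {1..R} \<Longrightarrow> norm (p x) \<le> K" unfolding bounded_iff by blast
  have [measurable]: "p \<in> borel_measurable (leb R)" "f \<in> borel_measurable (leb R)"
    using continuous_imp_integrable_real[OF c] f by (auto simp: L2_def)
  have "integrable (leb R) (\<lambda>r. (cmod (p r * f r))\<^sup>2)"
  proof (rule Bochner_Integration.integrable_bound)
    show "integrable (leb R) (\<lambda>r. K\<^sup>2 * (cmod (f r))\<^sup>2)" using f by (simp add: L2_def)
    show "AE r in leb R. norm ((cmod (p r * f r))\<^sup>2) \<le> norm (K\<^sup>2 * (cmod (f r))\<^sup>2)"
    proof (rule AE_I2)
      fix r assume "r \<in> space (leb R)"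
      then have "(cmod (p r))\<^sup>2 \<le> K\<^sup>2" using K by (intro power_mono) auto
      then show "norm ((cmod (p r * f r))\<^sup>2) \<le> norm (K\<^sup>2 * (cmod (f r))\<^sup>2)"
        by (simp add: norm_mult power_mult_distrib mult_right_mono)
    qed
  qed simp
  then show ?thesis by (simp add: L2_def)
qed

lemma L2_add:
  assumes "f \<in> L2 R" "g \<in> L2 R"
  shows "(\<lambda>r. f r + g r) \<in> L2 R"
proof -
  have [measurable]: "f \<in> borel_measurable (leb R)" "g \<in> borel_measurable (leb R)"
    using assms by (auto simp: L2_def)
  have "integrable (leb R) (\<lambda>r. (cmod (f r + g r))\<^sup>2)"
  proof (rule Bochner_Integration.integrable_bound)
    show "integrable (leb R) (\<lambda>r. 2 * (cmod (f r))\<^sup>2 + 2 * (cmod (g r))\<^sup>2)" using assms by (simp add: L2_def)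
    show "AE r in leb R. norm ((cmod (f r + g r))\<^sup>2) \<le> norm (2 * (cmod (f r))\<^sup>2 + 2 * (cmod (g r))\<^sup>2)"
    proof (rule AE_I2)
      fix r
      have "(cmod (f r + g r))\<^sup>2 \<le> (cmod (f r) + cmod (g r))\<^sup>2"
        by (intro power_mono norm_triangle_ineq) auto
      also have "\<dots> \<le> 2 * (cmod (f r))\<^sup>2 + 2 * (cmod (g r))\<^sup>2"
        using sum_squares_bound[of "cmod (f r)" "cmod (g r)"] by (simp add: power2_sum)
      finally show "norm ((cmod (f r + g r))\<^sup>2) \<le> norm (2 * (cmod (f r))\<^sup>2 + 2 * (cmod (g r))\<^sup>2)" by simp
    qed
  qed simp
  then show ?thesis by (simp add: L2_def)
qed

lemma inner_L2_linear_left: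
  assumes "f \<in> L2 R" "g \<in> L2 R" "u \<in> L2 R"
  shows "inner_L2 R (\<lambda>r. c * f r + e * g r) u = c * inner_L2 R f u + e * inner_L2 R g u"
  unfolding inner_L2_def
  using inner_L2_integrable[OF assms(1,3)] inner_L2_integrable[OF assms(2,3)]
  by (simp add: distrib_right mult.assoc)

lemma Delta_k_L2:
  assumes w: "C1_on R w w1" and w2: "wderiv R (wderiv R w) \<in> L2 R"
  shows "Delta_k R k w \<in> L2 R"
proof -
  have "continuous_on {1..R} (\<lambda>r. - of_real (((of_int k)\<^sup>2 - 1/4) / r\<^sup>2) * w r)"
    using C1_onD[OF w] by (intro continuous_intros) auto
  from L2_add[OF w2 L2_continuous[OF this]] show ?thesis
    by (simp add: Delta_k_def[abs_def] del: of_real_divide)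
qed

lemma Delta_k_weak_form:
  assumes w: "C1_on R w w1" and w2: "wderiv R (wderiv R w) \<in> L2 R"
    and ibp: "\<And>G G'. C1_on R G G' \<Longrightarrow> G 1 = 0 \<Longrightarrow> G R = 0 \<Longrightarrow>
      (LINT r|leb R. wderiv R (wderiv R w) r * G r) = - (LINT r|leb R. w1 r * G' r)"
    and G: "C1_on R G G1" "G 1 = 0" "G R = 0"
  shows "inner_L2 R (Delta_k R k w) G
    = - (inner_L2 R w1 G1 + of_real ((of_int k)\<^sup>2 - 1/4) * inner_L2 R (divr w) (divr G))"
proof -
  define w2 where "w2 = wderiv R (wderiv R w)"
  have cw: "continuous_on {1..R} w" and cG: "continuous_on {1..R} G"
    using C1_onD[OF w] C1_onD[OF G(1)] by auto
  define u where "u r = w r / (of_real r)\<^sup>2" for r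
  have u: "u \<in> L2 R" unfolding u_def[abs_def] by (intro L2_continuous continuous_intros cw) auto
  have L: "w2 \<in> L2 R" "G \<in> L2 R" using w2 cG by (auto simp: w2_def L2_continuous)
  define c where "c = complex_of_real ((of_int k)\<^sup>2 - 1/4)"
  have D: "Delta_k R k w r = 1 * w2 r + (- c) * u r" for r
  proof -
    have "of_real (((of_int k)\<^sup>2 - 1/4) / r\<^sup>2) = c / (of_real r)\<^sup>2" by (simp add: c_def)
    then show ?thesis by (simp add: Delta_k_def w2_def u_def del: of_real_divide)
  qed
  have 1: "inner_L2 R w2 G = - inner_L2 R w1 G1"
    using ibp[OF C1_on_cnj[OF G(1)]] G by (simp add: inner_L2_def w2_def)
  have 2: "inner_L2 R u G = inner_L2 R (divr w) (divr G)"
    unfolding inner_L2_def u_def by (intro Bochner_Integration.integral_cong) (auto simp: power2_eq_square)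
  have "inner_L2 R (Delta_k R k w) G = 1 * inner_L2 R w2 G + (- c) * inner_L2 R u G"
    unfolding D[abs_def] by (rule inner_L2_linear_left[OF L(1) u L(2)])
  then show ?thesis
    unfolding c_def[symmetric] by (simp add: 1 2)
qed

text \<open>A real \<open>Sup\<close> dominates the elements of its set only if the set is bounded
  above. The bound uses |g| \<le> R |g/r|.\<close>

lemma norm_Hm1r_bdd:
  assumes f: "f \<in> L2 R" and R: "R > 1"
  shows "bdd_above {cmod (inner_L2 R f g) | g. g \<in> H1 R \<and> norm_H1r R g \<le> 1}"
proof (rule bdd_aboveI)
  fix x assume "x \<in> {cmod (inner_L2 R f g) | g. g \<in> H1 R \<and> norm_H1r R g \<le> 1}"
  then obtain g where g: "x = cmod (inner_L2 R f g)" "g \<in> H1 R" "norm_H1r R g \<le> 1" by blast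
  have "continuous_on {1..R} (\<lambda>r. 1 / complex_of_real r)" by (intro continuous_intros) auto
  then have gL: "divr g \<in> L2 R"
    using L2_mult_continuous[of g R "\<lambda>r. 1 / of_real r"] g(2) by (simp add: H1_def)
  have "norm_L2 R (divr g) \<le> norm_H1r R g"
    unfolding norm_H1r_def by (intro real_le_rsqrt) simp
  then have g1: "norm_L2 R (divr g) \<le> 1" using g by simp
  have "cmod (inner_L2 R f g) \<le> R * (norm_L2 R f * norm_L2 R (divr g))"
  proof (rule inner_L2_bound[OF f gL])
    fix r assume r: "r \<in> {1..R}"
    have "cmod (f r) * cmod (g r) = r * (cmod (f r) * cmod (divr g r))"
      using r by (simp add: norm_divide)
    also have "\<dots> \<le> R * (cmod (f r) * cmod (divr g r))" using r by (intro mult_right_mono) auto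
    finally show "cmod (f r) * cmod (g r) \<le> R * (cmod (f r) * cmod (divr g r))" .
  qed (use R in auto)
  also have "\<dots> \<le> R * (norm_L2 R f * 1)" using g1 R by (intro mult_left_mono) auto
  finally show "x \<le> R * (norm_L2 R f * 1)" using g by simp
qed

lemma norm_H1r_C1:
  assumes G: "C1_on R G G1" and R: "R > 1"
  shows "norm_H1r R G = sqrt ((norm_L2 R G1)\<^sup>2 + (norm_L2 R (divr G))\<^sup>2)"
proof -
  have "norm_L2 R (wderiv R G) = norm_L2 R G1"
    using C1_on_H1[OF G R] C1_onD[OF G] by (intro norm_L2_cong_AE) (auto intro: H1_wderiv L2_continuous)
  then show ?thesis by (simp add: norm_H1r_def)
qed

lemma norm_L2_scale: "norm_L2 R (\<lambda>r. c * f r) = cmod c * norm_L2 R f"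
  by (simp add: norm_L2_def norm_mult power_mult_distrib real_sqrt_mult)

lemma sqrt_sum_squares_scale:
  fixes t x y :: real
  assumes "t \<ge> 0" shows "sqrt ((t * x)\<^sup>2 + (t * y)\<^sup>2) = t * sqrt (x\<^sup>2 + y\<^sup>2)"
  using assms by (simp add: power_mult_distrib real_sqrt_mult flip: distrib_left)

text \<open>Scaling \<open>G\<close> to unit norm makes it a competitor in the supremum. The
  Euclidean norm of the pair is then replaced by the sum, the form in which the locale expects the
  bound.\<close>

lemma norm_Hm1r_bound:
  assumes f: "f \<in> L2 R" and G: "C1_on R G G1" and R: "R > 1"
  shows "cmod (inner_L2 R f G) \<le> norm_Hm1r R f * (norm_L2 R G1 + norm_L2 R (divr G))"
    and "0 \<le> norm_Hm1r R f"
proof -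
  define N where "N = sqrt ((norm_L2 R G1)\<^sup>2 + (norm_L2 R (divr G))\<^sup>2)"
  define S where "S = {cmod (inner_L2 R f g) | g. g \<in> H1 R \<and> norm_H1r R g \<le> 1}"
  have bdd: "bdd_above S" unfolding S_def by (rule norm_Hm1r_bdd[OF f R])
  have Sup: "norm_Hm1r R f = Sup S" by (simp add: norm_Hm1r_def S_def)
  have scaled: "t * cmod (inner_L2 R f G) \<le> norm_Hm1r R f" if t: "t \<ge> 0" "t * N \<le> 1" for t :: real
  proof -
    have C: "C1_on R (\<lambda>r. of_real t * G r) (\<lambda>r. of_real t * G1 r)"
      using C1_on_mult[OF C1_on_of_real[of R "\<lambda>_. t" "\<lambda>_. 0"] G] by simp
    have d: "divr (\<lambda>r. of_real t * G r) = (\<lambda>r. of_real t * divr G r)" by auto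
    have "norm_H1r R (\<lambda>r. of_real t * G r) = t * N"
      unfolding norm_H1r_C1[OF C R] d norm_L2_scale N_def using sqrt_sum_squares_scale[OF t(1)] t by simp
    then have "cmod (inner_L2 R f (\<lambda>r. of_real t * G r)) \<in> S"
      unfolding S_def using C1_on_H1(1)[OF C R] t by auto
    moreover have "inner_L2 R f (\<lambda>r. of_real t * G r) = of_real t * inner_L2 R f G"
      unfolding inner_L2_def by (simp add: mult.left_commute)
    ultimately have "t * cmod (inner_L2 R f G) \<in> S" using t by (simp add: norm_mult)
    then show ?thesis unfolding Sup by (rule cSup_upper[OF _ bdd])
  qed
  show nn: "0 \<le> norm_Hm1r R f" using scaled[of 0] by simp
  have le: "N \<le> norm_L2 R G1 + norm_L2 R (divr G)"
    unfolding N_def by (rule sqrt_sum_squares_le_sum) auto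
  have N0: "N \<ge> 0" by (simp add: N_def)
  have "cmod (inner_L2 R f G) \<le> norm_Hm1r R f * N"
  proof (cases "N = 0")
    case False
    then have "1 / N * cmod (inner_L2 R f G) \<le> norm_Hm1r R f" using N0 by (intro scaled) auto
    then show ?thesis using False N0 by (simp add: field_simps)
  next
    \<comment> \<open>Every multiple of \<open>G\<close> is a competitor here, so a nonzero pairing
      would exceed the supremum after scaling.\<close>
    case True
    have "cmod (inner_L2 R f G) \<le> 0"
    proof (rule ccontr)
      assume "\<not> ?thesis"
      then have pos: "cmod (inner_L2 R f G) > 0" by simp
      have "(norm_Hm1r R f + 1) / cmod (inner_L2 R f G) * cmod (inner_L2 R f G) \<le> norm_Hm1r R f"
        using True nn pos by (intro scaled) auto
      then show False using pos by simp
    qed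
    then show ?thesis using True by simp
  qed
  also have "\<dots> \<le> norm_Hm1r R f * (norm_L2 R G1 + norm_L2 R (divr G))"
    using nn le by (intro mult_left_mono)
  finally show "cmod (inner_L2 R f G) \<le> norm_Hm1r R f * (norm_L2 R G1 + norm_L2 R (divr G))" .
qed

text \<open>Pairing the equation of the stream function with \<phi> gives -<w, \<phi>> as a coercive
  quadratic form in p and \<kappa> q. The quantity <w, \<phi>> is therefore what both regimes have
  to estimate.\<close>

lemma stream_energy:
  assumes \<phi>: "solves_stream R k w \<phi>" and R: "R > 1" and k: "\<bar>k\<bar> \<ge> 1" and w: "continuous_on {1..R} w"
  obtains \<phi>1 where "C1_on R \<phi> \<phi>1" "\<phi> 1 = 0" "\<phi> R = 0" "norm_L2 R (wderiv R \<phi>) = norm_L2 R \<phi>1"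
    "(norm_L2 R \<phi>1 + of_int \<bar>k\<bar> * norm_L2 R (divr \<phi>))\<^sup>2 \<le> 3 * cmod (inner_L2 R w \<phi>)"
    "cmod (inner_L2 R w \<phi>) \<le> R\<^sup>2 * (norm_L2 R (divr w) * norm_L2 R (divr \<phi>))"
proof -
  have D: "\<phi> \<in> dom_D R" and ae: "AE r in leb R. Delta_k R k \<phi> r = w r"
    using \<phi> by (auto simp: solves_stream_def)
  have bc: "\<phi> 1 = 0" "\<phi> R = 0" and H: "\<phi> \<in> H1 R" using D by (auto simp: dom_D_def)
  obtain \<phi>1 where C: "C1_on R \<phi> \<phi>1" and d: "AE r in leb R. wderiv R \<phi> r = \<phi>1 r"
    and L2: "wderiv R (wderiv R \<phi>) \<in> L2 R"
    and ibp: "\<And>G G'. C1_on R G G' \<Longrightarrow> G 1 = 0 \<Longrightarrow> G R = 0 \<Longrightarrow>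
      (LINT r|leb R. wderiv R (wderiv R \<phi>) r * G r) = - (LINT r|leb R. \<phi>1 r * G' r)"
    using dom_D_regularity[OF D R] by blast
  note c = C1_onD[OF C]
  define p q \<kappa> where "p = norm_L2 R \<phi>1" and "q = norm_L2 R (divr \<phi>)" and "\<kappa> = real_of_int \<bar>k\<bar>"
  have kap: "\<kappa> \<ge> 1" "\<kappa>\<^sup>2 = (of_int k)\<^sup>2" using k unfolding \<kappa>_def by simp_all
  have DL: "inner_L2 R (Delta_k R k \<phi>) \<phi>
      = - (inner_L2 R \<phi>1 \<phi>1 + of_real ((of_int k)\<^sup>2 - 1/4) * inner_L2 R (divr \<phi>) (divr \<phi>))"
    "Delta_k R k \<phi> \<in> L2 R"
    by (rule Delta_k_weak_form[OF C L2 _ C bc], rule ibp, assumption+) (rule Delta_k_L2[OF C L2])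
  have wL: "w \<in> L2 R" "\<phi> \<in> L2 R" using w c by (auto intro: L2_continuous)
  have "inner_L2 R w \<phi> = inner_L2 R (Delta_k R k \<phi>) \<phi>"
    unfolding inner_L2_def
  proof (rule integral_cong_AE)
    show "AE r in leb R. w r * cnj (\<phi> r) = Delta_k R k \<phi> r * cnj (\<phi> r)"
      using ae by eventually_elim simp
  qed (rule borel_measurable_integrable, rule inner_L2_integrable, (rule wL DL(2))+)+
  also have "\<dots> = - of_real (p\<^sup>2 + ((of_int k)\<^sup>2 - 1/4) * q\<^sup>2)"
    unfolding DL(1) inner_L2_self p_def q_def by simp
  finally have e: "cmod (inner_L2 R w \<phi>) = \<bar>p\<^sup>2 + (\<kappa>\<^sup>2 - 1/4) * q\<^sup>2\<bar>"
    by (simp only: norm_minus_cancel norm_of_real kap(2))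
  have "(p + \<kappa> * q)\<^sup>2 \<le> 2 * p\<^sup>2 + 2 * (\<kappa> * q)\<^sup>2"
    using sum_squares_bound[of p "\<kappa> * q"] by (simp add: power2_sum)
  also have "\<dots> \<le> 3 * (p\<^sup>2 + (3/4 * \<kappa>\<^sup>2) * q\<^sup>2)"
  proof -
    \<comment> \<open>The factor 3 suffices because 3 * 3/4 = 9/4 exceeds 2.\<close>
    have "3 * (p\<^sup>2 + (3/4 * \<kappa>\<^sup>2) * q\<^sup>2) = 3 * p\<^sup>2 + 9/4 * (\<kappa> * q)\<^sup>2"
      by (simp add: power_mult_distrib)
    then show ?thesis using zero_le_power2[of p] zero_le_power2[of "\<kappa> * q"] by linarith
  qed
  also have "\<dots> \<le> 3 * (p\<^sup>2 + (\<kappa>\<^sup>2 - 1/4) * q\<^sup>2)"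
    using three_quarters_sq_le[OF kap(1)] by (intro mult_left_mono add_mono mult_right_mono) auto
  also have "\<dots> \<le> 3 * cmod (inner_L2 R w \<phi>)" unfolding e by (intro mult_left_mono) auto
  finally have E: "(p + \<kappa> * q)\<^sup>2 \<le> 3 * cmod (inner_L2 R w \<phi>)" .
  have dL: "divr w \<in> L2 R" "divr \<phi> \<in> L2 R" using w c by (auto intro!: L2_continuous continuous_on_divr)
  have le: "cmod (inner_L2 R w \<phi>) \<le> R\<^sup>2 * (norm_L2 R (divr w) * norm_L2 R (divr \<phi>))"
  proof (rule inner_L2_bound[OF dL])
    fix r assume r: "r \<in> {1..R}"
    have "cmod (w r) * cmod (\<phi> r) = r\<^sup>2 * (cmod (divr w r) * cmod (divr \<phi> r))"
      using r by (simp add: norm_divide power2_eq_square)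
    also have "\<dots> \<le> R\<^sup>2 * (cmod (divr w r) * cmod (divr \<phi> r))"
      using r by (intro mult_right_mono power_mono) auto
    finally show "cmod (w r) * cmod (\<phi> r) \<le> R\<^sup>2 * (cmod (divr w r) * cmod (divr \<phi> r))" .
  qed auto
  have "norm_L2 R (wderiv R \<phi>) = norm_L2 R \<phi>1"
    using d H1_wderiv(1)[OF H] c by (intro norm_L2_cong_AE) (auto intro: L2_continuous)
  then show ?thesis using that[OF C bc] E le unfolding p_def q_def \<kappa>_def by blast
qed

section \<open>The two regimes combined\<close>

context weak_resolvent
begin

text \<open>With n = 0 the forcing pairs only with G/r, so the large derivative of the multiplier
  never meets it. The constant 100000 covers the constants of both regimes.\<close>

lemma strong_estimates:
  assumes c': "0 \<le> c'" "c' \<le> 1/4000" and d: "d = c' * \<eta>" and n0: "n = 0"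
    and \<phi>: "C1_on R \<phi> \<phi>1" "\<phi> 1 = 0" "\<phi> R = 0"
    and E: "(norm_L2 R \<phi>1 + \<kappa> * norm_L2 R (divr \<phi>))\<^sup>2 \<le> 3 * cmod (inner_L2 R w \<phi>)"
    and le: "cmod (inner_L2 R w \<phi>) \<le> R\<^sup>2 * (b * norm_L2 R (divr \<phi>))"
  shows "\<eta>\<^sup>2 * a + \<eta> * b \<le> 100000 * m"
    and "sqrt (\<eta> * \<kappa>) * (norm_L2 R \<phi>1 + \<kappa> * norm_L2 R (divr \<phi>)) \<le> 100000 * R\<^sup>2 * m"
proof -
  note pos = \<eta> \<kappa> norm_L2_nonneg[of R w1] norm_L2_nonneg[of R "divr w"] c'
  define p q Q Ep where "p = norm_L2 R \<phi>1" and "q = norm_L2 R (divr \<phi>)"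
    and "Q = norm_L2 R (\<lambda>r. of_real (theta lam \<eta> r) * divr \<phi> r)" and "Ep = p + \<kappa> * q"
  have pq: "p \<ge> 0" "q \<ge> 0" "Q \<ge> 0" "R\<^sup>2 \<ge> 0" by (auto simp: p_def q_def Q_def)
  note E' = E[folded p_def q_def, folded Ep_def] and le' = le[folded q_def]
  have en: "\<eta>^3 * (a\<^sup>2 + (\<kappa>\<^sup>2 - 1/4) * b\<^sup>2) \<le> m * b + c' * \<eta> * b\<^sup>2"
    using energy by (simp add: n0 d)
  have mR: "0 \<le> R\<^sup>2 * m" using m by simp
  have "(\<eta>\<^sup>2 * a + \<eta> * b \<le> 100000 * m) \<and> (sqrt (\<eta> * \<kappa>) * Ep \<le> 100000 * (R\<^sup>2 * m))"
  proof (cases "1/16 \<le> \<eta> * \<kappa>")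
    case True
    note s = elliptic_strong[OF pos m True en]
    have "Ep\<^sup>2 \<le> 3 * R\<^sup>2 * b * q" using E' le' by simp
    from stream_elliptic_strong[OF pos pq Ep_def m True this s(3)]
    show ?thesis using s(1,2) mR m by (intro conjI; linarith)
  next
    case False
    then have t: "\<eta> * \<kappa> \<le> 1/16" by simp
    have \<eta>2: "\<eta> \<le> 1/2" using eta_le_sixteenth[OF pos t] by simp
    have L: "b\<^sup>2 \<le> m * b / \<eta> + (2 * \<eta> + 2 * \<eta>\<^sup>2) * a * b + 8 * \<eta> * (a + b) * b"
      using layer[OF \<eta>2] by (simp add: n0)
    note s = viscous_strong[OF pos m t en L]
    have "Q\<^sup>2 \<le> 8 * \<eta> * (p + q) * q"
      unfolding Q_def p_def q_def by (rule critical_layer_bound[OF \<phi> R \<eta> \<eta>2])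
    moreover have "Ep\<^sup>2 \<le> 3 * (R\<^sup>2 * (m * Q / \<eta> + \<eta>^3 * a * (5 * Q / \<eta>\<^sup>2 + p / \<eta>)
        + \<eta>\<^sup>2 * \<kappa>\<^sup>2 * b * Q + c' * \<eta> * b * Q / \<eta> + b * Q))"
      using E' stream_split[OF \<phi> \<eta>2, folded p_def Q_def] by (simp add: n0 d)
    ultimately have "sqrt (\<eta> * \<kappa>) * Ep \<le> 24000 * R\<^sup>2 * m"
      using stream_viscous_strong[OF pos pq Ep_def m t _ _ s] by blast
    then show ?thesis using s mR m by (intro conjI; linarith)
  qed
  then show "\<eta>\<^sup>2 * a + \<eta> * b \<le> 100000 * m"
    "sqrt (\<eta> * \<kappa>) * (norm_L2 R \<phi>1 + \<kappa> * norm_L2 R (divr \<phi>)) \<le> 100000 * R\<^sup>2 * m"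
    unfolding Ep_def p_def q_def by (simp_all add: mult.assoc)
qed

text \<open>With m = n the forcing also meets the derivative of the multiplier; hence one more power
  of \<eta> than in \<open>strong_estimates\<close> on \<open>a\<close> and
  \<open>b\<close>.\<close>

lemma weak_estimates:
  assumes c': "0 \<le> c'" "c' \<le> 1/4000" and d: "d = c' * \<eta>" and mn: "m = n"
    and \<phi>: "C1_on R \<phi> \<phi>1" "\<phi> 1 = 0" "\<phi> R = 0"
    and E: "(norm_L2 R \<phi>1 + \<kappa> * norm_L2 R (divr \<phi>))\<^sup>2 \<le> 3 * cmod (inner_L2 R w \<phi>)"
    and le: "cmod (inner_L2 R w \<phi>) \<le> R\<^sup>2 * (b * norm_L2 R (divr \<phi>))"
  shows "\<eta>^3 * sqrt (a\<^sup>2 + b\<^sup>2) + \<eta>\<^sup>2 * b \<le> 100000 * n"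
    and "(sqrt \<eta>)^3 * (norm_L2 R \<phi>1 + \<kappa> * norm_L2 R (divr \<phi>)) \<le> 100000 * R\<^sup>2 * n"
proof -
  note pos = \<eta> \<kappa> norm_L2_nonneg[of R w1] norm_L2_nonneg[of R "divr w"] c'
  define p q Q Ep where "p = norm_L2 R \<phi>1" and "q = norm_L2 R (divr \<phi>)"
    and "Q = norm_L2 R (\<lambda>r. of_real (theta lam \<eta> r) * divr \<phi> r)" and "Ep = p + \<kappa> * q"
  have pq: "p \<ge> 0" "q \<ge> 0" "Q \<ge> 0" "R\<^sup>2 \<ge> 0" by (auto simp: p_def q_def Q_def)
  note E' = E[folded p_def q_def, folded Ep_def] and le' = le[folded q_def]
  have en: "\<eta>^3 * (a\<^sup>2 + (\<kappa>\<^sup>2 - 1/4) * b\<^sup>2) \<le> n * a + n * b + c' * \<eta> * b\<^sup>2"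
    using energy by (simp add: mn d)
  have nR: "0 \<le> R\<^sup>2 * n" using n by simp
  have "(\<eta>^3 * a \<le> 100 * n \<and> \<eta>^3 * \<kappa> * b \<le> 100 * n \<and> \<eta>\<^sup>2 * b \<le> 2100 * n) \<and> ((sqrt \<eta>)^3 * Ep \<le> 100000 * (R\<^sup>2 * n))"
  proof (cases "1/16 \<le> \<eta> * \<kappa>")
    case True
    note s = elliptic_weak[OF pos n True en]
    have "Ep\<^sup>2 \<le> 3 * R\<^sup>2 * b * q" using E' le' by simp
    from stream_elliptic_weak[OF pos pq Ep_def n True this s(2)]
    show ?thesis using s nR n by (intro conjI; linarith)
  next
    case False
    then have t: "\<eta> * \<kappa> \<le> 1/16" by simp
    have \<eta>2: "\<eta> \<le> 1/2" using eta_le_sixteenth[OF pos t] by simp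
    have L: "b\<^sup>2 \<le> (n * (a + (2 / \<eta> + 2) * b) + n * b) / \<eta> + (2 * \<eta> + 2 * \<eta>\<^sup>2) * a * b + 8 * \<eta> * (a + b) * b"
      using layer[OF \<eta>2] by (simp add: mn)
    note s = viscous_weak[OF pos n t en L]
    have "Q\<^sup>2 \<le> 8 * \<eta> * (p + q) * q"
      unfolding Q_def p_def q_def by (rule critical_layer_bound[OF \<phi> R \<eta> \<eta>2])
    moreover have "Ep\<^sup>2 \<le> 3 * (R\<^sup>2 * (n * (5 * Q / \<eta>\<^sup>2 + p / \<eta>) + n * Q / \<eta> + \<eta>^3 * a * (5 * Q / \<eta>\<^sup>2 + p / \<eta>)
        + \<eta>\<^sup>2 * \<kappa>\<^sup>2 * b * Q + c' * \<eta> * b * Q / \<eta> + b * Q))"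
      using E' stream_split[OF \<phi> \<eta>2, folded p_def Q_def] by (simp add: mn d)
    ultimately have "(sqrt \<eta>)^3 * Ep \<le> 61000 * R\<^sup>2 * n"
      using stream_viscous_weak[OF pos pq Ep_def n t _ _ s(3,1)] by blast
    then show ?thesis using s nR n by (intro conjI; linarith)
  qed
  note r = this
  have "\<eta>^3 * sqrt (a\<^sup>2 + b\<^sup>2) \<le> \<eta>^3 * (a + b)"
    using \<eta> by (intro mult_left_mono sqrt_sum_squares_le_sum) auto
  \<comment> \<open>The regimes control \<kappa> b rather than b at this power of \<eta>, and
    \<kappa> \<ge> 1.\<close>
  also have "\<dots> \<le> \<eta>^3 * a + \<eta>^3 * \<kappa> * b"
  proof -
    have "\<eta>^3 * (1 * b) \<le> \<eta>^3 * (\<kappa> * b)" using \<eta> \<kappa> by (intro mult_left_mono mult_right_mono) auto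
    then show ?thesis by (simp add: distrib_left mult.assoc)
  qed
  finally show "\<eta>^3 * sqrt (a\<^sup>2 + b\<^sup>2) + \<eta>\<^sup>2 * b \<le> 100000 * n" using r n by simp
  show "(sqrt \<eta>)^3 * (norm_L2 R \<phi>1 + \<kappa> * norm_L2 R (divr \<phi>)) \<le> 100000 * R\<^sup>2 * n"
    using r unfolding Ep_def p_def q_def by (simp add: mult.assoc)
qed

end

text \<open>In each product the exponents of \<nu> and K add up to 1, so for \<nu> = K \<eta>^3
  exactly one factor K comes out; it cancels the division of the equation by K.\<close>

lemma powr_scaling:
  fixes K \<eta> \<kappa> :: real
  assumes K: "K > 0" and \<eta>: "\<eta> > 0" and \<kappa>: "\<kappa> > 0"
  shows "(K * \<eta>^3) powr (2/3) * K powr (1/3) = K * \<eta>\<^sup>2"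
    "(K * \<eta>^3) powr (1/3) * K powr (2/3) = K * \<eta>"
    "(K * \<eta>^3) powr (1/6) * K powr (5/6) * \<kappa> powr (1/2) = K * sqrt (\<eta> * \<kappa>)"
    "(K * \<eta>^3) powr (1/2) * K powr (1/2) = K * (sqrt \<eta>)^3"
proof -
  have p: "(K * \<eta>^3) powr x * K powr y = K * \<eta> powr (3 * x)" if "x + y = 1" for x y
  proof -
    have "(K * \<eta>^3) powr x = K powr x * \<eta> powr (3 * x)"
      using K \<eta> by (simp add: powr_mult powr_powr flip: powr_numeral)
    then have "(K * \<eta>^3) powr x * K powr y = K powr (x + y) * \<eta> powr (3 * x)"
      by (simp add: powr_add)
    then show ?thesis using K that by simp
  qed
  show "(K * \<eta>^3) powr (2/3) * K powr (1/3) = K * \<eta>\<^sup>2"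
    using p[of "2/3" "1/3"] \<eta> by simp
  show "(K * \<eta>^3) powr (1/3) * K powr (2/3) = K * \<eta>"
    using p[of "1/3" "2/3"] \<eta> by simp
  show "(K * \<eta>^3) powr (1/6) * K powr (5/6) * \<kappa> powr (1/2) = K * sqrt (\<eta> * \<kappa>)"
    using p[of "1/6" "5/6"] \<eta> \<kappa> by (simp add: powr_half_sqrt real_sqrt_mult)
  have "\<eta> powr (3 / 2) = (\<eta> powr (1/2)) powr 3" by (simp add: powr_powr)
  then show "(K * \<eta>^3) powr (1/2) * K powr (1/2) = K * (sqrt \<eta>)^3"
    using p[of "1/2" "1/2"] \<eta> by (simp add: powr_half_sqrt)
qed

text \<open>An arbitrary continuous \<rho> serves both shifts of the theorem, the one decaying like
  1/r^2 and the constant one.\<close>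

lemma resolvent_weak_form:
  assumes w: "w \<in> dom_D R" and R: "R > 1" and \<rho>: "continuous_on {1..R} \<rho>"
  obtains w1 where "C1_on R w w1" "w 1 = 0" "w R = 0" "norm_L2 R (wderiv R w) = norm_L2 R w1"
    "(\<lambda>r. resolvent_F R \<nu> k B lam w r - of_real (\<rho> r) * w r) \<in> L2 R"
    "\<And>G G1. C1_on R G G1 \<Longrightarrow> G 1 = 0 \<Longrightarrow> G R = 0 \<Longrightarrow>
      inner_L2 R (\<lambda>r. resolvent_F R \<nu> k B lam w r - of_real (\<rho> r) * w r) G
      = of_real \<nu> * (inner_L2 R w1 G1 + of_real ((of_int k)\<^sup>2 - 1/4) * inner_L2 R (divr w) (divr G))
        + \<i> * of_real (of_int k * B) * inner_L2 R (\<lambda>r. of_real (1 / r\<^sup>2 - lam) * w r) G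
        - inner_L2 R (\<lambda>r. of_real (\<rho> r) * w r) G"
proof -
  have bc: "w 1 = 0" "w R = 0" and H: "w \<in> H1 R" using w by (auto simp: dom_D_def)
  obtain w1 where C: "C1_on R w w1" and d: "AE r in leb R. wderiv R w r = w1 r"
    and L2: "wderiv R (wderiv R w) \<in> L2 R"
    and ibp: "\<And>G G'. C1_on R G G' \<Longrightarrow> G 1 = 0 \<Longrightarrow> G R = 0 \<Longrightarrow>
      (LINT r|leb R. wderiv R (wderiv R w) r * G r) = - (LINT r|leb R. w1 r * G' r)"
    using dom_D_regularity[OF w R] by blast
  note c = C1_onD[OF C]
  define f g where "f r = of_real (1 / r\<^sup>2 - lam) * w r" and "g r = of_real (\<rho> r) * w r" for r
  have "continuous_on {1..R} (\<lambda>r. 1 / r\<^sup>2 - lam)" by (intro continuous_intros) auto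
  then have fg: "f \<in> L2 R" "g \<in> L2 R"
    unfolding f_def[abs_def] g_def[abs_def] using c \<rho>
    by (auto simp del: of_real_diff of_real_divide intro!: L2_continuous continuous_intros)
  have DL: "Delta_k R k w \<in> L2 R"
    by (rule Delta_k_L2[OF C L2])
  define h where "h r = (\<i> * of_real (of_int k * B)) * f r + (-1) * g r" for r
  have hL: "h \<in> L2 R" unfolding h_def[abs_def] by (intro L2_add L2_mult_continuous fg continuous_on_const)
  have eq: "resolvent_F R \<nu> k B lam w r - of_real (\<rho> r) * w r = (- of_real \<nu>) * Delta_k R k w r + 1 * h r" for r
    by (simp add: resolvent_F_def h_def f_def g_def del: of_real_diff of_real_divide)
  show ?thesis
  proof (rule that[OF C bc])
    show "norm_L2 R (wderiv R w) = norm_L2 R w1"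
      using d H1_wderiv(1)[OF H] c by (intro norm_L2_cong_AE) (auto intro: L2_continuous)
    show "(\<lambda>r. resolvent_F R \<nu> k B lam w r - of_real (\<rho> r) * w r) \<in> L2 R"
      unfolding eq by (intro L2_add L2_mult_continuous DL hL continuous_on_const)
    fix G G1 assume G: "C1_on R G G1" "G 1 = 0" "G R = 0"
    have Delta: "inner_L2 R (Delta_k R k w) G
      = - (inner_L2 R w1 G1 + of_real ((of_int k)\<^sup>2 - 1/4) * inner_L2 R (divr w) (divr G))"
      by (rule Delta_k_weak_form[OF C L2 _ G], rule ibp, assumption+)
    have GL: "G \<in> L2 R" using C1_onD[OF G(1)] by (intro L2_continuous)
    have "inner_L2 R (\<lambda>r. resolvent_F R \<nu> k B lam w r - of_real (\<rho> r) * w r) G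
      = (- of_real \<nu>) * inner_L2 R (Delta_k R k w) G + 1 * inner_L2 R h G"
      unfolding eq by (rule inner_L2_linear_left[OF DL hL GL])
    also have "inner_L2 R h G = (\<i> * of_real (of_int k * B)) * inner_L2 R f G + (-1) * inner_L2 R g G"
      unfolding h_def[abs_def] by (rule inner_L2_linear_left[OF fg GL])
    finally show "inner_L2 R (\<lambda>r. resolvent_F R \<nu> k B lam w r - of_real (\<rho> r) * w r) G
      = of_real \<nu> * (inner_L2 R w1 G1 + of_real ((of_int k)\<^sup>2 - 1/4) * inner_L2 R (divr w) (divr G))
        + \<i> * of_real (of_int k * B) * inner_L2 R (\<lambda>r. of_real (1 / r\<^sup>2 - lam) * w r) G
        - inner_L2 R (\<lambda>r. of_real (\<rho> r) * w r) G"
      unfolding Delta f_def[abs_def] g_def[abs_def]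
      by (simp only: minus_mult_minus mult_1 mult_minus1 diff_conv_add_uminus add.assoc)
  qed
qed

section \<open>Return from the rescaled estimates to the original parameters\<close>

theorem proposition3p2:
  shows "\<exists>C c :: real. C > 0 \<and> c > 0 \<and>
    (\<forall>(\<nu>::real) (B::real) (R::real) (k::int) (lam::real) (w::real \<Rightarrow> complex)
       (\<phi>::real \<Rightarrow> complex) (c'::real) (F::real \<Rightarrow> complex) (K::real).
      \<nu> > 0 \<longrightarrow> B \<noteq> 0 \<longrightarrow> R > 1 \<longrightarrow> \<bar>k\<bar> \<ge> 1 \<longrightarrow> w \<in> dom_D R \<longrightarrow> 0 \<le> c' \<longrightarrow> c' \<le> c \<longrightarrow>
      F = resolvent_F R \<nu> k B lam w \<longrightarrow> solves_stream R k w \<phi> \<longrightarrow>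
      K = \<bar>of_int k * B\<bar> \<longrightarrow>
      \<nu> powr (2/3) * K powr (1/3) * norm_L2 R (wderiv R w)
        + \<nu> powr (1/3) * K powr (2/3) * norm_L2 R (\<lambda>r. w r / of_real r)
        \<le> C * norm_L2 R (\<lambda>r. of_real r * F r
                - of_real (c' * \<nu> powr (1/3) * K powr (2/3)) * (w r / of_real r))
      \<and>
      \<nu> powr (1/6) * K powr (5/6) * of_int \<bar>k\<bar> powr (1/2)
        * (norm_L2 R (wderiv R \<phi>) + of_int \<bar>k\<bar> * norm_L2 R (\<lambda>r. \<phi> r / of_real r))
        \<le> C * R\<^sup>2 * ((\<nu> / K) powr (1/6) * ln R powr (1/2) + 1)
            * norm_L2 R (\<lambda>r. of_real r * F r
                - of_real (c' * \<nu> powr (1/3) * K powr (2/3)) * (w r / of_real r))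
      \<and>
      \<nu> * norm_H1r R w
        + \<nu> powr (2/3) * K powr (1/3) * norm_L2 R (\<lambda>r. w r / of_real r)
        \<le> C * norm_Hm1r R (\<lambda>r. F r
                - of_real (c' * \<nu> powr (1/3) * K powr (2/3) / R\<^sup>2) * w r)
      \<and>
      \<nu> powr (1/2) * K powr (1/2) * norm_L2 R (wderiv R \<phi>)
        + \<nu> powr (1/2) * of_int \<bar>k\<bar> * K powr (1/2) * norm_L2 R (\<lambda>r. \<phi> r / of_real r)
        \<le> C * R\<^sup>2 * norm_Hm1r R (\<lambda>r. F r
                - of_real (c' * \<nu> powr (1/3) * K powr (2/3) / R\<^sup>2) * w r))"
proof (rule exI[of _ 100000], rule exI[of _ "1/4000"], intro conjI[of "_ > _"] allI impI)
  fix \<nu> B R :: real and k :: int and lam :: real and w \<phi> :: "real \<Rightarrow> complex" and c' :: real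
    and F :: "real \<Rightarrow> complex" and K :: real
  assume \<nu>: "\<nu> > 0" and B: "B \<noteq> 0" and R: "R > 1" and k: "\<bar>k\<bar> \<ge> 1" and w: "w \<in> dom_D R"
    and c': "0 \<le> c'" "c' \<le> 1/4000" and F: "F = resolvent_F R \<nu> k B lam w"
    and \<phi>: "solves_stream R k w \<phi>" and K_def: "K = \<bar>of_int k * B\<bar>"
  \<comment> \<open>\<sigma> is the sign of k B; it remains when the equation is divided by
    K.\<close>
  define \<eta> \<kappa> \<sigma> where "\<eta> = (\<nu> / K) powr (1/3)" and "\<kappa> = real_of_int \<bar>k\<bar>" and "\<sigma> = of_int k * B / K"
  have K: "K > 0" using B k by (auto simp: K_def)
  have \<eta>: "\<eta> > 0" using \<nu> K by (simp add: \<eta>_def)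
  have "\<eta>^3 = \<nu> / K" using \<nu> K by (simp add: \<eta>_def powr_powr flip: powr_numeral)
  then have \<nu>_eq: "\<nu> = K * \<eta>^3" using K by simp
  have \<kappa>: "\<kappa> \<ge> 1" "\<kappa>\<^sup>2 = (of_int k)\<^sup>2" using k unfolding \<kappa>_def by simp_all
  have \<sigma>: "\<bar>\<sigma>\<bar> = 1" "K * \<sigma> = of_int k * B" using K by (auto simp: \<sigma>_def K_def abs_mult)
  have cw: "continuous_on {1..R} w" using w by (simp add: dom_D_def)
  obtain \<phi>1 where \<phi>1: "C1_on R \<phi> \<phi>1" "\<phi> 1 = 0" "\<phi> R = 0" "norm_L2 R (wderiv R \<phi>) = norm_L2 R \<phi>1"
    "(norm_L2 R \<phi>1 + \<kappa> * norm_L2 R (divr \<phi>))\<^sup>2 \<le> 3 * cmod (inner_L2 R w \<phi>)"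
    "cmod (inner_L2 R w \<phi>) \<le> R\<^sup>2 * (norm_L2 R (divr w) * norm_L2 R (divr \<phi>))"
    using stream_energy[OF \<phi> R k cw] unfolding \<kappa>_def by blast
  define Ep where "Ep = norm_L2 R \<phi>1 + \<kappa> * norm_L2 R (divr \<phi>)"
  note sc = powr_scaling[OF K \<eta>, of \<kappa>, folded \<nu>_eq]
  \<comment> \<open>The premise on the pairing is the only place where the norm of the forcing
    enters; the rest of the locale is verified once for both cases.\<close>
  have weak_resolventI: "\<exists>w1. norm_L2 R (wderiv R w) = norm_L2 R w1 \<and> C1_on R w w1 \<and>
      weak_resolvent R lam \<eta> \<kappa> \<sigma> (c' * \<eta>) m n \<rho> w w1
        (\<lambda>G. inner_L2 R (\<lambda>r. F r - of_real (K * \<rho> r) * w r) G / of_real K)"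
    if \<rho>: "continuous_on {1..R} \<rho>" "\<And>r. r \<in> {1..R} \<Longrightarrow> 0 \<le> \<rho> r" "\<And>r. r \<in> {1..R} \<Longrightarrow> \<rho> r \<le> c' * \<eta> / r\<^sup>2"
      and mn: "m \<ge> 0" "n \<ge> 0"
      and bound: "\<And>G G1. (\<lambda>r. F r - of_real (K * \<rho> r) * w r) \<in> L2 R \<Longrightarrow> C1_on R G G1 \<Longrightarrow>
        cmod (inner_L2 R (\<lambda>r. F r - of_real (K * \<rho> r) * w r) G) \<le> K * (n * norm_L2 R G1 + m * norm_L2 R (divr G))"
    for \<rho> m n
  proof -
    have c\<rho>: "continuous_on {1..R} (\<lambda>r. K * \<rho> r)" using \<rho>(1) by (intro continuous_intros)
    obtain w1 where w1: "C1_on R w w1" "w 1 = 0" "w R = 0" "norm_L2 R (wderiv R w) = norm_L2 R w1"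
      and L: "(\<lambda>r. F r - of_real (K * \<rho> r) * w r) \<in> L2 R"
      and weak: "\<And>G G1. C1_on R G G1 \<Longrightarrow> G 1 = 0 \<Longrightarrow> G R = 0 \<Longrightarrow>
      inner_L2 R (\<lambda>r. F r - of_real (K * \<rho> r) * w r) G
      = of_real \<nu> * (inner_L2 R w1 G1 + of_real ((of_int k)\<^sup>2 - 1/4) * inner_L2 R (divr w) (divr G))
        + \<i> * of_real (of_int k * B) * inner_L2 R (\<lambda>r. of_real (1 / r\<^sup>2 - lam) * w r) G
        - inner_L2 R (\<lambda>r. of_real (K * \<rho> r) * w r) G"
      using resolvent_weak_form[OF w R c\<rho>, of \<nu> k B lam] unfolding F by blast
    have "weak_resolvent R lam \<eta> \<kappa> \<sigma> (c' * \<eta>) m n \<rho> w w1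
        (\<lambda>G. inner_L2 R (\<lambda>r. F r - of_real (K * \<rho> r) * w r) G / of_real K)"
    proof
      fix G G1 assume G: "C1_on R G G1" "G 1 = 0" "G R = 0"
      have "inner_L2 R (\<lambda>r. of_real (K * \<rho> r) * w r) G = of_real K * inner_L2 R (\<lambda>r. of_real (\<rho> r) * w r) G"
        by (simp add: inner_L2_def mult.assoc)
      moreover have "complex_of_real \<nu> = of_real K * of_real (\<eta>^3)" "complex_of_real (of_int k * B) = of_real K * of_real \<sigma>"
        unfolding \<nu>_eq \<sigma>(2)[symmetric] by (simp_all only: of_real_mult)
      ultimately show "inner_L2 R (\<lambda>r. F r - of_real (K * \<rho> r) * w r) G / of_real K
        = of_real (\<eta>^3) * (inner_L2 R w1 G1 + of_real (\<kappa>\<^sup>2 - 1/4) * inner_L2 R (divr w) (divr G))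
          + \<i> * of_real \<sigma> * inner_L2 R (\<lambda>r. of_real (1 / r\<^sup>2 - lam) * w r) G
          - inner_L2 R (\<lambda>r. of_real (\<rho> r) * w r) G"
        using K unfolding weak[OF G] \<kappa>(2)
        by (simp add: diff_divide_distrib add_divide_distrib mult.assoc del: of_real_diff of_real_divide of_real_power)
      show "cmod (inner_L2 R (\<lambda>r. F r - of_real (K * \<rho> r) * w r) G / of_real K) \<le> n * norm_L2 R G1 + m * norm_L2 R (divr G)"
        using bound[OF L G(1)] K by (simp add: norm_divide field_simps)
    qed (use R \<eta> \<kappa> \<sigma> mn w1 \<rho> in auto)
    then show ?thesis using w1 by blast
  qed
  define M where "M = norm_L2 R (\<lambda>r. of_real r * F r - of_real (c' * \<nu> powr (1/3) * K powr (2/3)) * (w r / of_real r))"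
  define N where "N = norm_Hm1r R (\<lambda>r. F r - of_real (c' * \<nu> powr (1/3) * K powr (2/3) / R\<^sup>2) * w r)"
  have c_scale: "c' * \<nu> powr (1/3) * K powr (2/3) = K * (c' * \<eta>)"
    using sc(2) \<kappa> by (simp add: mult.assoc)

  have strong: "\<eta>\<^sup>2 * norm_L2 R (wderiv R w) + \<eta> * norm_L2 R (divr w) \<le> 100000 * (M / K) \<and>
      sqrt (\<eta> * \<kappa>) * Ep \<le> 100000 * R\<^sup>2 * (M / K)"
  proof -
    \<comment> \<open>Multiplied by r and by K this is the shift inside the weighted norm, so M is
      the norm of r times the shifted forcing.\<close>
    define \<rho> where "\<rho> r = c' * \<eta> / r\<^sup>2" for r
    have "\<exists>w1. norm_L2 R (wderiv R w) = norm_L2 R w1 \<and> C1_on R w w1 \<and>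
      weak_resolvent R lam \<eta> \<kappa> \<sigma> (c' * \<eta>) (M / K) 0 \<rho> w w1
        (\<lambda>G. inner_L2 R (\<lambda>r. F r - of_real (K * \<rho> r) * w r) G / of_real K)"
    proof (rule weak_resolventI)
      show "continuous_on {1..R} \<rho>" unfolding \<rho>_def by (intro continuous_intros) auto
      fix G G1 assume L: "(\<lambda>r. F r - of_real (K * \<rho> r) * w r) \<in> L2 R" and G: "C1_on R G G1"
      define H where "H r = of_real r * (F r - of_real (K * \<rho> r) * w r)" for r
      have HL: "H \<in> L2 R" unfolding H_def[abs_def] by (intro L2_mult_continuous L continuous_intros)
      have dL: "divr G \<in> L2 R" using C1_onD[OF G] by (intro L2_continuous continuous_on_divr)
      have "M = norm_L2 R H"
        unfolding M_def c_scale H_def by (rule norm_L2_cong) (simp add: \<rho>_def power2_eq_square algebra_simps)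
      \<comment> \<open>The factor r moves from \<open>G\<close> to the forcing.\<close>
      moreover have "cmod (inner_L2 R (\<lambda>r. F r - of_real (K * \<rho> r) * w r) G) \<le> 1 * (norm_L2 R H * norm_L2 R (divr G))"
        by (rule inner_L2_bound[OF HL dL]) (auto simp: H_def norm_mult norm_divide)
      ultimately show "cmod (inner_L2 R (\<lambda>r. F r - of_real (K * \<rho> r) * w r) G) \<le> K * (0 * norm_L2 R G1 + M / K * norm_L2 R (divr G))"
        using K by simp
    qed (use c' \<eta> K in \<open>auto simp: \<rho>_def M_def\<close>)
    then obtain w1 where w1: "norm_L2 R (wderiv R w) = norm_L2 R w1"
      and WR: "weak_resolvent R lam \<eta> \<kappa> \<sigma> (c' * \<eta>) (M / K) 0 \<rho> w w1
        (\<lambda>G. inner_L2 R (\<lambda>r. F r - of_real (K * \<rho> r) * w r) G / of_real K)" by blast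
    then show ?thesis
      unfolding w1 Ep_def
      using weak_resolvent.strong_estimates[OF WR c' refl refl \<phi>1(1,2,3,5,6)] by blast
  qed

  have weak: "\<eta>^3 * norm_H1r R w + \<eta>\<^sup>2 * norm_L2 R (divr w) \<le> 100000 * (N / K) \<and>
      (sqrt \<eta>)^3 * Ep \<le> 100000 * R\<^sup>2 * (N / K)"
  proof -
    \<comment> \<open>Constant in r, and below c' \<eta>/r^2 because r \<le> R.\<close>
    define \<rho> where "\<rho> r = c' * \<eta> / R\<^sup>2" for r :: real
    have N: "N = norm_Hm1r R (\<lambda>r. F r - of_real (K * \<rho> r) * w r)"
      unfolding N_def c_scale by (simp add: \<rho>_def)
    have L: "(\<lambda>r. F r - of_real (K * \<rho> r) * w r) \<in> L2 R"
      using resolvent_weak_form[OF w R, of "\<lambda>r. K * \<rho> r" \<nu> k B lam] unfolding F \<rho>_def by (metis continuous_on_const)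
    have N0: "N \<ge> 0"
      unfolding N using norm_Hm1r_bound(2)[OF L _ R, of "\<lambda>_. 0" "\<lambda>_. 0"] by (simp add: C1_on_def)
    have "\<exists>w1. norm_L2 R (wderiv R w) = norm_L2 R w1 \<and> C1_on R w w1 \<and>
      weak_resolvent R lam \<eta> \<kappa> \<sigma> (c' * \<eta>) (N / K) (N / K) \<rho> w w1
        (\<lambda>G. inner_L2 R (\<lambda>r. F r - of_real (K * \<rho> r) * w r) G / of_real K)"
    proof (rule weak_resolventI)
      show "continuous_on {1..R} \<rho>" unfolding \<rho>_def by (intro continuous_intros)
      show "\<rho> r \<le> c' * \<eta> / r\<^sup>2" if "r \<in> {1..R}" for r
        unfolding \<rho>_def using that c' \<eta> R by (intro divide_left_mono power_mono) auto
      fix G G1 assume G: "C1_on R G G1"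
      show "cmod (inner_L2 R (\<lambda>r. F r - of_real (K * \<rho> r) * w r) G) \<le> K * (N / K * norm_L2 R G1 + N / K * norm_L2 R (divr G))"
        using norm_Hm1r_bound(1)[OF L G R] K unfolding N[symmetric] by (simp add: distrib_left)
    qed (use c' \<eta> K N0 in \<open>auto simp: \<rho>_def\<close>)
    then obtain w1 where w1: "norm_L2 R (wderiv R w) = norm_L2 R w1" "C1_on R w w1"
      and WR: "weak_resolvent R lam \<eta> \<kappa> \<sigma> (c' * \<eta>) (N / K) (N / K) \<rho> w w1
        (\<lambda>G. inner_L2 R (\<lambda>r. F r - of_real (K * \<rho> r) * w r) G / of_real K)" by blast
    then show ?thesis
      unfolding norm_H1r_C1[OF w1(2) R] Ep_def
      using weak_resolvent.weak_estimates[OF WR c' refl refl \<phi>1(1,2,3,5,6)] by blast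
  qed
  have M0: "M \<ge> 0" by (simp add: M_def)
  have \<kappa>0: "\<kappa> > 0" using \<kappa> by simp
  have 1: "\<nu> powr (2/3) * K powr (1/3) * norm_L2 R (wderiv R w)
        + \<nu> powr (1/3) * K powr (2/3) * norm_L2 R (divr w) \<le> 100000 * M"
    unfolding sc(1)[OF \<kappa>0] sc(2)[OF \<kappa>0] using mult_left_mono[OF conjunct1[OF strong], of K] K
    by (simp add: distrib_left mult.assoc)
  have "\<nu> powr (1/6) * K powr (5/6) * \<kappa> powr (1/2) * Ep \<le> 100000 * R\<^sup>2 * M"
    unfolding sc(3)[OF \<kappa>0] using mult_left_mono[OF conjunct2[OF strong], of K] K by (simp add: mult.assoc)
  \<comment> \<open>The bracket is at least 1, since both powers in it are nonnegative.\<close>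
  also have "\<dots> \<le> 100000 * R\<^sup>2 * ((\<nu> / K) powr (1/6) * ln R powr (1/2) + 1) * M"
  proof -
    have "1 * (100000 * R\<^sup>2 * M) \<le> ((\<nu> / K) powr (1/6) * ln R powr (1/2) + 1) * (100000 * R\<^sup>2 * M)"
      using M0 by (intro mult_right_mono) auto
    then show ?thesis by (simp only: mult_1 mult.assoc mult.left_commute)
  qed
  finally have 2: "\<nu> powr (1/6) * K powr (5/6) * \<kappa> powr (1/2) * Ep
      \<le> 100000 * R\<^sup>2 * ((\<nu> / K) powr (1/6) * ln R powr (1/2) + 1) * M" .
  have 3: "\<nu> * norm_H1r R w + \<nu> powr (2/3) * K powr (1/3) * norm_L2 R (divr w) \<le> 100000 * N"
    unfolding sc(1)[OF \<kappa>0] using mult_left_mono[OF conjunct1[OF weak], of K] K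
    by (subst \<nu>_eq) (simp add: distrib_left mult.assoc)
  have "\<nu> powr (1/2) * K powr (1/2) * Ep \<le> 100000 * R\<^sup>2 * N"
    unfolding sc(4)[OF \<kappa>0] using mult_left_mono[OF conjunct2[OF weak], of K] K by (simp add: mult.assoc)
  then have 4: "\<nu> powr (1/2) * K powr (1/2) * norm_L2 R \<phi>1
        + \<nu> powr (1/2) * \<kappa> * K powr (1/2) * norm_L2 R (divr \<phi>) \<le> 100000 * R\<^sup>2 * N"
    by (simp add: Ep_def distrib_left mult_ac)
  show "\<nu> powr (2/3) * K powr (1/3) * norm_L2 R (wderiv R w)
        + \<nu> powr (1/3) * K powr (2/3) * norm_L2 R (\<lambda>r. w r / of_real r)
        \<le> 100000 * norm_L2 R (\<lambda>r. of_real r * F r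
                - of_real (c' * \<nu> powr (1/3) * K powr (2/3)) * (w r / of_real r))
      \<and>
      \<nu> powr (1/6) * K powr (5/6) * of_int \<bar>k\<bar> powr (1/2)
        * (norm_L2 R (wderiv R \<phi>) + of_int \<bar>k\<bar> * norm_L2 R (\<lambda>r. \<phi> r / of_real r))
        \<le> 100000 * R\<^sup>2 * ((\<nu> / K) powr (1/6) * ln R powr (1/2) + 1)
            * norm_L2 R (\<lambda>r. of_real r * F r
                - of_real (c' * \<nu> powr (1/3) * K powr (2/3)) * (w r / of_real r))
      \<and>
      \<nu> * norm_H1r R w
        + \<nu> powr (2/3) * K powr (1/3) * norm_L2 R (\<lambda>r. w r / of_real r)
        \<le> 100000 * norm_Hm1r R (\<lambda>r. F r
                - of_real (c' * \<nu> powr (1/3) * K powr (2/3) / R\<^sup>2) * w r)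
      \<and>
      \<nu> powr (1/2) * K powr (1/2) * norm_L2 R (wderiv R \<phi>)
        + \<nu> powr (1/2) * of_int \<bar>k\<bar> * K powr (1/2) * norm_L2 R (\<lambda>r. \<phi> r / of_real r)
        \<le> 100000 * R\<^sup>2 * norm_Hm1r R (\<lambda>r. F r
                - of_real (c' * \<nu> powr (1/3) * K powr (2/3) / R\<^sup>2) * w r)"
    unfolding \<phi>1(4) \<kappa>_def[symmetric] M_def[symmetric] N_def[symmetric]
    using 1 2 3 4 unfolding Ep_def by blast
qed simp_all

end
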